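(* Let $F:\mathbb{R}^d\to\mathbb{R}$ be convex, differentiable with $L$-Lipschitz continuous gradient ($L>0$), and $\lambda$-strongly convex for some $\lambda\ge 0$ ($\lambda=0$ permitted). Let $\mathcal{H}:\mathcal{P}_2(\mathbb{R}^d)\to\mathbb{R}\cup\{+\infty\}$ be proper, lower semicontinuous (with respect to $W_2$) and convex along generalized geodesics, with $\operatorname{dom}(\mathcal{H})\subset\mathcal{P}_2^r(\mathbb{R}^d)$. Let $\mathcal{G}(\mu)=\int F\,d\mu+\mathcal{H}(\mu)$ and suppose $\operatorname{arg\,min}\mathcal{G}\neq\emptyset$. Let $\{\epsilon_n\}_{n\ge0}\subset \mathbb{R}_{\geq 0}$ with $\sum_{n=0}^{\infty} \epsilon_n < \infty$, let $\{\tau_n\}_{n\ge0} \subset \left(0,\frac{1}{L}\right)$ with $\sum_{i=0}^{\infty}\tau_i= \infty$ and $\sup_i \tau_i < \frac{1}{L}$, and let $\sigma_n:= \sum_{i=0}^{n-1}\tau_i$ for $n\in\mathbb{N}$. Let $\{\eta_n\}_{n\ge0}$ and $\{\mu_n\}_{n\ge0}$ in $\mathcal{P}_2(\mathbb{R}^d)$ satisfy, for all $n\in\mathbb{N}$, $\eta_{n}=(I-\tau_n \nabla F)_{\#}\mu_n$ and $$\mathcal{H}(\mu_{n+1})+\frac{1}{2\tau_n}W_2^2(\mu_{n+1},\eta_{n})\leq \mathcal{H}(J_{\tau_n,\mathcal{H}}(\eta_{n}))+\frac{1}{2\tau_n}W_2^2(J_{\tau_n,\mathcal{H}}(\eta_{n}),\eta_{n})+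 \frac{\epsilon_n^2}{2\tau_n}.$$ 1. It holds that $$\mathcal{G}(\beta_n)-\inf \mathcal{G} = O\left(\frac{1}{\sigma_n}\right) \quad \text{as } n\to \infty,$$ where $\beta_n := \mu_{j_n}$ with $j_n \in \operatorname{arg\,min}_{i=0,\dots,n-1}\mathcal{G}(\mu_i)$ (the best iterate). 2. If $\sum_{n=0}^{\infty}\frac{\sigma_n}{\tau_n}\epsilon_{n} < \infty$, then $$\mathcal{G}(\mu_n)-\inf \mathcal{G} = O\left(\frac{1}{\sigma_n}\right) \quad \text{as } n\to \infty,$$ and $\{\mu_n\}_n$ converges with respect to the topology $\tau_{w,2}$ to some $\mu^*\in \operatorname{arg\,min} \mathcal{G}$. In particular $W_p(\mu_n,\mu^* )\to 0$ for all $p\in[1,2)$.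
   Context: $\mathbb{N}$ includes $0$. $\mathcal{P}_2(\mathbb{R}^d)$ is the set of Borel probability measures on $\mathbb{R}^d$ with finite second moment; $\mathcal{P}_2^r(\mathbb{R}^d)$ is the subset of those absolutely continuous with respect to Lebesgue measure. For $p\in[1,2]$, $W_p$ is the $p$-Wasserstein distance for the Euclidean cost; $\Gamma_{\rm opt}(\mu,\nu)$ is the set of optimal couplings for $p=2$. $I$ is the identity map and $T_{\#}\mu$ the pushforward of $\mu$ by $T$. $\operatorname{dom}(\mathcal{H})=\{\mu:\mathcal{H}(\mu)<+\infty\}$. A generalized geodesic between $\mu_0,\mu_1\in\mathcal{P}_2(\mathbb{R}^d)$ with base $\nu\in\mathcal{P}_2(\mathbb{R}^d)$ is a curve $\mu_t=((1-t)\pi^2+t\pi^3)_{\#}\gamma$, $t\in[0,1]$, where $\gamma$ is a probability measure on $(\mathbb{R}^d)^3$ with marginals $\nu,\mu_0,\mu_1$ such that $\pi^{1,2}_{\#}\gamma\in\Gamma_{\rm opt}(\nu,\mu_0)$ and $\pi^{1,3}_{\#}\gamma\in\Gamma_{\rm opt}(\nu,\mu_1)$ ($\pi^i$, $\pi^{i,j}$ are the coordinate projections). A proper function $\mathcal{H}$ is convex along generalized geodesics if for every $\mu_0,\mu_1,\nu\in\mathcal{P}_2(\mathbb{R}^d)$ there is a generalized geodesic $(\mu_s)_{s\in[0,1]}$ between $\mu_0$ and $\mu_1$ with base $\nu$ such that $\mathcal{H}(\mu_s)\le(1-s)\mathcal{H}(\mu_0)+s\,\mathcal{H}(\mu_1)$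 for all $s\in[0,1]$. For $\tau>0$, $J_{\tau,\mathcal{H}}(\mu)$ is the (unique) minimizer of $\nu\mapsto \mathcal{H}(\nu)+\frac{1}{2\tau}W_2^2(\nu,\mu)$ over $\mathcal{P}_2(\mathbb{R}^d)$. Topology $\tau_{w,2}$: let $C_2^w(\mathbb{R}^d)$ be the space of continuous $f:\mathbb{R}^d\to\mathbb{R}$ with $\lim_{\|x\|\to\infty} f(x)/(1+\|x\|^2)=0$, normed by $\sup_x |f(x)|/(1+\|x\|^2)$. Its dual is the space of signed measures with finite second moment, and $\tau_{w,2}$ is the weak-$*$ topology restricted to $\mathcal{P}_2(\mathbb{R}^d)$; thus $\mu_n\to\mu$ in $\tau_{w,2}$ iff $\int f\,d\mu_n\to\int f\,d\mu$ for all $f\in C_2^w(\mathbb{R}^d)$. *)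

theory Defs
  imports "HOL-Probability.Probability"
begin

definition P2 :: "'a::euclidean_space measure set" where
  "P2 = {\<mu>. prob_space \<mu> \<and> sets \<mu> = sets borel \<and> integrable \<mu> (\<lambda>x. (norm x)\<^sup>2)}"

definition P2r :: "'a::euclidean_space measure set" where
  "P2r = {\<mu> \<in> P2. absolutely_continuous lborel \<mu>}"

definition couplings ::
    "'a::euclidean_space measure \<Rightarrow> 'a measure \<Rightarrow> ('a \<times> 'a) measure set" where
  "couplings \<mu> \<nu> = {\<gamma>. prob_space \<gamma> \<and> sets \<gamma> = sets borel \<and>
      distr \<gamma> borel fst = \<mu> \<and> distr \<gamma> borel snd = \<nu>}"

definition transport_cost :: "real \<Rightarrow> ('a::euclidean_space \<times> 'a) measure \<Rightarrow> ennreal" where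
  "transport_cost p \<gamma> = (\<integral>\<^sup>+ (x, y). ennreal (dist x y powr p) \<partial>\<gamma>)"

text \<open>Real-valued, because the infimum is finite for measures in \<open>P2\<close> and \<open>1 \<le> p \<le> 2\<close>; on other
  arguments the value may be meaningless.\<close>

definition wasserstein ::
    "real \<Rightarrow> 'a::euclidean_space measure \<Rightarrow> 'a measure \<Rightarrow> real" where
  "wasserstein p \<mu> \<nu> = enn2real (INF \<gamma>\<in>couplings \<mu> \<nu>. transport_cost p \<gamma>) powr (1 / p)"

definition opt_couplings ::
    "'a::euclidean_space measure \<Rightarrow> 'a measure \<Rightarrow> ('a \<times> 'a) measure set" where
  "opt_couplings \<mu> \<nu> = {\<gamma>. is_arg_min (transport_cost 2) (\<lambda>\<gamma>'. \<gamma>' \<in> couplings \<mu> \<nu>) \<gamma>}"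

definition generalized_geodesic ::
    "'a::euclidean_space measure \<Rightarrow> 'a measure \<Rightarrow> 'a measure \<Rightarrow> (real \<Rightarrow> 'a measure) \<Rightarrow> bool" where
  "generalized_geodesic \<nu> \<mu>\<^sub>0 \<mu>\<^sub>1 m \<longleftrightarrow>
    (\<exists>\<gamma> :: ('a \<times> 'a \<times> 'a) measure.
      prob_space \<gamma> \<and> sets \<gamma> = sets borel \<and>
      distr \<gamma> borel (\<lambda>(x, y, z). x) = \<nu> \<and>
      distr \<gamma> borel (\<lambda>(x, y, z). y) = \<mu>\<^sub>0 \<and>
      distr \<gamma> borel (\<lambda>(x, y, z). z) = \<mu>\<^sub>1 \<and>
      distr \<gamma> borel (\<lambda>(x, y, z). (x, y)) \<in> opt_couplings \<nu> \<mu>\<^sub>0 \<and>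
      distr \<gamma> borel (\<lambda>(x, y, z). (x, z)) \<in> opt_couplings \<nu> \<mu>\<^sub>1 \<and>
      (\<forall>t\<in>{0..1}. m t = distr \<gamma> borel (\<lambda>(x, y, z). (1 - t) *\<^sub>R y + t *\<^sub>R z)))"

text \<open>Functionals on \<open>P2\<close> are represented by total functions on measures with values in
  \<^typ>\<open>ereal\<close>; only their values on \<open>P2\<close> matter. A proper functional takes values in
  \<open>(-\<infinity>, +\<infinity>]\<close> and is not identically \<open>+\<infinity>\<close>.\<close>

definition proper_on_P2 :: "('a::euclidean_space measure \<Rightarrow> ereal) \<Rightarrow> bool" where
  "proper_on_P2 H \<longleftrightarrow> (\<forall>\<mu>\<in>P2. H \<mu> \<noteq> -\<infinity>) \<and> (\<exists>\<mu>\<in>P2. H \<mu> < \<infinity>)"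

definition effective_domain :: "('a::euclidean_space measure \<Rightarrow> ereal) \<Rightarrow> 'a measure set" where
  "effective_domain H = {\<mu> \<in> P2. H \<mu> < \<infinity>}"

definition lsc_W2 :: "('a::euclidean_space measure \<Rightarrow> ereal) \<Rightarrow> bool" where
  "lsc_W2 H \<longleftrightarrow> (\<forall>\<mu> m. \<mu> \<in> P2 \<longrightarrow> (\<forall>n. m n \<in> P2) \<longrightarrow>
      (\<lambda>n. wasserstein 2 (m n) \<mu>) \<longlonglongrightarrow> 0 \<longrightarrow> H \<mu> \<le> liminf (\<lambda>n. H (m n)))"

definition convex_along_generalized_geodesics ::
    "('a::euclidean_space measure \<Rightarrow> ereal) \<Rightarrow> bool" where
  "convex_along_generalized_geodesics H \<longleftrightarrow>
    (\<forall>\<mu>\<^sub>0\<in>P2. \<forall>\<mu>\<^sub>1\<in>P2. \<forall>\<nu>\<in>P2. \<exists>m. generalized_geodesic \<nu> \<mu>\<^sub>0 \<mu>\<^sub>1 m \<and>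
      (\<forall>s\<in>{0..1}. H (m s) \<le> ereal (1 - s) * H \<mu>\<^sub>0 + ereal s * H \<mu>\<^sub>1))"

definition prox_objective ::
    "real \<Rightarrow> ('a::euclidean_space measure \<Rightarrow> ereal) \<Rightarrow> 'a measure \<Rightarrow> 'a measure \<Rightarrow> ereal" where
  "prox_objective \<tau> H \<mu> \<nu> = H \<nu> + ereal (1 / (2 * \<tau>) * (wasserstein 2 \<nu> \<mu>)\<^sup>2)"

definition J :: "real \<Rightarrow> ('a::euclidean_space measure \<Rightarrow> ereal) \<Rightarrow> 'a measure \<Rightarrow> 'a measure" where
  "J \<tau> H \<mu> = arg_min (prox_objective \<tau> H \<mu>) (\<lambda>\<nu>. \<nu> \<in> P2)"

definition argmin_P2 :: "('a::euclidean_space measure \<Rightarrow> ereal) \<Rightarrow> 'a measure set" where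
  "argmin_P2 G = {\<mu>. is_arg_min G (\<lambda>\<nu>. \<nu> \<in> P2) \<mu>}"

definition strongly_convex :: "real \<Rightarrow> ('a::real_inner \<Rightarrow> real) \<Rightarrow> bool" where
  "strongly_convex l F \<longleftrightarrow> (\<forall>x y. \<forall>t\<in>{0..1}.
      F ((1 - t) *\<^sub>R x + t *\<^sub>R y)
        \<le> (1 - t) * F x + t * F y - l / 2 * t * (1 - t) * (norm (x - y))\<^sup>2)"

definition C2w :: "('a::euclidean_space \<Rightarrow> real) set" where
  "C2w = {f. continuous_on UNIV f \<and> ((\<lambda>x. f x / (1 + (norm x)\<^sup>2)) \<longlongrightarrow> 0) at_infinity}"

text \<open>The weak-* topology restricted to \<open>P2\<close> is the initial topology of the evaluations
  \<open>\<mu> \<mapsto> \<integral> f \<partial>\<mu>\<close> for \<open>f \<in> C2w\<close>, here obtained by pulling back the topology of pointwise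
  convergence on \<open>C2w\<close>.\<close>

definition tau_w2 :: "'a::euclidean_space measure topology" where
  "tau_w2 = pullback_topology P2 (\<lambda>\<mu>. \<lambda>f\<in>C2w. \<integral>x. f x \<partial>\<mu>)
      (product_topology (\<lambda>_. euclideanreal) C2w)"

lemma limitin_tau_w2:
  fixes m :: "nat \<Rightarrow> 'a::euclidean_space measure"
  assumes m: "\<And>n. m n \<in> P2" and \<mu>: "\<mu> \<in> P2"
  shows "limitin tau_w2 m \<mu> sequentially \<longleftrightarrow>
    (\<forall>f\<in>C2w. (\<lambda>n. \<integral>x. f x \<partial>m n) \<longlonglongrightarrow> (\<integral>x. f x \<partial>\<mu>))"
proof -
  define ev :: "'a measure \<Rightarrow> ('a \<Rightarrow> real) \<Rightarrow> real" where
    "ev = (\<lambda>\<mu>. \<lambda>f\<in>C2w. \<integral>x. f x \<partial>\<mu>)"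
  let ?T = "product_topology (\<lambda>_. euclideanreal) (C2w :: ('a \<Rightarrow> real) set)"
  have ev: "ev \<nu> \<in> topspace ?T" for \<nu>
    by (simp add: ev_def)
  have "limitin tau_w2 m \<mu> sequentially \<longleftrightarrow> limitin ?T (\<lambda>n. ev (m n)) (ev \<mu>) sequentially"
  proof
    assume "limitin tau_w2 m \<mu> sequentially"
    moreover have "continuous_map tau_w2 ?T (id \<circ> ev)"
      unfolding tau_w2_def ev_def by (rule continuous_map_pullback) simp
    ultimately show "limitin ?T (\<lambda>n. ev (m n)) (ev \<mu>) sequentially"
      using continuous_map_limit by (fastforce simp: o_def)
  next
    assume lim: "limitin ?T (\<lambda>n. ev (m n)) (ev \<mu>) sequentially"
    show "limitin tau_w2 m \<mu> sequentially"
      unfolding limitin_def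
    proof (intro conjI allI impI)
      show "\<mu> \<in> topspace tau_w2"
        using ev \<mu> by (simp add: tau_w2_def topspace_pullback_topology flip: ev_def)
      fix U assume "openin tau_w2 U \<and> \<mu> \<in> U"
      then obtain V where V: "openin ?T V" "U = ev -` V \<inter> P2" "ev \<mu> \<in> V"
        by (auto simp: tau_w2_def openin_pullback_topology simp flip: ev_def)
      with lim have "\<forall>\<^sub>F n in sequentially. ev (m n) \<in> V"
        by (auto simp: limitin_def)
      then show "\<forall>\<^sub>F n in sequentially. m n \<in> U"
        by eventually_elim (use V m in auto)
    qed
  qed
  also have "\<dots> \<longleftrightarrow> (\<forall>f\<in>C2w. (\<lambda>n. \<integral>x. f x \<partial>m n) \<longlonglongrightarrow> (\<integral>x. f x \<partial>\<mu>))"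
    by (simp add: limitin_componentwise ev_def)
  finally show ?thesis .
qed

end

theory Submission
  imports Defs
begin

text \<open>
  Testing the exact or inexact minimality of the backward step along a generalized geodesic based
  at \<open>\<eta>\<^sub>n\<close> gives an evolution variational inequality. For step sizes below \<open>1 / L\<close> the forward map
  \<open>I - \<tau> grad F\<close> is a bijection with Lipschitz inverse, so every coupling of \<open>\<eta>\<^sub>n\<close> lifts to a coupling of
  \<open>\<mu>\<^sub>n\<close> without gluing; together with the descent inequality for \<open>F\<close> this yields
  \<open>2\<tau>\<^sub>n (G \<mu>\<^sub>n\<^sub>+\<^sub>1 - G \<nu>) \<le> W\<^sub>2\<^sup>2(\<mu>\<^sub>n, \<nu>) - W\<^sub>2\<^sup>2(\<mu>\<^sub>n\<^sub>+\<^sub>1, \<nu>) + 2\<epsilon>\<^sub>n (W\<^sub>2(\<mu>\<^sub>n\<^sub>+\<^sub>1, \<nu>) + \<epsilon>\<^sub>n)\<close>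
  for all \<open>\<nu>\<close>. Summation gives both rates, and distances to minimizers converge.

  Compactness comes from the real line: a compact convex set is the image of \<open>\<real>\<close> under a continuous
  map with a Borel section, so Helly's and Skorohod's theorems for real distributions provide almost
  surely convergent representations of subsequences with bounded second moments. Fatou's lemma along
  such representations of optimal couplings proves Opial's inequality
  \<open>liminf (W\<^sub>2\<^sup>2(m\<^sub>n, \<nu>) - W\<^sub>2\<^sup>2(m\<^sub>n, \<mu>)) \<ge> W\<^sub>2\<^sup>2(\<mu>, \<nu>)\<close> for \<open>m\<^sub>n\<close> converging narrowly to \<open>\<mu>\<close>. It replaces
  the weak lower semicontinuity of \<open>H\<close> in showing that cluster points of the iterates are minimizers,
  and it shows that there is only one of them.
\<close>

section \<open>Almost surely convergent representations\<close>

text \<open>The assumption \<open>lsc\<close> speaks of \<open>W2\<close>-convergent sequences,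
  whereas a bound on second moments yields only narrow cluster points, so \<open>H\<close> cannot be
  passed to the limit along the iterates. Semicontinuity is used for the minimizing sequences of
  proximal problems, where strong convexity upgrades narrow convergence to \<open>W2\<close>
  convergence. The bound \<open>1 / L\<close> lets the term
  \<open>L / 2 * (norm (y - x))\<^sup>2\<close> of the descent inequality be absorbed by the
  penalty, so no distance between consecutive iterates is left over. The same bound makes proximal
  problems along the iteration bounded below. Testing an inexact step at parameter \<open>s\<close>
  of a geodesic costs \<open>\<epsilon>\<^sup>2 / s\<close> and loses the fraction \<open>s\<close>
  of the contraction; balancing the two makes the error linear in \<epsilon>, which is why
  summability of \<epsilon> controls the distances. For the last iterate the descent error
  \<open>\<epsilon>\<^sup>2 / (2 * \<tau>)\<close> is multiplied by \<sigma>, whence the weight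
  \<sigma> / \<tau> in the second assumption.\<close>

text \<open>At the first differing digit \<open>m\<close> the sums separate by
  \<open>(1/3)^m\<close>, and all later digits together recover at most half of that. Base 3 is
  essential: in base 2 the tail could cancel the leading difference completely.\<close>

lemma ternary_digits_agree:
  fixes a b :: "nat \<Rightarrow> real"
  assumes a: "\<And>k. a k \<in> {0, 1}" and b: "\<And>k. b k \<in> {0, 1}"
    and less: "\<bar>(\<Sum>k. (1/3)^k * a k) - (\<Sum>k. (1/3)^k * b k)\<bar> < (1/3)^N / 2"
    and "k \<le> N"
  shows "a k = b k"
proof (rule ccontr)
  assume "a k \<noteq> b k"
  define m where "m = (LEAST m. a m \<noteq> b m)"
  have m: "a m \<noteq> b m"
    unfolding m_def by (rule LeastI[where P = "\<lambda>m. a m \<noteq> b m"]) fact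
  have "m \<le> k"
    unfolding m_def by (rule Least_le[where P = "\<lambda>m. a m \<noteq> b m"]) fact
  have before: "a j = b j" if "j < m" for j
    using not_less_Least[of j "\<lambda>m. a m \<noteq> b m"] that by (auto simp: m_def)
  define f where "f j = (1/3)^j * (a j - b j)" for j
  have g: "summable (\<lambda>j. (1/3::real)^j)" by (simp add: summable_geometric)
  have bd: "\<bar>a j\<bar> \<le> 1" "\<bar>b j\<bar> \<le> 1" "\<bar>a j - b j\<bar> \<le> 1" for j
    using a[of j] b[of j] by auto
  have sa: "summable (\<lambda>j. (1/3)^j * a j)" and sb: "summable (\<lambda>j. (1/3)^j * b j)"
    by (rule summable_comparison_test'[OF g, of 0], use bd in \<open>simp add: abs_mult mult_left_le\<close>)+
  have sf: "summable f"
    unfolding f_def right_diff_distrib by (intro summable_diff sa sb)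
  have "(\<Sum>k. (1/3)^k * a k) - (\<Sum>k. (1/3)^k * b k) = suminf f"
    unfolding f_def right_diff_distrib by (rule suminf_diff[OF sa sb])
  also have "\<dots> = (\<Sum>j. f (j + Suc m)) + (\<Sum>j<Suc m. f j)"
    by (rule suminf_split_initial_segment[OF sf])
  also have "(\<Sum>j<Suc m. f j) = f m"
    using before by (simp add: f_def)
  finally have eq: "(\<Sum>k. (1/3)^k * a k) - (\<Sum>k. (1/3)^k * b k) = (\<Sum>j. f (j + Suc m)) + f m" .
  have gs: "(\<lambda>j. (1/3::real)^Suc m * (1/3)^j) sums ((1/3)^Suc m * (1 / (1 - 1/3)))"
    by (intro sums_mult geometric_sums) simp
  have "\<bar>\<Sum>j. f (j + Suc m)\<bar> \<le> (\<Sum>j. (1/3)^Suc m * (1/3)^j)"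
    unfolding real_norm_def[symmetric]
  proof (rule norm_suminf_le[OF _ sums_summable[OF gs]])
    show "norm (f (j + Suc m)) \<le> (1/3)^Suc m * (1/3)^j" for j
      using bd(3)[of "j + Suc m"]
      by (simp add: f_def abs_mult power_add mult_left_le mult.commute mult.left_commute)
  qed
  also have "\<dots> = (1/3)^m / 2"
    using sums_unique[OF gs] by simp
  finally have tail: "\<bar>\<Sum>j. f (j + Suc m)\<bar> \<le> (1/3)^m / 2" .
  have "\<bar>f m\<bar> = (1/3)^m"
    using m a[of m] b[of m] by (auto simp: f_def abs_mult)
  moreover have "(1/3::real)^N \<le> (1/3)^m"
    using \<open>m \<le> k\<close> \<open>k \<le> N\<close> by (intro power_decreasing) auto
  ultimately show False
    using less eq tail by linarith
qed

text \<open>A point is coded by its membership in the sets of a countable base, read as ternary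
  digits. The code is merely Borel, but its inverse is uniformly continuous on \<open>B\<close>: by
  compactness finitely many small basic sets cover \<open>B\<close>, and sufficiently close codes
  agree on membership in all of them.\<close>

lemma borel_coding_compact:
  fixes B :: "'a::euclidean_space set"
  assumes "compact B"
  obtains s :: "'a \<Rightarrow> real" where "s \<in> borel_measurable borel" "\<And>x. s x \<in> {0..2}"
    "\<And>e. e > 0 \<Longrightarrow> \<exists>d>0. \<forall>x\<in>B. \<forall>y\<in>B. \<bar>s x - s y\<bar> < d \<longrightarrow> dist x y < e"
proof -
  obtain A :: "nat \<Rightarrow> 'a set" where opn: "\<And>n. open (A n)"
    and basis: "\<And>S. open S \<Longrightarrow> \<exists>k. S = \<Union>{A n |n. n \<in> k}"
    by (rule univ_second_countable_sequence) blast
  define s where "s x = (\<Sum>k. (1/3)^k * indicator (A k) x :: real)" for x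
  have [measurable]: "A k \<in> sets borel" for k
    using opn by simp
  have g: "summable (\<lambda>j. (1/3::real)^j)" by (simp add: summable_geometric)
  have sm: "summable (\<lambda>k. (1/3)^k * indicator (A k) x :: real)" for x
    by (rule summable_comparison_test'[OF g, of 0]) (auto simp: indicator_def)
  show ?thesis
  proof
    show "s \<in> borel_measurable borel"
      unfolding s_def by measurable
    show "s x \<in> {0..2}" for x
    proof -
      have "s x \<le> (\<Sum>k. (1/3)^k)"
        unfolding s_def by (intro suminf_le sm g) (auto simp: indicator_def)
      also have "\<dots> = 3/2"
        by (subst suminf_geometric) auto
      finally show ?thesis
        unfolding s_def using suminf_nonneg[OF sm] by auto
    qed
    fix e :: real assume "e > 0"
    have "\<exists>n. x \<in> A n \<and> A n \<subseteq> ball x (e/2)" for x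
    proof -
      obtain k where k: "ball x (e/2) = \<Union>{A n |n. n \<in> k}"
        using basis[of "ball x (e/2)"] by auto
      moreover have "x \<in> ball x (e/2)"
        using \<open>e > 0\<close> by simp
      ultimately obtain n where "n \<in> k" "x \<in> A n" by blast
      moreover have "A n \<subseteq> ball x (e/2)"
        unfolding k using \<open>n \<in> k\<close> by blast
      ultimately show ?thesis by blast
    qed
    then obtain n where n: "\<And>x. x \<in> A (n x)" "\<And>x. A (n x) \<subseteq> ball x (e/2)"
      by metis
    obtain D where D: "D \<subseteq> B" "finite D" "B \<subseteq> (\<Union>x\<in>D. A (n x))"
      by (rule compactE_image[OF assms, of B "\<lambda>x. A (n x)"]) (use opn n in auto)
    define N where "N = Max (insert 0 (n ` D))"
    have N: "n x \<le> N" if "x \<in> D" for x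
      unfolding N_def using that \<open>finite D\<close> by (intro Max_ge) auto
    show "\<exists>d>0. \<forall>x\<in>B. \<forall>y\<in>B. \<bar>s x - s y\<bar> < d \<longrightarrow> dist x y < e"
    proof (intro exI[of _ "(1/3)^N/2"] conjI ballI impI)
      fix x y assume "x \<in> B" "y \<in> B" and less: "\<bar>s x - s y\<bar> < (1/3)^N/2"
      obtain z where z: "z \<in> D" "x \<in> A (n z)"
        using D \<open>x \<in> B\<close> by blast
      have "(indicator (A (n z)) x :: real) = indicator (A (n z)) y"
        by (rule ternary_digits_agree[where N = N and a = "\<lambda>k. indicator (A k) x" and b = "\<lambda>k. indicator (A k) y"])
           (use less N z in \<open>auto simp: s_def indicator_def\<close>)
      then have "y \<in> A (n z)"
        using z by (auto simp: indicator_def split: if_splits)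
      then have "x \<in> ball z (e/2)" "y \<in> ball z (e/2)"
        using n z by blast+
      then show "dist x y < e"
        by (simp add: dist_triangle_half_r)
    qed simp
  qed
qed

text \<open>A Borel section of a continuous map onto \<open>B\<close>: it transfers Helly's selection theorem and
  Skorohod's theorem from the real line to \<open>B\<close>.\<close>

lemma compact_continuous_image_of_line:
  fixes B :: "'a::euclidean_space set"
  assumes "compact B" "convex B" "B \<noteq> {}"
  obtains s :: "'a \<Rightarrow> real" and q :: "real \<Rightarrow> 'a" where
    "s \<in> borel_measurable borel" "\<And>x. s x \<in> {0..2}"
    "continuous_on UNIV q" "range q \<subseteq> B" "\<And>x. x \<in> B \<Longrightarrow> q (s x) = x"
proof -
  obtain s :: "'a \<Rightarrow> real" where s: "s \<in> borel_measurable borel" "\<And>x. s x \<in> {0..2}"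
    and sep: "\<And>e. e > 0 \<Longrightarrow> \<exists>d>0. \<forall>x\<in>B. \<forall>y\<in>B. \<bar>s x - s y\<bar> < d \<longrightarrow> dist x y < e"
    using borel_coding_compact[OF \<open>compact B\<close>] by metis
  define p where "p = inv_into B s"
  have "inj_on s B"
  proof (rule inj_onI, rule ccontr)
    fix x y assume "x \<in> B" "y \<in> B" "s x = s y" "x \<noteq> y"
    with sep[of "dist x y"] show False
      by (metis abs_zero diff_self less_irrefl zero_less_dist_iff)
  qed
  then have p: "p (s x) = x" if "x \<in> B" for x
    using that by (simp add: p_def)
  have "uniformly_continuous_on (s ` B) p"
    unfolding uniformly_continuous_on_def
  proof (intro allI impI)
    fix e :: real assume "e > 0"
    with sep obtain d where "d > 0" "\<forall>x\<in>B. \<forall>y\<in>B. \<bar>s x - s y\<bar> < d \<longrightarrow> dist x y < e"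
      by blast
    then show "\<exists>d>0. \<forall>x\<in>s ` B. \<forall>x'\<in>s ` B. dist x' x < d \<longrightarrow> dist (p x') (p x) < e"
      by (intro exI[of _ d]) (auto simp: p dist_real_def)
  qed
  \<comment> \<open>A limit of codes need not be a code, so the inverse must also be defined on the
    closure; uniform continuity provides the extension.\<close>
  then obtain g where g: "uniformly_continuous_on (closure (s ` B)) g" "\<And>u. u \<in> s ` B \<Longrightarrow> p u = g u"
    by (rule uniformly_continuous_on_extension_on_closure) blast
  have cont: "continuous_on (closure (s ` B)) g"
    using g by (simp add: uniformly_continuous_imp_continuous)
  have "g ` closure (s ` B) \<subseteq> B"
  proof (rule image_closure_subset[OF cont])
    show "closed B" using \<open>compact B\<close> by (rule compact_imp_closed)
    show "g ` (s ` B) \<subseteq> B" using g(2) p by auto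
  qed
  \<comment> \<open>Dugundji's extension keeps its values in the convex set \<open>B\<close>, so
    \<open>q\<close> decodes every real number to a point of \<open>B\<close>.\<close>
  then obtain q where "continuous_on UNIV q" "q ` UNIV \<subseteq> B"
    "\<And>u. u \<in> closure (s ` B) \<Longrightarrow> q u = g u"
    using Dugundji[OF \<open>convex B\<close> \<open>B \<noteq> {}\<close>, of UNIV "closure (s ` B)" g] cont by auto
  moreover from this have "q (s x) = x" if "x \<in> B" for x
    using that g(2)[of "s x"] p[of x] closure_subset[of "s ` B"] by auto
  ultimately show ?thesis
    using that s by metis
qed

section \<open>Narrow convergence and uniqueness of its limits\<close>

definition narrow_conv :: "(nat \<Rightarrow> 'a::topological_space measure) \<Rightarrow> 'a measure \<Rightarrow> bool" where
  "narrow_conv m \<mu> \<longleftrightarrow> (\<forall>f :: 'a \<Rightarrow> real. continuous_on UNIV f \<longrightarrow> bounded (range f) \<longrightarrow>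
     (\<lambda>n. \<integral>x. f x \<partial>m n) \<longlonglongrightarrow> (\<integral>x. f x \<partial>\<mu>))"

lemma narrow_conv_subseq:
  "narrow_conv m \<mu> \<Longrightarrow> strict_mono r \<Longrightarrow> narrow_conv (\<lambda>n. m (r n)) \<mu>"
  unfolding narrow_conv_def
  using LIMSEQ_subseq_LIMSEQ[of "\<lambda>n. integral\<^sup>L (m n) f" for f] by (fastforce simp: o_def)

lemma narrow_conv_distr:
  fixes X :: "nat \<Rightarrow> 'b \<Rightarrow> 'a::{second_countable_topology, topological_space}"
  assumes "prob_space M" and [measurable]: "\<And>n. X n \<in> borel_measurable M" "Y \<in> borel_measurable M"
    and lim: "AE \<omega> in M. (\<lambda>n. X n \<omega>) \<longlonglongrightarrow> Y \<omega>"
  shows "narrow_conv (\<lambda>n. distr M borel (X n)) (distr M borel Y)"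
  unfolding narrow_conv_def
proof (intro allI impI)
  interpret prob_space M by fact
  fix f :: "'a \<Rightarrow> real" assume f: "continuous_on UNIV f" "bounded (range f)"
  have [measurable]: "f \<in> borel_measurable borel"
    using f(1) by (rule borel_measurable_continuous_onI)
  obtain K where K: "\<And>x. norm (f x) \<le> K"
    using f(2) by (auto simp: bounded_iff)
  have "(\<lambda>n. \<integral>\<omega>. f (X n \<omega>) \<partial>M) \<longlonglongrightarrow> (\<integral>\<omega>. f (Y \<omega>) \<partial>M)"
  proof (rule integral_dominated_convergence[where w = "\<lambda>_. K"])
    show "AE \<omega> in M. (\<lambda>n. f (X n \<omega>)) \<longlonglongrightarrow> f (Y \<omega>)"
      using lim f(1) by (auto elim!: eventually_mono intro!: continuous_on_tendsto_compose[OF f(1)])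
  qed (use K in auto)
  then show "(\<lambda>n. integral\<^sup>L (distr M borel (X n)) f) \<longlonglongrightarrow> integral\<^sup>L (distr M borel Y) f"
    by (simp add: integral_distr)
qed

text \<open>Open sets form an intersection-stable generator, and the indicator of an open set is the
  pointwise limit of truncated multiples of the distance to its complement.\<close>

lemma measure_eqI_bounded_continuous:
  fixes \<mu> \<nu> :: "'a::metric_space measure"
  assumes "prob_space \<mu>" "prob_space \<nu>" and sets: "sets \<mu> = sets borel" "sets \<nu> = sets borel"
    and eq: "\<And>f :: 'a \<Rightarrow> real. continuous_on UNIV f \<Longrightarrow> bounded (range f) \<Longrightarrow>
      (\<integral>x. f x \<partial>\<mu>) = (\<integral>x. f x \<partial>\<nu>)"
  shows "\<mu> = \<nu>"
proof (rule measure_eqI_generator_eq[where E = "{S. open S}" and \<Omega> = UNIV and A = "\<lambda>_. UNIV"])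
  interpret \<mu>: prob_space \<mu> by fact
  interpret \<nu>: prob_space \<nu> by fact
  show "sets \<mu> = sigma_sets UNIV {S. open S}" "sets \<nu> = sigma_sets UNIV {S. open S}"
    using sets by (simp_all add: borel_def)
  have [simp]: "space \<mu> = UNIV" "space \<nu> = UNIV"
    using sets[THEN sets_eq_imp_space_eq] by auto
  show "emeasure \<mu> UNIV \<noteq> \<infinity>"
    by simp
  fix U :: "'a set" assume "U \<in> {S. open S}"
  then have U: "open U" by simp
  show "emeasure \<mu> U = emeasure \<nu> U"
  \<comment> \<open>The distance to the empty set is 0 by convention, so the approximating functions
    below would vanish for the whole space.\<close>
  proof (cases "U = UNIV")
    case True
    then show ?thesis
      using \<mu>.emeasure_space_1 \<nu>.emeasure_space_1 by simp
  next
    case False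
    define f where "f k x = min 1 (real k * infdist x (- U))" for k x
    have cont: "continuous_on UNIV (f k)" for k
      unfolding f_def by (intro continuous_intros)
    have bd: "norm (f k x) \<le> 1" for k x
      unfolding f_def using infdist_nonneg[of x "- U"] by (auto simp: min_def mult_nonneg_nonneg)
    have lim: "(\<lambda>k. f k x) \<longlonglongrightarrow> indicator U x" for x
    proof (cases "x \<in> U")
      case True
      have "infdist x (- U) \<noteq> 0"
        using in_closed_iff_infdist_zero[of "- U" x] False True U by auto
      then have pos: "infdist x (- U) > 0"
        using infdist_nonneg[of x "- U"] by linarith
      obtain N where N: "real N > 1 / infdist x (- U)"
        using reals_Archimedean2 by blast
      have "f k x = 1" if "k \<ge> N" for k
      proof -
        have "1 < real N * infdist x (- U)"
          using N pos by (simp add: field_simps)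
        also have "\<dots> \<le> real k * infdist x (- U)"
          using that pos by (intro mult_right_mono) auto
        finally show ?thesis by (simp add: f_def)
      qed
      then have "\<forall>\<^sub>F k in sequentially. f k x = 1"
        by (auto simp: eventually_sequentially)
      then show ?thesis
        using True by (simp add: tendsto_eventually)
    next
      case False
      then show ?thesis by (simp add: f_def)
    qed
    have "(\<lambda>k. \<integral>x. f k x \<partial>M) \<longlonglongrightarrow> measure M U" if "prob_space M" "sets M = sets borel" for M
    proof -
      interpret prob_space M by fact
      have [measurable]: "U \<in> sets M" "f k \<in> borel_measurable M" for k
        using that U borel_measurable_continuous_onI[OF cont[of k]]
        by (auto simp: measurable_cong_sets[OF that(2) refl])
      have "(\<lambda>k. \<integral>x. f k x \<partial>M) \<longlonglongrightarrow> (\<integral>x. indicator U x \<partial>M)"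
        by (rule integral_dominated_convergence[where w = "\<lambda>_. 1"]) (use bd lim in auto)
      then show ?thesis
        by simp
    qed
    from this[OF assms(1) sets(1)] this[OF assms(2) sets(2)]
    have lims: "(\<lambda>k. \<integral>x. f k x \<partial>\<mu>) \<longlonglongrightarrow> measure \<mu> U" "(\<lambda>k. \<integral>x. f k x \<partial>\<nu>) \<longlonglongrightarrow> measure \<nu> U" .
    have "bounded (range (f k))" for k
      using bd by (auto simp: bounded_iff)
    then have "(\<integral>x. f k x \<partial>\<mu>) = (\<integral>x. f k x \<partial>\<nu>)" for k
      by (intro eq cont)
    then have "measure \<mu> U = measure \<nu> U"
      using lims by (simp add: LIMSEQ_unique)
    then show ?thesis
      by (simp add: \<mu>.emeasure_eq_measure \<nu>.emeasure_eq_measure)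
  qed
qed (auto simp: Int_stable_def)

lemma narrow_conv_unique:
  fixes \<mu> \<nu> :: "'a::metric_space measure"
  assumes "narrow_conv m \<mu>" "narrow_conv m \<nu>" "prob_space \<mu>" "prob_space \<nu>"
    and "sets \<mu> = sets borel" "sets \<nu> = sets borel"
  shows "\<mu> = \<nu>"
  using assms unfolding narrow_conv_def
  by (intro measure_eqI_bounded_continuous) (auto intro: LIMSEQ_unique)

lemma tight_bounded_support:
  assumes "\<And>n. real_distribution (\<nu> n)" and "\<And>n. AE x in \<nu> n. x \<in> {0..2}"
  shows "tight \<nu>"
  unfolding tight_def
proof (intro conjI allI impI)
  fix e :: real assume "e > 0"
  have "measure (\<nu> n) {-1<..3} > 1 - e" for n
  proof -
    interpret real_distribution "\<nu> n" by fact
    have "AE x in \<nu> n. x \<in> {-1<..3}"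
      using assms(2)[of n] by (rule eventually_mono) auto
    then have "prob {-1<..3} = 1"
      by (intro prob_eq_1[THEN iffD2]) auto
    then show ?thesis
      using \<open>e > 0\<close> by simp
  qed
  then show "\<exists>a b. a < b \<and> (\<forall>n. measure (\<nu> n) {a<..b} > 1 - e)"
    by (intro exI[of _ "-1"] exI[of _ 3]) auto
qed (use assms in auto)

section \<open>Representations of sequences with bounded second moments\<close>

lemma P2D:
  assumes "\<mu> \<in> P2"
  shows "prob_space \<mu>" "sets \<mu> = sets borel" "space \<mu> = UNIV" "integrable \<mu> (\<lambda>x. (norm x)\<^sup>2)"
  using assms by (auto simp: P2_def dest: sets_eq_imp_space_eq)

text \<open>The map \<open>h\<close> compresses the space radially into the open unit ball, with
  inverse \<open>k\<close>. Coding the closed ball by \<open>s\<close> turns the laws into tight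
  real distributions, and the convergent variables found on the line are carried back by
  \<open>q\<close> and \<open>k\<close>. Since \<open>k\<close> is continuous only inside the ball,
  the limit must put no mass on the sphere; this is where the moment bound enters.\<close>

lemma skorohod_subsequence_P2:
  fixes m :: "nat \<Rightarrow> 'a::euclidean_space measure"
  assumes m: "\<And>n. m n \<in> P2" and C: "\<And>n. (\<integral>x. (norm x)\<^sup>2 \<partial>m n) \<le> C"
  obtains r :: "nat \<Rightarrow> nat" and M :: "real measure" and X Y where
    "strict_mono r" "prob_space M" "\<And>n. X n \<in> borel_measurable M" "Y \<in> borel_measurable M"
    "\<And>n. distr M borel (X n) = m (r n)" "AE \<omega> in M. (\<lambda>n. X n \<omega>) \<longlonglongrightarrow> Y \<omega>"
proof -
  define h where "h x = (1 / (1 + norm x)) *\<^sub>R x" for x :: 'a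
  define k where "k z = (1 / (1 - norm z)) *\<^sub>R z" for z :: 'a
  have norm_h: "norm (h x) = norm x / (1 + norm x)" for x
    by (simp add: h_def)
  have pos: "1 + norm x > 0" for x :: 'a
    using norm_ge_zero[of x] by linarith
  have one_h: "1 - norm (h x) = 1 / (1 + norm x)" for x
    using pos[of x] by (simp add: norm_h field_simps)
  have h1: "norm (h x) < 1" for x
    using pos[of x] one_h[of x] by (smt (verit) zero_less_divide_1_iff)
  have kh: "k (h x) = x" for x
    using pos[of x] unfolding k_def one_h by (simp add: h_def)
  have [measurable]: "h \<in> borel_measurable borel" "k \<in> borel_measurable borel"
    unfolding h_def k_def by measurable
  obtain s :: "'a \<Rightarrow> real" and q :: "real \<Rightarrow> 'a" where
    [measurable]: "s \<in> borel_measurable borel" and s: "\<And>x. s x \<in> {0..2}"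
    and q: "continuous_on UNIV q" "range q \<subseteq> cball 0 1" "\<And>x. x \<in> cball 0 1 \<Longrightarrow> q (s x) = x"
    by (rule compact_continuous_image_of_line[of "cball 0 1"]) auto
  have [measurable]: "q \<in> borel_measurable borel"
    using q(1) by (rule borel_measurable_continuous_onI)
  have q1: "norm (q u) \<le> 1" for u
    using q(2) by (auto simp: image_subset_iff)
  have qsh: "q (s (h x)) = h x" for x
    using h1[of x] by (intro q(3)) auto
  define \<nu> where "\<nu> n = distr (m n) borel (\<lambda>x. s (h x))" for n
  note P = P2D[OF m]
  have sets_m [measurable_cong]: "sets (m n) = sets borel" for n
    by (rule P)
  have real: "real_distribution (\<nu> n)" for n
  proof -
    interpret prob_space "m n" by (rule P)
    show ?thesis
      unfolding \<nu>_def by (intro real_distribution_distr) measurable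
  qed
  have "tight \<nu>"
    using real
  proof (rule tight_bounded_support)
    show "AE x in \<nu> n. x \<in> {0..2}" for n
      unfolding \<nu>_def using s by (subst AE_distr_iff) (auto simp del: atLeastAtMost_iff)
  qed
  from tight_imp_convergent_subsubsequence[OF this strict_mono_id]
  obtain r N where r: "strict_mono r" "real_distribution N" "weak_conv_m (\<lambda>n. \<nu> (r n)) N"
    by (auto simp: o_def id_def)
  from Skorohod[of "\<lambda>n. \<nu> (r n)" N] r real
  obtain M U V where M: "prob_space (M :: real measure)"
    and U [measurable]: "\<And>n. U n \<in> borel_measurable M" and dU: "\<And>n. distr M borel (U n) = \<nu> (r n)"
    and V [measurable]: "V \<in> borel_measurable M"
    and UV: "\<And>\<omega>. \<omega> \<in> space M \<Longrightarrow> (\<lambda>n. U n \<omega>) \<longlonglongrightarrow> V \<omega>"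
    by (metis measurable_lborel1)
  interpret prob_space M by (rule M)
  define X where "X n \<omega> = k (q (U n \<omega>))" for n \<omega>
  define Y where "Y \<omega> = k (q (V \<omega>))" for \<omega>
  have mX [measurable]: "X n \<in> borel_measurable M" and mY: "Y \<in> borel_measurable M" for n
    unfolding X_def Y_def by measurable
  \<comment> \<open>The map \<open>q\<close> inverts \<open>s\<close> only on the ball, but the
    range of \<open>h\<close> lies there, so decoding recovers the laws exactly although
    \<open>s\<close> is just Borel.\<close>
  have dX: "distr M borel (X n) = m (r n)" for n
  proof -
    have "distr M borel (X n) = distr (\<nu> (r n)) borel (\<lambda>u. k (q u))"
      unfolding dU[symmetric] X_def by (subst distr_distr) (auto simp: o_def)
    also have "\<dots> = distr (m (r n)) borel (\<lambda>x. x)"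
      unfolding \<nu>_def by (subst distr_distr) (auto simp: o_def qsh kh)
    also have "\<dots> = m (r n)"
      by (rule distr_id2) (simp add: sets_m)
    finally show ?thesis .
  qed
  have Q: "(\<lambda>n. q (U n \<omega>)) \<longlonglongrightarrow> q (V \<omega>)" if "\<omega> \<in> space M" for \<omega>
    using continuous_on_tendsto_compose[OF q(1) UV[OF that]] by auto
  \<comment> \<open>The inverse is taken in the extended reals so that it is infinite on the sphere.
    Along the sequence it equals \<open>1 + norm x\<close>, whose expectation is controlled by the
    second moment; Fatou's lemma then excludes mass of the limit on the sphere.\<close>
  let ?g = "\<lambda>u. inverse (ennreal (1 - norm (q u)))"
  have bound: "(\<integral>\<^sup>+\<omega>. ?g (U n \<omega>) \<partial>M) \<le> ennreal (2 + C)" for n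
  proof -
    interpret mn: prob_space "m (r n)" by (rule P)
    have "(\<integral>\<^sup>+\<omega>. ?g (U n \<omega>) \<partial>M) = (\<integral>\<^sup>+u. ?g u \<partial>distr M borel (U n))"
      by (subst nn_integral_distr) auto
    also have "\<dots> = (\<integral>\<^sup>+x. ?g (s (h x)) \<partial>m (r n))"
      unfolding dU \<nu>_def by (subst nn_integral_distr) auto
    also have "\<dots> \<le> (\<integral>\<^sup>+x. ennreal (2 + (norm x)\<^sup>2) \<partial>m (r n))"
    proof (rule nn_integral_mono)
      fix x
      have "?g (s (h x)) = ennreal (1 + norm x)"
        using pos[of x] by (simp add: qsh one_h inverse_ennreal)
      also have "1 + norm x \<le> 2 + (norm x)\<^sup>2"
        using zero_le_power2[of "norm x - 1"] by (simp add: power2_diff) (smt (verit) norm_ge_zero zero_le_power2)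
      finally show "?g (s (h x)) \<le> ennreal (2 + (norm x)\<^sup>2)"
        by (simp add: ennreal_leI)
    qed
    also have "\<dots> = ennreal (\<integral>x. 2 + (norm x)\<^sup>2 \<partial>m (r n))"
      using P(4) by (intro nn_integral_eq_integral) auto
    also have "\<dots> \<le> ennreal (2 + C)"
    proof (rule ennreal_leI)
      have "(\<integral>x. 2 + (norm x)\<^sup>2 \<partial>m (r n)) = 2 + (\<integral>x. (norm x)\<^sup>2 \<partial>m (r n))"
        using P(4) by (subst Bochner_Integration.integral_add) (auto simp: mn.prob_space)
      then show "(\<integral>x. 2 + (norm x)\<^sup>2 \<partial>m (r n)) \<le> 2 + C"
        using C[of "r n"] by simp
    qed
    finally show ?thesis .
  qed
  have "(\<integral>\<^sup>+\<omega>. ?g (V \<omega>) \<partial>M) = (\<integral>\<^sup>+\<omega>. liminf (\<lambda>n. ?g (U n \<omega>)) \<partial>M)"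
  proof (rule nn_integral_cong)
    fix \<omega> assume "\<omega> \<in> space M"
    then have "(\<lambda>n. ?g (U n \<omega>)) \<longlonglongrightarrow> ?g (V \<omega>)"
      using Q by (intro continuous_on_tendsto_compose[OF continuous_on_inverse_ennreal[OF continuous_on_id, of UNIV]] tendsto_intros) auto
    then show "?g (V \<omega>) = liminf (\<lambda>n. ?g (U n \<omega>))"
      by (simp add: lim_imp_Liminf)
  qed
  also have "\<dots> \<le> liminf (\<lambda>n. \<integral>\<^sup>+\<omega>. ?g (U n \<omega>) \<partial>M)"
    by (rule nn_integral_liminf) auto
  also have "\<dots> \<le> ennreal (2 + C)"
    using bound by (intro Liminf_le) auto
  finally have "(\<integral>\<^sup>+\<omega>. ?g (V \<omega>) \<partial>M) < \<infinity>"
    by (rule le_less_trans) simp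
  then have "AE \<omega> in M. ?g (V \<omega>) \<noteq> \<infinity>"
    by (intro nn_integral_PInf_AE) (auto simp: less_top)
  then have lt: "AE \<omega> in M. norm (q (V \<omega>)) < 1"
  proof (eventually_elim)
    fix \<omega> assume "?g (V \<omega>) \<noteq> \<infinity>"
    then have "norm (q (V \<omega>)) \<noteq> 1" by auto
    then show "norm (q (V \<omega>)) < 1" using q1[of "V \<omega>"] by simp
  qed
  have "AE \<omega> in M. (\<lambda>n. X n \<omega>) \<longlonglongrightarrow> Y \<omega>"
    using lt AE_space
  proof eventually_elim
    case (elim \<omega>)
    then show ?case
      unfolding X_def Y_def k_def by (intro tendsto_intros Q) auto
  qed
  then show ?thesis
    using that r(1) M mX mY dX by blast
qed

section \<open>Couplings and the quadratic Wasserstein distance\<close>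

lemma fatou_nonneg:
  fixes f :: "nat \<Rightarrow> 'a \<Rightarrow> real"
  assumes int: "\<And>n. integrable M (f n)" and [measurable]: "g \<in> borel_measurable M"
    and nonneg: "\<And>n. AE x in M. 0 \<le> f n x"
    and lim: "AE x in M. (\<lambda>n. f n x) \<longlonglongrightarrow> g x"
    and le: "\<And>n. (\<integral>x. f n x \<partial>M) \<le> b"
  shows "integrable M g" "(\<integral>x. g x \<partial>M) \<le> b"
proof -
  have [measurable]: "f n \<in> borel_measurable M" for n
    using int by (rule borel_measurable_integrable)
  have nn: "AE x in M. \<forall>n. 0 \<le> f n x"
    using nonneg by (simp add: AE_all_countable)
  have g0: "AE x in M. 0 \<le> g x"
    using nn lim by eventually_elim (auto intro: LIMSEQ_le_const)
  have b0: "0 \<le> b"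
    using integral_nonneg_AE[OF nonneg[of 0]] le[of 0] by linarith
  have "(\<integral>\<^sup>+x. ennreal (g x) \<partial>M) = (\<integral>\<^sup>+x. liminf (\<lambda>n. ennreal (f n x)) \<partial>M)"
  proof (rule nn_integral_cong_AE, use lim in eventually_elim)
    fix x assume "(\<lambda>n. f n x) \<longlonglongrightarrow> g x"
    then have "(\<lambda>n. ennreal (f n x)) \<longlonglongrightarrow> ennreal (g x)"
      by (rule tendsto_ennrealI)
    then show "ennreal (g x) = liminf (\<lambda>n. ennreal (f n x))"
      by (simp add: lim_imp_Liminf)
  qed
  also have "\<dots> \<le> liminf (\<lambda>n. \<integral>\<^sup>+x. ennreal (f n x) \<partial>M)"
    by (rule nn_integral_liminf) auto
  also have "\<dots> \<le> ennreal b"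
  proof -
    have "(\<integral>\<^sup>+x. ennreal (f n x) \<partial>M) \<le> ennreal b" for n
      using nn_integral_eq_integral[OF int nonneg] le[of n] by (simp add: ennreal_leI)
    then show ?thesis
      by (intro Liminf_le) auto
  qed
  finally have fin: "(\<integral>\<^sup>+x. ennreal (g x) \<partial>M) \<le> ennreal b" .
  show *: "integrable M g"
    by (rule integrableI_nonneg[OF _ g0 le_less_trans[OF fin]]) auto
  show "(\<integral>x. g x \<partial>M) \<le> b"
    using fin nn_integral_eq_integral[OF * g0] b0 by simp
qed

lemma P2_distr:
  assumes "prob_space M" "X \<in> borel_measurable M" "integrable M (\<lambda>\<omega>. (norm (X \<omega>))\<^sup>2)"
  shows "distr M borel X \<in> P2"
  using assms by (auto simp: P2_def integrable_distr_eq intro!: prob_space.prob_space_distr)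

lemma P2_distrD:
  assumes "distr M borel X \<in> P2" and [measurable]: "X \<in> borel_measurable M"
  shows "integrable M (\<lambda>\<omega>. (norm (X \<omega>))\<^sup>2)"
    "(\<integral>\<omega>. (norm (X \<omega>))\<^sup>2 \<partial>M) = (\<integral>x. (norm x)\<^sup>2 \<partial>distr M borel X)"
  using P2D(4)[OF assms(1)] by (auto simp: integrable_distr_eq integral_distr)

lemma integrable_norm_diff_sq:
  fixes X Y :: "'b \<Rightarrow> 'a::euclidean_space"
  assumes [measurable]: "X \<in> borel_measurable M" "Y \<in> borel_measurable M"
    and "integrable M (\<lambda>\<omega>. (norm (X \<omega>))\<^sup>2)" "integrable M (\<lambda>\<omega>. (norm (Y \<omega>))\<^sup>2)"
  shows "integrable M (\<lambda>\<omega>. (norm (X \<omega> - Y \<omega>))\<^sup>2)"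
proof (rule Bochner_Integration.integrable_bound)
  show "integrable M (\<lambda>\<omega>. 2 * (norm (X \<omega>))\<^sup>2 + 2 * (norm (Y \<omega>))\<^sup>2)"
    using assms by auto
  show "AE \<omega> in M. norm ((norm (X \<omega> - Y \<omega>))\<^sup>2) \<le> norm (2 * (norm (X \<omega>))\<^sup>2 + 2 * (norm (Y \<omega>))\<^sup>2)"
  proof (rule AE_I2)
    fix \<omega>
    have "(norm (X \<omega> - Y \<omega>))\<^sup>2 + (norm (X \<omega> + Y \<omega>))\<^sup>2 = 2 * (norm (X \<omega>))\<^sup>2 + 2 * (norm (Y \<omega>))\<^sup>2"
      by (simp add: power2_norm_eq_inner algebra_simps)
    then have "(norm (X \<omega> - Y \<omega>))\<^sup>2 \<le> 2 * (norm (X \<omega>))\<^sup>2 + 2 * (norm (Y \<omega>))\<^sup>2"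
      using zero_le_power2[of "norm (X \<omega> + Y \<omega>)"] by linarith
    then show "norm ((norm (X \<omega> - Y \<omega>))\<^sup>2) \<le> norm (2 * (norm (X \<omega>))\<^sup>2 + 2 * (norm (Y \<omega>))\<^sup>2)"
      by simp
  qed
qed measurable

text \<open>Fatou's lemma for the squared norms places the limit law in \<open>P2\<close>. Second
  moment may be lost in the limit, hence narrow rather than \<open>W2\<close> convergence.\<close>

lemma skorohod_subsequence:
  fixes m :: "nat \<Rightarrow> 'a::euclidean_space measure"
  assumes m: "\<And>n. m n \<in> P2" and C: "\<And>n. (\<integral>x. (norm x)\<^sup>2 \<partial>m n) \<le> C"
  obtains r :: "nat \<Rightarrow> nat" and M :: "real measure" and X Y where
    "strict_mono r" "prob_space M" "\<And>n. X n \<in> borel_measurable M" "Y \<in> borel_measurable M"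
    "\<And>n. distr M borel (X n) = m (r n)" "AE \<omega> in M. (\<lambda>n. X n \<omega>) \<longlonglongrightarrow> Y \<omega>"
    "distr M borel Y \<in> P2" "narrow_conv (\<lambda>n. m (r n)) (distr M borel Y)"
proof (rule skorohod_subsequence_P2[OF m C])
  fix r M X Y assume
    *: "strict_mono (r :: nat \<Rightarrow> nat)" "prob_space (M :: real measure)" "\<And>n. X n \<in> borel_measurable M"
    "Y \<in> borel_measurable M" "\<And>n. distr M borel (X n) = m (r n)"
    "AE \<omega> in M. (\<lambda>n. X n \<omega>) \<longlonglongrightarrow> Y \<omega>"
  note [measurable] = *(3,4)
  have mem: "distr M borel (X n) \<in> P2" for n
    by (simp add: * m)
  have "integrable M (\<lambda>\<omega>. (norm (Y \<omega>))\<^sup>2)"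
  proof (rule fatou_nonneg)
    show "integrable M (\<lambda>\<omega>. (norm (X n \<omega>))\<^sup>2)" for n
      by (rule P2_distrD[OF mem]) measurable
    show "AE \<omega> in M. (\<lambda>n. (norm (X n \<omega>))\<^sup>2) \<longlonglongrightarrow> (norm (Y \<omega>))\<^sup>2"
      using *(6) by (auto elim!: eventually_mono intro!: tendsto_intros)
    show "(\<integral>\<omega>. (norm (X n \<omega>))\<^sup>2 \<partial>M) \<le> C" for n
      using P2_distrD(2)[OF mem, of n] C[of "r n"] by (simp add: *)
  qed auto
  then have "distr M borel Y \<in> P2"
    using * by (intro P2_distr)
  moreover have "narrow_conv (\<lambda>n. m (r n)) (distr M borel Y)"
    using narrow_conv_distr[OF *(2,3,4,6)] by (simp add: *)
  ultimately show ?thesis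
    using that * by blast
qed

lemma narrow_conv_image:
  fixes g :: "'a::topological_space \<Rightarrow> 'b::topological_space"
  assumes g: "continuous_on UNIV g" and conv: "narrow_conv m \<mu>"
    and sets: "\<And>n. sets (m n) = sets borel" "sets \<mu> = sets borel"
  shows "narrow_conv (\<lambda>n. distr (m n) borel g) (distr \<mu> borel g)"
  unfolding narrow_conv_def
proof (intro allI impI)
  fix f :: "'b \<Rightarrow> real" assume f: "continuous_on UNIV f" "bounded (range f)"
  have [measurable]: "f \<in> borel_measurable borel" "g \<in> measurable borel borel"
    using f(1) g by (auto intro: borel_measurable_continuous_onI)
  have [measurable]: "g \<in> measurable (m n) borel" "g \<in> measurable \<mu> borel" for n
    using sets by (simp_all cong: measurable_cong_sets)
  have "continuous_on UNIV (\<lambda>x. f (g x))" "bounded (range (\<lambda>x. f (g x)))"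
    using f g by (auto intro: continuous_on_compose2 bounded_subset)
  then have "(\<lambda>n. \<integral>x. f (g x) \<partial>m n) \<longlonglongrightarrow> (\<integral>x. f (g x) \<partial>\<mu>)"
    using conv by (auto simp: narrow_conv_def)
  then show "(\<lambda>n. integral\<^sup>L (distr (m n) borel g) f) \<longlonglongrightarrow> integral\<^sup>L (distr \<mu> borel g) f"
    by (simp add: integral_distr)
qed

lemma borel_measurable_fst_snd [measurable]:
  "fst \<in> borel_measurable (borel :: ('a::euclidean_space \<times> 'b::euclidean_space) measure)"
  "snd \<in> borel_measurable (borel :: ('a::euclidean_space \<times> 'b::euclidean_space) measure)"
  by (auto intro!: borel_measurable_continuous_onI continuous_intros)

lemma wasserstein_sq:
  "(wasserstein 2 \<mu> \<nu>)\<^sup>2 = enn2real (INF \<gamma>\<in>couplings \<mu> \<nu>. transport_cost 2 \<gamma>)"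
  by (simp add: wasserstein_def powr_half_sqrt)

lemma distr_Pair_couplings:
  fixes X Y :: "'b \<Rightarrow> 'a::euclidean_space"
  assumes "prob_space M" and [measurable]: "X \<in> borel_measurable M" "Y \<in> borel_measurable M"
  shows "distr M borel (\<lambda>\<omega>. (X \<omega>, Y \<omega>)) \<in> couplings (distr M borel X) (distr M borel Y)"
    "transport_cost p (distr M borel (\<lambda>\<omega>. (X \<omega>, Y \<omega>))) = (\<integral>\<^sup>+\<omega>. ennreal (dist (X \<omega>) (Y \<omega>) powr p) \<partial>M)"
  using assms(1)
  by (auto simp: couplings_def transport_cost_def distr_distr o_def nn_integral_distr split_beta
    intro!: prob_space.prob_space_distr)

text \<open>Any pair of random variables on a common probability space is a competitor in the
  infimum. Integrability makes the real integral agree with the extended cost; for a divergent cost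
  it would be 0 by convention.\<close>

lemma wasserstein_le_distr:
  fixes X Y :: "'b \<Rightarrow> 'a::euclidean_space"
  assumes "prob_space M" and [measurable]: "X \<in> borel_measurable M" "Y \<in> borel_measurable M"
    and int: "integrable M (\<lambda>\<omega>. dist (X \<omega>) (Y \<omega>) powr p)" and "p > 0"
  shows "wasserstein p (distr M borel X) (distr M borel Y)
    \<le> (\<integral>\<omega>. dist (X \<omega>) (Y \<omega>) powr p \<partial>M) powr (1 / p)"
proof -
  have "(INF \<gamma>\<in>couplings (distr M borel X) (distr M borel Y). transport_cost p \<gamma>)
      \<le> (\<integral>\<^sup>+\<omega>. ennreal (dist (X \<omega>) (Y \<omega>) powr p) \<partial>M)"
    using distr_Pair_couplings[OF assms(1-3)] by (metis INF_lower)
  also have "\<dots> = ennreal (\<integral>\<omega>. dist (X \<omega>) (Y \<omega>) powr p \<partial>M)"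
    by (rule nn_integral_eq_integral[OF int]) auto
  finally show ?thesis
    unfolding wasserstein_def using \<open>p > 0\<close>
    by (intro powr_mono2 enn2real_leI) (auto intro: integral_nonneg_AE)
qed

lemma wasserstein_sq_le_distr:
  fixes X Y :: "'b \<Rightarrow> 'a::euclidean_space"
  assumes "prob_space M" "X \<in> borel_measurable M" "Y \<in> borel_measurable M"
    and "integrable M (\<lambda>\<omega>. (norm (X \<omega> - Y \<omega>))\<^sup>2)"
  shows "(wasserstein 2 (distr M borel X) (distr M borel Y))\<^sup>2 \<le> (\<integral>\<omega>. (norm (X \<omega> - Y \<omega>))\<^sup>2 \<partial>M)"
proof -
  have "wasserstein 2 (distr M borel X) (distr M borel Y)
      \<le> sqrt (\<integral>\<omega>. (norm (X \<omega> - Y \<omega>))\<^sup>2 \<partial>M)"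
    using wasserstein_le_distr[OF assms(1-3), of 2] assms(4)
    by (simp add: dist_norm powr_half_sqrt)
  then have "(wasserstein 2 (distr M borel X) (distr M borel Y))\<^sup>2 \<le> (sqrt (\<integral>\<omega>. (norm (X \<omega> - Y \<omega>))\<^sup>2 \<partial>M))\<^sup>2"
    by (rule power_mono) (simp add: wasserstein_def)
  then show ?thesis
    by (simp add: integral_nonneg_AE)
qed

lemma couplings_P2:
  assumes "\<gamma> \<in> couplings \<mu> \<nu>" "\<mu> \<in> P2" "\<nu> \<in> P2"
  shows "\<gamma> \<in> P2" "integrable \<gamma> (\<lambda>z. (norm (fst z))\<^sup>2)" "integrable \<gamma> (\<lambda>z. (norm (snd z))\<^sup>2)"
    "integrable \<gamma> (\<lambda>z. (norm (fst z - snd z))\<^sup>2)"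
    "(\<integral>z. (norm z)\<^sup>2 \<partial>\<gamma>) = (\<integral>x. (norm x)\<^sup>2 \<partial>\<mu>) + (\<integral>x. (norm x)\<^sup>2 \<partial>\<nu>)"
proof -
  have g: "prob_space \<gamma>" "distr \<gamma> borel fst = \<mu>" "distr \<gamma> borel snd = \<nu>"
    and sets [measurable_cong]: "sets \<gamma> = sets borel"
    using assms by (auto simp: couplings_def)
  have m [measurable]: "fst \<in> borel_measurable \<gamma>" "snd \<in> borel_measurable \<gamma>"
    by measurable
  show 1: "integrable \<gamma> (\<lambda>z. (norm (fst z))\<^sup>2)" and 2: "integrable \<gamma> (\<lambda>z. (norm (snd z))\<^sup>2)"
    using P2_distrD(1)[of \<gamma> fst] P2_distrD(1)[of \<gamma> snd] g assms by auto
  have eq: "(norm z)\<^sup>2 = (norm (fst z))\<^sup>2 + (norm (snd z))\<^sup>2" for z :: "'a \<times> 'a"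
    by (cases z) (simp add: norm_Pair)
  show "\<gamma> \<in> P2"
    unfolding P2_def eq using g sets 1 2 by auto
  show "integrable \<gamma> (\<lambda>z. (norm (fst z - snd z))\<^sup>2)"
    using m 1 2 by (rule integrable_norm_diff_sq)
  show "(\<integral>z. (norm z)\<^sup>2 \<partial>\<gamma>) = (\<integral>x. (norm x)\<^sup>2 \<partial>\<mu>) + (\<integral>x. (norm x)\<^sup>2 \<partial>\<nu>)"
    unfolding eq using 1 2 P2_distrD(2)[of \<gamma> fst] P2_distrD(2)[of \<gamma> snd] g assms by auto
qed

lemma opt_couplings_sq:
  assumes "\<gamma> \<in> opt_couplings \<mu> \<nu>" "\<mu> \<in> P2" "\<nu> \<in> P2"
  shows "\<gamma> \<in> couplings \<mu> \<nu>" "(wasserstein 2 \<mu> \<nu>)\<^sup>2 = (\<integral>z. (norm (fst z - snd z))\<^sup>2 \<partial>\<gamma>)"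
proof -
  show g: "\<gamma> \<in> couplings \<mu> \<nu>"
    using assms by (simp add: opt_couplings_def is_arg_min_def)
  have "(INF \<gamma>\<in>couplings \<mu> \<nu>. transport_cost 2 \<gamma>) = transport_cost 2 \<gamma>"
    using assms(1) by (intro antisym INF_lower g INF_greatest)
      (auto simp: opt_couplings_def is_arg_min_def not_less)
  also have "\<dots> = (\<integral>\<^sup>+z. ennreal ((norm (fst z - snd z))\<^sup>2) \<partial>\<gamma>)"
    by (simp add: transport_cost_def case_prod_unfold dist_norm)
  also have "\<dots> = ennreal (\<integral>z. (norm (fst z - snd z))\<^sup>2 \<partial>\<gamma>)"
    using couplings_P2(4)[OF g assms(2,3)] by (intro nn_integral_eq_integral) auto
  finally show "(wasserstein 2 \<mu> \<nu>)\<^sup>2 = (\<integral>z. (norm (fst z - snd z))\<^sup>2 \<partial>\<gamma>)"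
    by (simp add: wasserstein_sq integral_nonneg_AE)
qed

lemma couplings_nonempty:
  fixes \<mu> \<nu> :: "'a::euclidean_space measure"
  assumes "\<mu> \<in> P2" "\<nu> \<in> P2"
  shows "couplings \<mu> \<nu> \<noteq> {}"
proof -
  interpret \<mu>: prob_space \<mu> by (rule P2D[OF assms(1)])
  interpret \<nu>: prob_space \<nu> by (rule P2D[OF assms(2)])
  interpret pair_prob_space \<mu> \<nu> ..
  have [measurable_cong]: "sets \<mu> = sets borel" "sets \<nu> = sets borel"
    using P2D assms by auto
  have "distr (\<mu> \<Otimes>\<^sub>M \<nu>) borel fst = \<mu>" "distr (\<mu> \<Otimes>\<^sub>M \<nu>) borel snd = \<nu>"
  proof -
    have "distr (\<mu> \<Otimes>\<^sub>M \<nu>) borel fst = distr (\<mu> \<Otimes>\<^sub>M \<nu>) \<mu> fst"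
      by (rule distr_cong) (use P2D assms in auto)
    then show "distr (\<mu> \<Otimes>\<^sub>M \<nu>) borel fst = \<mu>"
      by (simp add: \<nu>.distr_pair_fst \<nu>.emeasure_space_1)
    have "distr (\<mu> \<Otimes>\<^sub>M \<nu>) borel snd = distr (distr (\<nu> \<Otimes>\<^sub>M \<mu>) (\<mu> \<Otimes>\<^sub>M \<nu>) (\<lambda>(x, y). (y, x))) borel snd"
      by (subst distr_pair_swap) simp
    also have "\<dots> = distr (\<nu> \<Otimes>\<^sub>M \<mu>) borel fst"
      by (subst distr_distr) (auto simp: o_def split_beta)
    also have "\<dots> = distr (\<nu> \<Otimes>\<^sub>M \<mu>) \<nu> fst"
      by (rule distr_cong) (use P2D assms in auto)
    finally show "distr (\<mu> \<Otimes>\<^sub>M \<nu>) borel snd = \<nu>"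
      by (simp add: \<mu>.distr_pair_fst \<mu>.emeasure_space_1)
  qed
  moreover have "sets (\<mu> \<Otimes>\<^sub>M \<nu>) = sets borel"
    using P2D assms by (metis borel_prod sets_pair_measure_cong)
  ultimately have "\<mu> \<Otimes>\<^sub>M \<nu> \<in> couplings \<mu> \<nu>"
    using prob_space_axioms by (simp add: couplings_def)
  then show ?thesis by blast
qed

text \<open>All couplings have the same second moment, the sum of those of the marginals, so a
  minimizing sequence has an almost surely convergent representation on the product space. The
  marginal sequences are constant and survive in the limit, and Fatou's lemma bounds the limiting
  cost.\<close>

lemma opt_couplings_nonempty:
  fixes \<mu> \<nu> :: "'a::euclidean_space measure"
  assumes P: "\<mu> \<in> P2" "\<nu> \<in> P2"
  shows "opt_couplings \<mu> \<nu> \<noteq> {}"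
proof -
  let ?I = "INF \<gamma>\<in>couplings \<mu> \<nu>. transport_cost 2 \<gamma>"
  have "transport_cost 2 ` couplings \<mu> \<nu> \<noteq> {}"
    using couplings_nonempty[OF P] by simp
  from ennreal_Inf_countable_INF[OF this] obtain f :: "nat \<Rightarrow> ennreal" where
    f: "decseq f" "range f \<subseteq> transport_cost 2 ` couplings \<mu> \<nu>" "?I = (INF i. f i)"
    by auto
  then have "\<forall>i. \<exists>\<gamma>. \<gamma> \<in> couplings \<mu> \<nu> \<and> f i = transport_cost 2 \<gamma>"
    by blast
  then obtain \<gamma> where \<gamma>: "\<And>i. \<gamma> i \<in> couplings \<mu> \<nu>" "\<And>i. f i = transport_cost 2 (\<gamma> i)"
    by metis
  have lim: "(\<lambda>i. transport_cost 2 (\<gamma> i)) \<longlonglongrightarrow> ?I"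
    unfolding f(3) using LIMSEQ_INF[OF f(1)] by (simp flip: \<gamma>(2))
  obtain r M X Y where r: "strict_mono (r :: nat \<Rightarrow> nat)" and M: "prob_space (M :: real measure)"
    and [measurable]: "\<And>n. X n \<in> borel_measurable M" "Y \<in> borel_measurable M"
    and dX: "\<And>n. distr M borel (X n) = \<gamma> (r n)"
    and XY: "AE \<omega> in M. (\<lambda>n. X n \<omega>) \<longlonglongrightarrow> Y \<omega>"
    and conv: "narrow_conv (\<lambda>n. \<gamma> (r n)) (distr M borel Y)"
    by (rule skorohod_subsequence[of \<gamma>, OF couplings_P2(1)[OF \<gamma>(1) P] eq_refl[OF couplings_P2(5)[OF \<gamma>(1) P]]]) blast
  let ?\<gamma> = "distr M borel Y"
  have sets: "sets (\<gamma> n) = sets borel" for n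
    using \<gamma>(1)[of n] by (simp add: couplings_def)
  have marg: "distr (\<gamma> n) borel fst = \<mu>" "distr (\<gamma> n) borel snd = \<nu>" for n
    using \<gamma>(1)[of n] by (auto simp: couplings_def)
  have const: "narrow_conv (\<lambda>_. \<rho>) \<rho>" for \<rho> :: "'a measure"
    by (simp add: narrow_conv_def)
  have prob: "prob_space (distr ?\<gamma> borel fst)" "prob_space (distr ?\<gamma> borel snd)"
    using M by (auto simp: distr_distr intro!: prob_space.prob_space_distr)
  have "narrow_conv (\<lambda>_::nat. \<mu>) (distr ?\<gamma> borel fst)"
    using narrow_conv_image[OF _ conv sets, of fst] by (simp add: marg continuous_on_fst)
  then have 1: "distr ?\<gamma> borel fst = \<mu>"
    by (rule narrow_conv_unique[OF _ const]) (use P2D P prob in auto)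
  have "narrow_conv (\<lambda>_::nat. \<nu>) (distr ?\<gamma> borel snd)"
    using narrow_conv_image[OF _ conv sets, of snd] by (simp add: marg continuous_on_snd)
  then have 2: "distr ?\<gamma> borel snd = \<nu>"
    by (rule narrow_conv_unique[OF _ const]) (use P2D P prob in auto)
  have mem: "?\<gamma> \<in> couplings \<mu> \<nu>"
    using 1 2 M by (auto simp: couplings_def intro!: prob_space.prob_space_distr)
  have cost: "transport_cost 2 (distr M borel Z) = (\<integral>\<^sup>+\<omega>. ennreal ((norm (fst (Z \<omega>) - snd (Z \<omega>)))\<^sup>2) \<partial>M)"
    if [measurable]: "Z \<in> borel_measurable M" for Z :: "real \<Rightarrow> 'a \<times> 'a"
    by (simp add: transport_cost_def nn_integral_distr split_beta dist_norm)
  have "transport_cost 2 ?\<gamma> = (\<integral>\<^sup>+\<omega>. liminf (\<lambda>n. ennreal ((norm (fst (X n \<omega>) - snd (X n \<omega>)))\<^sup>2)) \<partial>M)"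
    unfolding cost[OF \<open>Y \<in> _\<close>]
  proof (rule nn_integral_cong_AE, use XY in eventually_elim)
    fix \<omega> assume "(\<lambda>n. X n \<omega>) \<longlonglongrightarrow> Y \<omega>"
    then have "(\<lambda>n. ennreal ((norm (fst (X n \<omega>) - snd (X n \<omega>)))\<^sup>2)) \<longlonglongrightarrow> ennreal ((norm (fst (Y \<omega>) - snd (Y \<omega>)))\<^sup>2)"
      by (intro tendsto_intros)
    then show "ennreal ((norm (fst (Y \<omega>) - snd (Y \<omega>)))\<^sup>2) = liminf (\<lambda>n. ennreal ((norm (fst (X n \<omega>) - snd (X n \<omega>)))\<^sup>2))"
      by (rule lim_imp_Liminf[OF trivial_limit_sequentially, symmetric])
  qed
  also have "\<dots> \<le> liminf (\<lambda>n. \<integral>\<^sup>+\<omega>. ennreal ((norm (fst (X n \<omega>) - snd (X n \<omega>)))\<^sup>2) \<partial>M)"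
    by (rule nn_integral_liminf) auto
  also have "\<dots> = liminf (\<lambda>n. transport_cost 2 (\<gamma> (r n)))"
    by (simp add: cost flip: dX)
  also have "\<dots> = ?I"
    using LIMSEQ_subseq_LIMSEQ[OF lim r] by (intro lim_imp_Liminf) (auto simp: o_def)
  finally have "transport_cost 2 ?\<gamma> \<le> ?I" .
  then have "?\<gamma> \<in> opt_couplings \<mu> \<nu>"
    using mem by (auto simp: opt_couplings_def is_arg_min_def not_less intro: order_trans INF_lower)
  then show ?thesis by blast
qed

section \<open>The Opial property\<close>

lemma optimal_couplingE:
  fixes \<mu> \<nu> :: "'a::euclidean_space measure"
  assumes "\<mu> \<in> P2" "\<nu> \<in> P2"
  obtains \<gamma> where "\<gamma> \<in> couplings \<mu> \<nu>" "(wasserstein 2 \<mu> \<nu>)\<^sup>2 = (\<integral>z. (norm (fst z - snd z))\<^sup>2 \<partial>\<gamma>)"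
  using opt_couplings_nonempty[OF assms] opt_couplings_sq[OF _ assms] by blast

lemma couplingsD:
  assumes "\<gamma> \<in> couplings \<mu> \<nu>"
  shows "prob_space \<gamma>" "sets \<gamma> = sets borel" "distr \<gamma> borel fst = \<mu>" "distr \<gamma> borel snd = \<nu>"
    "fst \<in> borel_measurable \<gamma>" "snd \<in> borel_measurable \<gamma>"
  using assms by (auto simp: couplings_def cong: measurable_cong_sets)

lemma wasserstein_commute_P2:
  fixes \<mu> \<nu> :: "'a::euclidean_space measure"
  assumes "\<mu> \<in> P2" "\<nu> \<in> P2"
  shows "wasserstein 2 \<mu> \<nu> = wasserstein 2 \<nu> \<mu>"
proof -
  have le: "(wasserstein 2 \<nu> \<mu>)\<^sup>2 \<le> (wasserstein 2 \<mu> \<nu>)\<^sup>2" if P: "\<mu> \<in> P2" "\<nu> \<in> P2"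
    for \<mu> \<nu> :: "'a measure"
  proof -
    obtain \<gamma> where \<gamma>: "\<gamma> \<in> couplings \<mu> \<nu>" "(wasserstein 2 \<mu> \<nu>)\<^sup>2 = (\<integral>z. (norm (fst z - snd z))\<^sup>2 \<partial>\<gamma>)"
      using optimal_couplingE[OF P] by blast
    then show ?thesis
      using wasserstein_sq_le_distr[of \<gamma> snd fst] couplingsD[OF \<gamma>(1)] couplings_P2(4)[OF \<gamma>(1) P]
      by (simp add: norm_minus_commute)
  qed
  have "(wasserstein 2 \<mu> \<nu>)\<^sup>2 = (wasserstein 2 \<nu> \<mu>)\<^sup>2"
    using le[OF assms] le[OF assms(2,1)] by simp
  then show ?thesis
    by (simp add: power2_eq_iff_nonneg wasserstein_def)
qed

lemma wasserstein_eq_0_P2: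
  fixes \<mu> \<nu> :: "'a::euclidean_space measure"
  assumes P: "\<mu> \<in> P2" "\<nu> \<in> P2" and "(wasserstein 2 \<mu> \<nu>)\<^sup>2 \<le> 0"
  shows "\<mu> = \<nu>"
proof -
  obtain \<gamma> where \<gamma>: "\<gamma> \<in> couplings \<mu> \<nu>" "(wasserstein 2 \<mu> \<nu>)\<^sup>2 = (\<integral>z. (norm (fst z - snd z))\<^sup>2 \<partial>\<gamma>)"
    using optimal_couplingE[OF P] by blast
  note g = couplingsD[OF \<gamma>(1)] and int = couplings_P2(4)[OF \<gamma>(1) P]
  have "(\<integral>z. (norm (fst z - snd z))\<^sup>2 \<partial>\<gamma>) = 0"
    using assms(3) \<gamma>(2) by (metis antisym zero_le_power2)
  then have "AE z in \<gamma>. fst z = snd z"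
    using integral_nonneg_eq_0_iff_AE[OF int] by simp
  then have "distr \<gamma> borel fst = distr \<gamma> borel snd"
    using g(5,6) by (intro distr_cong_AE) auto
  then show ?thesis
    using g by simp
qed

lemma wasserstein_self_P2:
  fixes \<mu> :: "'a::euclidean_space measure"
  assumes P: "\<mu> \<in> P2"
  shows "wasserstein 2 \<mu> \<mu> = 0"
proof -
  have d: "distr \<mu> borel (\<lambda>x. x) = \<mu>"
    using P2D[OF P] by (intro distr_id2) auto
  have "(\<lambda>x. x) \<in> borel_measurable \<mu>"
    using P2D[OF P] by (intro measurable_ident_sets)
  then have "(wasserstein 2 \<mu> \<mu>)\<^sup>2 \<le> 0"
    using wasserstein_sq_le_distr[of \<mu> "\<lambda>x. x" "\<lambda>x. x"] P2D[OF P] by (simp add: d)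
  then show ?thesis
    by simp
qed

lemma second_moment_le_wasserstein:
  fixes \<mu> \<nu> :: "'a::euclidean_space measure"
  assumes P: "\<mu> \<in> P2" "\<nu> \<in> P2"
  shows "(\<integral>x. (norm x)\<^sup>2 \<partial>\<mu>) \<le> 2 * (wasserstein 2 \<mu> \<nu>)\<^sup>2 + 2 * (\<integral>x. (norm x)\<^sup>2 \<partial>\<nu>)"
proof -
  obtain \<gamma> where \<gamma>: "\<gamma> \<in> couplings \<mu> \<nu>" "(wasserstein 2 \<mu> \<nu>)\<^sup>2 = (\<integral>z. (norm (fst z - snd z))\<^sup>2 \<partial>\<gamma>)"
    using optimal_couplingE[OF P] by blast
  note g = couplingsD[OF \<gamma>(1)] and int = couplings_P2[OF \<gamma>(1) P]
  have "(\<integral>z. (norm (fst z))\<^sup>2 \<partial>\<gamma>) \<le> (\<integral>z. 2 * (norm (fst z - snd z))\<^sup>2 + 2 * (norm (snd z))\<^sup>2 \<partial>\<gamma>)"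
  proof (rule integral_mono)
    fix z :: "'a \<times> 'a"
    have "2 * (norm (fst z - snd z))\<^sup>2 + 2 * (norm (snd z))\<^sup>2 - (norm (fst z))\<^sup>2 = (norm (fst z - 2 *\<^sub>R snd z))\<^sup>2"
      by (simp add: power2_norm_eq_inner algebra_simps inner_commute)
    then show "(norm (fst z))\<^sup>2 \<le> 2 * (norm (fst z - snd z))\<^sup>2 + 2 * (norm (snd z))\<^sup>2"
      using zero_le_power2[of "norm (fst z - 2 *\<^sub>R snd z)"] by linarith
  qed (use int in auto)
  also have "\<dots> = 2 * (wasserstein 2 \<mu> \<nu>)\<^sup>2 + 2 * (\<integral>z. (norm (snd z))\<^sup>2 \<partial>\<gamma>)"
    using int \<gamma> by simp
  finally show ?thesis
    using P2_distrD(2)[of \<gamma> fst] P2_distrD(2)[of \<gamma> snd] g P by simp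
qed

text \<open>Along a representation \<open>(X\<^sub>n, Y\<^sub>n) \<rightarrow> (X, Y)\<close> of
  optimal couplings of \<open>m n\<close> and \<open>\<nu>\<close>, the difference
  \<open>\<parallel>X\<^sub>n - Y\<^sub>n\<parallel>\<^sup>2 - \<parallel>X\<^sub>n - X\<parallel>\<^sup>2\<close> is affine in \<open>X\<^sub>n\<close>; after adding a small multiple of \<open>\<parallel>X\<^sub>n\<parallel>\<^sup>2\<close> it is bounded
  below by terms with constant expectation, so Fatou's lemma applies.\<close>

lemma opial_P2:
  fixes m :: "nat \<Rightarrow> 'a::euclidean_space measure"
  assumes m: "\<And>n. m n \<in> P2" and C: "\<And>n. (\<integral>x. (norm x)\<^sup>2 \<partial>m n) \<le> C"
    and P: "\<mu> \<in> P2" "\<nu> \<in> P2" and conv: "narrow_conv m \<mu>"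
    and c: "c < (wasserstein 2 \<mu> \<nu>)\<^sup>2"
  shows "\<forall>\<^sub>F n in sequentially. c < (wasserstein 2 (m n) \<nu>)\<^sup>2 - (wasserstein 2 (m n) \<mu>)\<^sup>2"
proof (rule ccontr)
  assume "\<not> ?thesis"
  from not_eventually_sequentiallyD[OF this] obtain r0 :: "nat \<Rightarrow> nat" where r0: "strict_mono r0"
    and le: "\<And>n. (wasserstein 2 (m (r0 n)) \<nu>)\<^sup>2 - (wasserstein 2 (m (r0 n)) \<mu>)\<^sup>2 \<le> c"
    unfolding not_less by blast
  have "\<forall>n. \<exists>\<gamma>. \<gamma> \<in> couplings (m (r0 n)) \<nu> \<and>
      (wasserstein 2 (m (r0 n)) \<nu>)\<^sup>2 = (\<integral>z. (norm (fst z - snd z))\<^sup>2 \<partial>\<gamma>)"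
    using optimal_couplingE[OF m P(2)] by blast
  then obtain \<gamma> where \<gamma>: "\<And>n. \<gamma> n \<in> couplings (m (r0 n)) \<nu>"
    and opt: "\<And>n. (wasserstein 2 (m (r0 n)) \<nu>)\<^sup>2 = (\<integral>z. (norm (fst z - snd z))\<^sup>2 \<partial>\<gamma> n)"
    by metis
  have moments: "(\<integral>z. (norm z)\<^sup>2 \<partial>\<gamma> n) \<le> C + (\<integral>x. (norm x)\<^sup>2 \<partial>\<nu>)" for n
    using couplings_P2(5)[OF \<gamma> m P(2), of n] C[of "r0 n"] by simp
  obtain r M Z W where r: "strict_mono (r :: nat \<Rightarrow> nat)" and M: "prob_space (M :: real measure)"
    and [measurable]: "\<And>n. Z n \<in> borel_measurable M" "W \<in> borel_measurable M"
    and dZ: "\<And>n. distr M borel (Z n) = \<gamma> (r n)"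
    and ZW: "AE \<omega> in M. (\<lambda>n. Z n \<omega>) \<longlonglongrightarrow> W \<omega>"
    and convZ: "narrow_conv (\<lambda>n. \<gamma> (r n)) (distr M borel W)"
    by (rule skorohod_subsequence[of \<gamma>, OF couplings_P2(1)[OF \<gamma> m P(2)] moments]) blast
  define X where "X n \<omega> = fst (Z n \<omega>)" for n \<omega>
  define Y where "Y n \<omega> = snd (Z n \<omega>)" for n \<omega>
  define X' where "X' \<omega> = fst (W \<omega>)" for \<omega>
  define Y' where "Y' \<omega> = snd (W \<omega>)" for \<omega>
  have meas [measurable]: "X n \<in> borel_measurable M" "Y n \<in> borel_measurable M"
    "X' \<in> borel_measurable M" "Y' \<in> borel_measurable M" for n
    unfolding X_def Y_def X'_def Y'_def by measurable
  note g = couplingsD[OF \<gamma>]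
  have dX: "distr M borel (X n) = m (r0 (r n))" and dY: "distr M borel (Y n) = \<nu>" for n
    using g(3,4)[of "r n"] unfolding dZ[symmetric]
    by (simp_all add: distr_distr o_def X_def[abs_def] Y_def[abs_def])
  have const: "narrow_conv (\<lambda>_. \<rho>) \<rho>" for \<rho> :: "'a measure"
    by (simp add: narrow_conv_def)
  have prob: "prob_space (distr M borel X')" "prob_space (distr M borel Y')"
    using M by (auto intro!: prob_space.prob_space_distr)
  have lim: "AE \<omega> in M. (\<lambda>n. X n \<omega>) \<longlonglongrightarrow> X' \<omega>" "AE \<omega> in M. (\<lambda>n. Y n \<omega>) \<longlonglongrightarrow> Y' \<omega>"
    using ZW by (auto elim!: eventually_mono intro!: tendsto_intros simp: X_def X'_def Y_def Y'_def)
  have dX': "distr M borel X' = \<mu>"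
  proof (rule narrow_conv_unique)
    show "narrow_conv (\<lambda>n. m (r0 (r n))) (distr M borel X')"
      using narrow_conv_distr[OF M meas(1,3) lim(1)] by (simp add: dX)
    show "narrow_conv (\<lambda>n. m (r0 (r n))) \<mu>"
      using narrow_conv_subseq[OF narrow_conv_subseq[OF conv r0] r] .
  qed (use prob P P2D in auto)
  have dY': "distr M borel Y' = \<nu>"
  proof (rule narrow_conv_unique)
    show "narrow_conv (\<lambda>n. \<nu>) (distr M borel Y')"
      using narrow_conv_distr[OF M meas(2,4) lim(2)] by (simp add: dY)
  qed (use prob P P2D const in auto)
  have sq: "integrable M (\<lambda>\<omega>. (norm (X n \<omega>))\<^sup>2)" "integrable M (\<lambda>\<omega>. (norm (Y n \<omega>))\<^sup>2)"
    "integrable M (\<lambda>\<omega>. (norm (X' \<omega>))\<^sup>2)" "integrable M (\<lambda>\<omega>. (norm (Y' \<omega>))\<^sup>2)" for n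
    using m P by (auto intro!: P2_distrD(1) simp: dX dY dX' dY')
  have msq: "(\<integral>\<omega>. (norm (X n \<omega>))\<^sup>2 \<partial>M) \<le> C"
    "(\<integral>\<omega>. (norm (Y n \<omega>))\<^sup>2 \<partial>M) = (\<integral>\<omega>. (norm (Y' \<omega>))\<^sup>2 \<partial>M)" for n
    using P2_distrD(2)[of M "X n"] P2_distrD(2)[of M "Y n"] P2_distrD(2)[of M Y'] C[of "r0 (r n)"] m P
    by (auto simp: dX dY dY')
  note diff = integrable_norm_diff_sq[OF meas(1,2) sq(1,2)] integrable_norm_diff_sq[OF meas(1,3) sq(1,3)]
    integrable_norm_diff_sq[OF meas(3,4) sq(3,4)]
  have WXY: "(\<integral>\<omega>. (norm (X n \<omega> - Y n \<omega>))\<^sup>2 \<partial>M) = (wasserstein 2 (m (r0 (r n))) \<nu>)\<^sup>2" for n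
    unfolding opt dZ[symmetric] by (simp add: integral_distr X_def Y_def)
  \<comment> \<open>The pair \<open>(X n, X')\<close> is in general not optimal, but this distance
    enters with a minus sign, so an upper bound is what is needed. Equality is required only for the
    pair \<open>(X n, Y n)\<close>.\<close>
  have WXX: "(wasserstein 2 (m (r0 (r n))) \<mu>)\<^sup>2 \<le> (\<integral>\<omega>. (norm (X n \<omega> - X' \<omega>))\<^sup>2 \<partial>M)" for n
    using wasserstein_sq_le_distr[OF M meas(1,3) diff(2), of n] by (simp add: dX dX')
  have WXY': "(wasserstein 2 \<mu> \<nu>)\<^sup>2 \<le> (\<integral>\<omega>. (norm (X' \<omega> - Y' \<omega>))\<^sup>2 \<partial>M)"
    using wasserstein_sq_le_distr[OF M meas(3,4) diff(3)] by (simp add: dX' dY')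
  have C0: "0 \<le> C"
    using order_trans[OF integral_nonneg_AE C[of 0]] by auto
  \<comment> \<open>Here \<open>d\<close> is the weight of the added multiple of the squared norm of
    \<open>X n\<close>. It costs at most \<open>d * C\<close> in expectation and is chosen small at
    the end.\<close>
  have bound: "(\<integral>\<omega>. (norm (X' \<omega> - Y' \<omega>))\<^sup>2 \<partial>M) \<le> c + d * C" if "d > 0" for d
  proof -
    \<comment> \<open>These terms complete the square in \<open>X n\<close>. Their expectation
      \<open>?E\<close> does not depend on \<open>n\<close>, because all \<open>Y n\<close> have law
      \<nu>, so it cancels after Fatou's lemma.\<close>
    define R where "R y \<omega> = (2 / d) * (norm (X' \<omega>))\<^sup>2 + (2 / d) * (norm y)\<^sup>2 + (norm (X' \<omega>))\<^sup>2" for y :: 'a and \<omega>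
    let ?E = "(2 / d) * (\<integral>\<omega>. (norm (X' \<omega>))\<^sup>2 \<partial>M) + (2 / d) * (\<integral>\<omega>. (norm (Y' \<omega>))\<^sup>2 \<partial>M) + (\<integral>\<omega>. (norm (X' \<omega>))\<^sup>2 \<partial>M)"
    let ?f = "\<lambda>n \<omega>. (norm (X n \<omega> - Y n \<omega>))\<^sup>2 - (norm (X n \<omega> - X' \<omega>))\<^sup>2 + d * (norm (X n \<omega>))\<^sup>2 + R (Y n \<omega>) \<omega>"
    let ?g = "\<lambda>\<omega>. (norm (X' \<omega> - Y' \<omega>))\<^sup>2 + d * (norm (X' \<omega>))\<^sup>2 + R (Y' \<omega>) \<omega>"
    have "(\<integral>\<omega>. ?g \<omega> \<partial>M) \<le> c + d * C + ?E"
    proof (rule fatou_nonneg(2))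
      show "integrable M (?f n)" for n
        unfolding R_def using diff sq by (intro Bochner_Integration.integrable_add Bochner_Integration.integrable_diff integrable_mult_right)
      show "?g \<in> borel_measurable M"
        unfolding R_def by measurable
      show "AE \<omega> in M. 0 \<le> ?f n \<omega>" for n
      proof (rule AE_I2)
        fix \<omega>
        have *: "0 \<le> (norm (x - y))\<^sup>2 - (norm (x - z))\<^sup>2 + d * (norm x)\<^sup>2
            + ((2 / d) * (norm z)\<^sup>2 + (2 / d) * (norm y)\<^sup>2 + (norm z)\<^sup>2)" for x y z :: 'a
        proof -
          have "(norm (x - y))\<^sup>2 - (norm (x - z))\<^sup>2 + d * (norm x)\<^sup>2
            + ((2 / d) * (norm z)\<^sup>2 + (2 / d) * (norm y)\<^sup>2 + (norm z)\<^sup>2)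
            = (norm y)\<^sup>2 + (1 / d) * ((norm (d *\<^sub>R x + (z - y)))\<^sup>2 + (norm (z + y))\<^sup>2)"
            using \<open>d > 0\<close> by (simp add: power2_norm_eq_inner inner_simps inner_commute field_simps)
          then show ?thesis
            using \<open>d > 0\<close> by simp
        qed
        show "0 \<le> ?f n \<omega>"
          unfolding R_def by (rule *)
      qed
      show "AE \<omega> in M. (\<lambda>n. ?f n \<omega>) \<longlonglongrightarrow> ?g \<omega>"
        using lim
      proof eventually_elim
        case (elim \<omega>)
        have "(\<lambda>n. ?f n \<omega>) \<longlonglongrightarrow> (norm (X' \<omega> - Y' \<omega>))\<^sup>2 - (norm (X' \<omega> - X' \<omega>))\<^sup>2 + d * (norm (X' \<omega>))\<^sup>2 + R (Y' \<omega>) \<omega>"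
          unfolding R_def by (intro tendsto_intros elim)
        then show ?case by simp
      qed
      show "(\<integral>\<omega>. ?f n \<omega> \<partial>M) \<le> c + d * C + ?E" for n
      proof -
        have "(\<integral>\<omega>. ?f n \<omega> \<partial>M) = (\<integral>\<omega>. (norm (X n \<omega> - Y n \<omega>))\<^sup>2 \<partial>M) - (\<integral>\<omega>. (norm (X n \<omega> - X' \<omega>))\<^sup>2 \<partial>M)
            + d * (\<integral>\<omega>. (norm (X n \<omega>))\<^sup>2 \<partial>M) + ?E"
          unfolding R_def msq(2)[of n, symmetric] using diff sq by simp
        moreover have "d * (\<integral>\<omega>. (norm (X n \<omega>))\<^sup>2 \<partial>M) \<le> d * C"
          using msq(1) \<open>d > 0\<close> by (simp add: mult_left_mono)
        ultimately show ?thesis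
          using WXY[of n] WXX[of n] le[of "r n"] by linarith
      qed
    qed
    also have "(\<integral>\<omega>. ?g \<omega> \<partial>M) = (\<integral>\<omega>. (norm (X' \<omega> - Y' \<omega>))\<^sup>2 \<partial>M) + d * (\<integral>\<omega>. (norm (X' \<omega>))\<^sup>2 \<partial>M) + ?E"
      unfolding R_def using diff sq by simp
    finally have "(\<integral>\<omega>. (norm (X' \<omega> - Y' \<omega>))\<^sup>2 \<partial>M) + d * (\<integral>\<omega>. (norm (X' \<omega>))\<^sup>2 \<partial>M) \<le> c + d * C"
      by simp
    moreover have "0 \<le> d * (\<integral>\<omega>. (norm (X' \<omega>))\<^sup>2 \<partial>M)"
      using \<open>d > 0\<close> by (simp add: integral_nonneg_AE)
    ultimately show ?thesis by linarith
  qed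
  define e where "e = ((wasserstein 2 \<mu> \<nu>)\<^sup>2 - c) / 2"
  have "e > 0" using c by (simp add: e_def)
  \<comment> \<open>The choice \<open>d = e / (C + 1)\<close> keeps the denominator positive when
    \<open>C\<close> is 0.\<close>
  have "e / (C + 1) * C \<le> e"
    using C0 \<open>e > 0\<close> by (simp add: field_simps)
  moreover have "(\<integral>\<omega>. (norm (X' \<omega> - Y' \<omega>))\<^sup>2 \<partial>M) \<le> c + e / (C + 1) * C"
    using C0 \<open>e > 0\<close> by (intro bound) auto
  moreover have "(wasserstein 2 \<mu> \<nu>)\<^sup>2 = c + 2 * e"
    by (simp add: e_def field_simps)
  ultimately show False
    using WXY' \<open>e > 0\<close> by linarith
qed

section \<open>The proximal step\<close>

text \<open>The pointwise identity for the squared distance from a convex combination to the base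
  point is integrated. The couplings with the base are optimal and give equalities; the induced
  coupling of the endpoints need not be, but its cost appears with a negative sign.\<close>

lemma generalized_geodesic_wasserstein:
  fixes \<mu>\<^sub>0 \<mu>\<^sub>1 \<nu> :: "'a::euclidean_space measure"
  assumes gg: "generalized_geodesic \<nu> \<mu>\<^sub>0 \<mu>\<^sub>1 m" and P: "\<nu> \<in> P2" "\<mu>\<^sub>0 \<in> P2" "\<mu>\<^sub>1 \<in> P2"
    and t: "t \<in> {0..1}"
  shows "m t \<in> P2" "(wasserstein 2 (m t) \<nu>)\<^sup>2 + t * (1 - t) * (wasserstein 2 \<mu>\<^sub>0 \<mu>\<^sub>1)\<^sup>2
    \<le> (1 - t) * (wasserstein 2 \<mu>\<^sub>0 \<nu>)\<^sup>2 + t * (wasserstein 2 \<mu>\<^sub>1 \<nu>)\<^sup>2"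
proof -
  obtain \<gamma> :: "('a \<times> 'a \<times> 'a) measure" where M: "prob_space \<gamma>"
    and sets [measurable_cong]: "sets \<gamma> = sets borel"
    and d: "distr \<gamma> borel (\<lambda>(x, y, z). x) = \<nu>" "distr \<gamma> borel (\<lambda>(x, y, z). y) = \<mu>\<^sub>0"
      "distr \<gamma> borel (\<lambda>(x, y, z). z) = \<mu>\<^sub>1"
    and opt: "distr \<gamma> borel (\<lambda>(x, y, z). (x, y)) \<in> opt_couplings \<nu> \<mu>\<^sub>0"
      "distr \<gamma> borel (\<lambda>(x, y, z). (x, z)) \<in> opt_couplings \<nu> \<mu>\<^sub>1"
    and m: "m t = distr \<gamma> borel (\<lambda>(x, y, z). (1 - t) *\<^sub>R y + t *\<^sub>R z)"
    using gg t unfolding generalized_geodesic_def by blast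
  define X where "X = (\<lambda>w :: 'a \<times> 'a \<times> 'a. fst w)"
  define Y where "Y = (\<lambda>w :: 'a \<times> 'a \<times> 'a. fst (snd w))"
  define Z where "Z = (\<lambda>w :: 'a \<times> 'a \<times> 'a. snd (snd w))"
  define V where "V = (\<lambda>w. (1 - t) *\<^sub>R Y w + t *\<^sub>R Z w)"
  have meas [measurable]: "X \<in> borel_measurable \<gamma>" "Y \<in> borel_measurable \<gamma>" "Z \<in> borel_measurable \<gamma>"
    "V \<in> borel_measurable \<gamma>"
    unfolding X_def Y_def Z_def V_def by measurable
  have D: "distr \<gamma> borel X = \<nu>" "distr \<gamma> borel Y = \<mu>\<^sub>0" "distr \<gamma> borel Z = \<mu>\<^sub>1" "distr \<gamma> borel V = m t"
    using d m by (simp_all add: X_def Y_def Z_def V_def case_prod_unfold)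
  have opt': "distr \<gamma> borel (\<lambda>w. (X w, Y w)) \<in> opt_couplings \<nu> \<mu>\<^sub>0"
      "distr \<gamma> borel (\<lambda>w. (X w, Z w)) \<in> opt_couplings \<nu> \<mu>\<^sub>1"
    using opt by (simp_all add: X_def Y_def Z_def case_prod_unfold)
  have sq: "integrable \<gamma> (\<lambda>w. (norm (X w))\<^sup>2)" "integrable \<gamma> (\<lambda>w. (norm (Y w))\<^sup>2)"
    "integrable \<gamma> (\<lambda>w. (norm (Z w))\<^sup>2)"
    using P by (auto intro!: P2_distrD(1) simp: D)
  note diff = integrable_norm_diff_sq[OF meas(1,2) sq(1,2)] integrable_norm_diff_sq[OF meas(1,3) sq(1,3)]
    integrable_norm_diff_sq[OF meas(2,3) sq(2,3)]
  have id: "(norm (V w - X w))\<^sup>2 = (1 - t) * (norm (X w - Y w))\<^sup>2 + t * (norm (X w - Z w))\<^sup>2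
      - t * (1 - t) * (norm (Y w - Z w))\<^sup>2" for w
    by (simp add: V_def power2_norm_eq_inner algebra_simps inner_commute)
  have VX: "integrable \<gamma> (\<lambda>w. (norm (V w - X w))\<^sup>2)"
    unfolding id using diff by (intro Bochner_Integration.integrable_add Bochner_Integration.integrable_diff integrable_mult_right)
  \<comment> \<open>Writing \<open>V\<close> as a difference of \<open>V - X\<close> and
    \<open>- X\<close> reuses the integrability already shown.\<close>
  have "integrable \<gamma> (\<lambda>w. (norm ((V w - X w) - (- X w)))\<^sup>2)"
    by (rule integrable_norm_diff_sq) (use VX sq in auto)
  then show "m t \<in> P2"
    using M by (auto simp flip: D(4) intro!: P2_distr)
  have "(wasserstein 2 (m t) \<nu>)\<^sup>2 \<le> (\<integral>w. (norm (V w - X w))\<^sup>2 \<partial>\<gamma>)"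
    using wasserstein_sq_le_distr[OF M meas(4,1) VX] by (simp add: D)
  also have "\<dots> = (1 - t) * (\<integral>w. (norm (X w - Y w))\<^sup>2 \<partial>\<gamma>) + t * (\<integral>w. (norm (X w - Z w))\<^sup>2 \<partial>\<gamma>)
      - t * (1 - t) * (\<integral>w. (norm (Y w - Z w))\<^sup>2 \<partial>\<gamma>)"
    unfolding id using diff by simp
  also have "(\<integral>w. (norm (X w - Y w))\<^sup>2 \<partial>\<gamma>) = (wasserstein 2 \<mu>\<^sub>0 \<nu>)\<^sup>2"
    using opt_couplings_sq(2)[OF opt'(1) P(1,2)] wasserstein_commute_P2[OF P(1,2)] by (simp add: integral_distr)
  also have "(\<integral>w. (norm (X w - Z w))\<^sup>2 \<partial>\<gamma>) = (wasserstein 2 \<mu>\<^sub>1 \<nu>)\<^sup>2"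
    using opt_couplings_sq(2)[OF opt'(2) P(1,3)] wasserstein_commute_P2[OF P(1,3)] by (simp add: integral_distr)
  finally have "(wasserstein 2 (m t) \<nu>)\<^sup>2 \<le> (1 - t) * (wasserstein 2 \<mu>\<^sub>0 \<nu>)\<^sup>2 + t * (wasserstein 2 \<mu>\<^sub>1 \<nu>)\<^sup>2
      - t * (1 - t) * (\<integral>w. (norm (Y w - Z w))\<^sup>2 \<partial>\<gamma>)" .
  moreover have "t * (1 - t) * (wasserstein 2 \<mu>\<^sub>0 \<mu>\<^sub>1)\<^sup>2 \<le> t * (1 - t) * (\<integral>w. (norm (Y w - Z w))\<^sup>2 \<partial>\<gamma>)"
    using wasserstein_sq_le_distr[OF M meas(2,3) diff(3)] t by (intro mult_left_mono) (auto simp: D)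
  ultimately show "(wasserstein 2 (m t) \<nu>)\<^sup>2 + t * (1 - t) * (wasserstein 2 \<mu>\<^sub>0 \<mu>\<^sub>1)\<^sup>2
    \<le> (1 - t) * (wasserstein 2 \<mu>\<^sub>0 \<nu>)\<^sup>2 + t * (wasserstein 2 \<mu>\<^sub>1 \<nu>)\<^sup>2"
    by linarith
qed

locale geodesically_convex_functional =
  fixes H :: "'a::euclidean_space measure \<Rightarrow> ereal"
  assumes proper: "proper_on_P2 H" and lsc: "lsc_W2 H"
    and convex: "convex_along_generalized_geodesics H"
begin

lemma H_finiteE:
  assumes "\<nu> \<in> P2" "H \<nu> \<noteq> \<infinity>"
  obtains h where "H \<nu> = ereal h"
  using assms proper by (cases "H \<nu>") (auto simp: proper_on_P2_def)

lemma prox_objective_ereal: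
  "H \<nu> = ereal h \<Longrightarrow> prox_objective \<tau> H \<eta> \<nu> = ereal (h + (wasserstein 2 \<nu> \<eta>)\<^sup>2 / (2 * \<tau>))"
  by (simp add: prox_objective_def)

lemma prox_objective_finiteE:
  assumes "\<nu> \<in> P2" "prox_objective \<tau> H \<eta> \<nu> \<noteq> \<infinity>"
  obtains h where "H \<nu> = ereal h"
  using assms by (auto simp: prox_objective_def elim: H_finiteE)

text \<open>The geodesic is based at the centre \<eta> of the penalty. Along such a curve the
  squared distance to \<eta> is strongly convex, which need not hold along an ordinary Wasserstein
  geodesic; this is what convexity along generalized geodesics provides.\<close>

lemma prox_objective_strongly_convex:
  assumes P: "\<eta> \<in> P2" "\<nu>\<^sub>0 \<in> P2" "\<nu>\<^sub>1 \<in> P2" and "\<tau> > 0" and s: "s \<in> {0..1}"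
    and H: "H \<nu>\<^sub>0 = ereal a" "H \<nu>\<^sub>1 = ereal b"
  obtains \<rho> h where "\<rho> \<in> P2" "H \<rho> = ereal h"
    "h + (wasserstein 2 \<rho> \<eta>)\<^sup>2 / (2 * \<tau>) + s * (1 - s) * (wasserstein 2 \<nu>\<^sub>0 \<nu>\<^sub>1)\<^sup>2 / (2 * \<tau>)
      \<le> (1 - s) * (a + (wasserstein 2 \<nu>\<^sub>0 \<eta>)\<^sup>2 / (2 * \<tau>)) + s * (b + (wasserstein 2 \<nu>\<^sub>1 \<eta>)\<^sup>2 / (2 * \<tau>))"
proof -
  obtain m where m: "generalized_geodesic \<eta> \<nu>\<^sub>0 \<nu>\<^sub>1 m"
    and "\<forall>s\<in>{0..1}. H (m s) \<le> ereal (1 - s) * H \<nu>\<^sub>0 + ereal s * H \<nu>\<^sub>1"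
    using convex P unfolding convex_along_generalized_geodesics_def by blast
  then have le: "H (m s) \<le> ereal ((1 - s) * a + s * b)"
    using s H by simp
  note W = generalized_geodesic_wasserstein[OF m P s]
  obtain h where h: "H (m s) = ereal h"
    using le by (auto intro: H_finiteE[OF W(1)])
  have "h \<le> (1 - s) * a + s * b"
    using le h by simp
  moreover have "((wasserstein 2 (m s) \<eta>)\<^sup>2 + s * (1 - s) * (wasserstein 2 \<nu>\<^sub>0 \<nu>\<^sub>1)\<^sup>2) / (2 * \<tau>)
      \<le> ((1 - s) * (wasserstein 2 \<nu>\<^sub>0 \<eta>)\<^sup>2 + s * (wasserstein 2 \<nu>\<^sub>1 \<eta>)\<^sup>2) / (2 * \<tau>)"
    using W(2) \<open>\<tau> > 0\<close> by (intro divide_right_mono) auto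
  ultimately show ?thesis
    using that[OF W(1) h] by (simp add: algebra_simps add_divide_distrib diff_divide_distrib)
qed

text \<open>Minimizing sequences are Cauchy by strong convexity. The Opial property replaces both the
  completeness of the Wasserstein space and the lower semicontinuity of the distance.\<close>

lemma prox_minimizer_exists:
  assumes \<eta>: "\<eta> \<in> P2" and "\<tau> > 0"
    and lower: "\<And>\<nu>. \<nu> \<in> P2 \<Longrightarrow> ereal b \<le> prox_objective \<tau> H \<eta> \<nu>"
  shows "\<exists>\<rho>. is_arg_min (prox_objective \<tau> H \<eta>) (\<lambda>\<nu>. \<nu> \<in> P2) \<rho>"
proof -
  let ?W = "\<lambda>\<mu> \<nu>. (wasserstein 2 \<mu> \<nu>)\<^sup>2"
  define I where "I = (INF \<nu>\<in>P2. prox_objective \<tau> H \<eta> \<nu>)"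
  obtain \<nu>0 where \<nu>0: "\<nu>0 \<in> P2" "H \<nu>0 \<noteq> \<infinity>"
    using proper by (auto simp: proper_on_P2_def)
  then obtain h0 where "H \<nu>0 = ereal h0"
    by (rule H_finiteE)
  then have "I < \<infinity>"
    unfolding I_def using INF_lower[OF \<nu>0(1), of "prox_objective \<tau> H \<eta>"]
    by (auto simp: prox_objective_ereal less_top[symmetric])
  moreover have "ereal b \<le> I"
    unfolding I_def by (intro INF_greatest lower)
  ultimately obtain i where i: "I = ereal i"
    by (cases I) auto
  have I_le: "i \<le> h + ?W \<nu> \<eta> / (2 * \<tau>)" if "\<nu> \<in> P2" "H \<nu> = ereal h" for \<nu> h
    using INF_lower[OF that(1), of "prox_objective \<tau> H \<eta>"] prox_objective_ereal[OF that(2)]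
    by (simp add: i flip: I_def)
  have "\<exists>\<nu> h. \<nu> \<in> P2 \<and> H \<nu> = ereal h \<and> h + ?W \<nu> \<eta> / (2 * \<tau>) \<le> i + 1 / (real n + 1)" for n
  proof -
    have "I < ereal (i + 1 / (real n + 1))"
      by (simp add: i)
    then obtain \<nu> where \<nu>: "\<nu> \<in> P2" "prox_objective \<tau> H \<eta> \<nu> < ereal (i + 1 / (real n + 1))"
      unfolding I_def by (auto simp: INF_less_iff)
    then obtain h where h: "H \<nu> = ereal h"
      by (elim prox_objective_finiteE[where \<tau> = \<tau> and \<eta> = \<eta>]) auto
    then show ?thesis
      using \<nu> by (auto simp: prox_objective_ereal less_imp_le)
  qed
  then obtain \<nu> h where \<nu>: "\<And>n. \<nu> n \<in> P2" and h: "\<And>n. H (\<nu> n) = ereal (h n)"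
    and min: "\<And>n. h n + ?W (\<nu> n) \<eta> / (2 * \<tau>) \<le> i + 1 / (real n + 1)"
    by metis
  \<comment> \<open>At the midpoint the strong convexity gain is a quarter of the squared distance
    divided by \<open>2 * \<tau>\<close>. The midpoint value is at least \<open>i\<close>, so the
    gain is at most the mean of the two excesses.\<close>
  have cauchy: "?W (\<nu> n) (\<nu> k) \<le> 4 * \<tau> * (1 / (real n + 1) + 1 / (real k + 1))" for n k
  proof -
    obtain \<rho> h' where \<rho>: "\<rho> \<in> P2" "H \<rho> = ereal h'" and
      "h' + ?W \<rho> \<eta> / (2 * \<tau>) + 1/2 * (1 - 1/2) * ?W (\<nu> n) (\<nu> k) / (2 * \<tau>)
      \<le> (1 - 1/2) * (h n + ?W (\<nu> n) \<eta> / (2 * \<tau>)) + 1/2 * (h k + ?W (\<nu> k) \<eta> / (2 * \<tau>))"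
      by (rule prox_objective_strongly_convex[OF \<eta> \<nu> \<nu> \<open>\<tau> > 0\<close> _ h h, of "1/2" n k]) auto
    then have "h' + ?W \<rho> \<eta> / (2 * \<tau>) + ?W (\<nu> n) (\<nu> k) / (8 * \<tau>)
      \<le> (h n + ?W (\<nu> n) \<eta> / (2 * \<tau>)) / 2 + (h k + ?W (\<nu> k) \<eta> / (2 * \<tau>)) / 2"
      by simp
    moreover have "w \<le> 1/2 * (u + v)" if "x + w \<le> p / 2 + q / 2" "i \<le> x" "p \<le> i + u" "q \<le> i + v"
      for x w p q u v :: real
      using that by (simp add: field_simps)
    ultimately have "?W (\<nu> n) (\<nu> k) / (8 * \<tau>) \<le> 1/2 * (1 / (real n + 1) + 1 / (real k + 1))"
      using I_le[OF \<rho>] min[of n] min[of k] by blast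
    then have "?W (\<nu> n) (\<nu> k) \<le> 1/2 * (1 / (real n + 1) + 1 / (real k + 1)) * (8 * \<tau>)"
      using \<open>\<tau> > 0\<close> by (subst (asm) pos_divide_le_eq) auto
    also have "\<dots> = 4 * \<tau> * (1 / (real n + 1) + 1 / (real k + 1))"
      by simp
    finally show ?thesis .
  qed
  have moments: "(\<integral>x. (norm x)\<^sup>2 \<partial>\<nu> n) \<le> 2 * (8 * \<tau>) + 2 * (\<integral>x. (norm x)\<^sup>2 \<partial>\<nu> 0)" for n
  proof -
    have "4 * \<tau> * (1 / (real n + 1) + 1 / (real 0 + 1)) \<le> 4 * \<tau> * 2"
      using \<open>\<tau> > 0\<close> by (intro mult_left_mono) auto
    then show ?thesis
      using second_moment_le_wasserstein[OF \<nu>[of n] \<nu>[of 0]] cauchy[of n 0] by simp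
  qed
  obtain r \<rho> where r: "strict_mono (r :: nat \<Rightarrow> nat)" and \<rho>: "\<rho> \<in> P2"
    and conv: "narrow_conv (\<lambda>n. \<nu> (r n)) \<rho>"
    by (rule skorohod_subsequence[of \<nu>, OF \<nu> moments]) blast
  have r_ge: "n \<le> r n" for n
    using r by (rule seq_suble)
  \<comment> \<open>Opial's inequality with the member \<open>\<nu> n\<close> as reference point
    carries the Cauchy bound to the narrow limit: otherwise late members of the subsequence would
    stay too far from \<open>\<nu> n\<close>.\<close>
  have W_small: "?W (\<nu> n) \<rho> \<le> 8 * \<tau> / (real n + 1)" for n
  proof (rule ccontr)
    assume "\<not> ?thesis"
    then have "8 * \<tau> / (real n + 1) < ?W \<rho> (\<nu> n)"
      by (simp add: wasserstein_commute_P2[OF \<nu> \<rho>])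
    from opial_P2[OF \<nu> moments \<rho> \<nu> conv this]
    have "\<forall>\<^sub>F k in sequentially. k \<ge> n \<and> 8 * \<tau> / (real n + 1) < ?W (\<nu> (r k)) (\<nu> n)"
      using eventually_ge_at_top[of n]
    proof eventually_elim
      case (elim k)
      then show ?case
        using zero_le_power2[of "wasserstein 2 (\<nu> (r k)) \<rho>"] by linarith
    qed
    then obtain k where k: "k \<ge> n" "8 * \<tau> / (real n + 1) < ?W (\<nu> (r k)) (\<nu> n)"
      by (auto simp: eventually_sequentially)
    have "1 / (real (r k) + 1) \<le> 1 / (real n + 1)"
      using r_ge[of k] k(1) by (intro divide_left_mono) auto
    then have "4 * \<tau> * (1 / (real (r k) + 1) + 1 / (real n + 1)) \<le> 4 * \<tau> * (2 / (real n + 1))"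
      using \<open>\<tau> > 0\<close> by (intro mult_left_mono) auto
    then show False
      using k cauchy[of "r k" n] by simp
  qed
  have "(\<lambda>n. ?W (\<nu> (r n)) \<rho>) \<longlonglongrightarrow> 0"
  proof (rule tendsto_sandwich[OF _ _ tendsto_const])
    show "(\<lambda>n. 8 * \<tau> / (real (r n) + 1)) \<longlonglongrightarrow> 0"
    proof -
      have "(\<lambda>n. 8 * \<tau> / (real n + 1)) \<longlonglongrightarrow> 0"
        using tendsto_mult_right_zero[OF LIMSEQ_inverse_real_of_nat, of "8 * \<tau>"]
        by (simp add: field_simps)
      from LIMSEQ_subseq_LIMSEQ[OF this r] show ?thesis
        by (simp add: o_def)
    qed
  qed (use W_small in auto)
  then have "(\<lambda>n. sqrt (?W (\<nu> (r n)) \<rho>)) \<longlonglongrightarrow> sqrt 0"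
    by (rule tendsto_real_sqrt)
  then have "(\<lambda>n. wasserstein 2 (\<nu> (r n)) \<rho>) \<longlonglongrightarrow> 0"
    by (simp add: wasserstein_def)
  then have lscH: "H \<rho> \<le> liminf (\<lambda>n. H (\<nu> (r n)))"
    using lsc \<nu> \<rho> by (simp add: lsc_W2_def)
  \<comment> \<open>\<open>H \<rho>\<close> might still be infinite, so \<open>H\<close> is bounded
    on its own. The penalty is moved to the right through any \<open>c\<close> strictly below its
    limiting value, as Opial's inequality needs a strict gap.\<close>
  have H_le: "H \<rho> \<le> ereal (i - c / (2 * \<tau>))" if c: "c < ?W \<rho> \<eta>" for c
  proof -
    have "\<forall>\<^sub>F n in sequentially. H (\<nu> (r n)) \<le> ereal (i + 1 / (real n + 1) - c / (2 * \<tau>))"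
      using opial_P2[OF \<nu> moments \<rho> \<eta> conv c]
    proof eventually_elim
      case (elim n)
      have "c \<le> ?W (\<nu> (r n)) \<eta>"
        using elim zero_le_power2[of "wasserstein 2 (\<nu> (r n)) \<rho>"] by linarith
      then have "c / (2 * \<tau>) \<le> ?W (\<nu> (r n)) \<eta> / (2 * \<tau>)"
        using \<open>\<tau> > 0\<close> by (intro divide_right_mono) auto
      moreover have "1 / (real (r n) + 1) \<le> 1 / (real n + 1)"
        using r_ge[of n] by (intro divide_left_mono) auto
      ultimately show ?case
        using min[of "r n"] by (simp add: h)
    qed
    then have "liminf (\<lambda>n. H (\<nu> (r n))) \<le> liminf (\<lambda>n. ereal (i + 1 / (real n + 1) - c / (2 * \<tau>)))"
      by (rule Liminf_mono)
    moreover have "(\<lambda>n. ereal (i + 1 / (real n + 1) - c / (2 * \<tau>))) \<longlonglongrightarrow> ereal (i + 0 - c / (2 * \<tau>))"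
      using LIMSEQ_inverse_real_of_nat by (intro tendsto_intros) (simp add: field_simps)
    then have "liminf (\<lambda>n. ereal (i + 1 / (real n + 1) - c / (2 * \<tau>))) = ereal (i + 0 - c / (2 * \<tau>))"
      by (rule lim_imp_Liminf[OF trivial_limit_sequentially])
    ultimately show ?thesis
      using lscH by simp
  qed
  have "H \<rho> \<noteq> \<infinity>"
    using H_le[of "?W \<rho> \<eta> - 1"] by auto
  then obtain h' where h': "H \<rho> = ereal h'"
    by (rule H_finiteE[OF \<rho>])
  have "h' + ?W \<rho> \<eta> / (2 * \<tau>) \<le> i"
  proof (rule field_le_epsilon)
    fix e :: real assume "e > 0"
    then have "h' \<le> i - (?W \<rho> \<eta> - 2 * \<tau> * e) / (2 * \<tau>)"
      using H_le[of "?W \<rho> \<eta> - 2 * \<tau> * e"] \<open>\<tau> > 0\<close> by (simp add: h')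
    then show "h' + ?W \<rho> \<eta> / (2 * \<tau>) \<le> i + e"
      using \<open>\<tau> > 0\<close> by (simp add: diff_divide_distrib)
  qed
  then have "prox_objective \<tau> H \<eta> \<rho> \<le> I"
    by (simp add: prox_objective_ereal[OF h'] i)
  then have "is_arg_min (prox_objective \<tau> H \<eta>) (\<lambda>\<nu>. \<nu> \<in> P2) \<rho>"
    using \<rho> by (simp add: is_arg_min_linorder I_def le_INF_iff)
  then show ?thesis by blast
qed

text \<open>The near-minimizer \<mu> is compared with the point at parameter \<open>s\<close> on a
  curve from \<mu> to \<nu>. The gain over \<mu> is proportional to \<open>s\<close>, so dividing by
  \<open>s\<close> turns the defect \<open>d\<close> into \<open>d / s\<close>, and the strong
  convexity term keeps the factor \<open>1 - s\<close>.\<close>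

lemma approximate_prox_evi:
  assumes P: "\<eta> \<in> P2" "\<mu> \<in> P2" "\<nu> \<in> P2" and "\<tau> > 0" and s: "0 < s" "s \<le> 1"
    and H: "H \<mu> = ereal a" "H \<nu> = ereal b"
    and min: "\<And>\<rho>. \<rho> \<in> P2 \<Longrightarrow> prox_objective \<tau> H \<eta> \<mu> \<le> prox_objective \<tau> H \<eta> \<rho> + ereal (d / (2 * \<tau>))"
  shows "2 * \<tau> * (a - b) \<le> (wasserstein 2 \<nu> \<eta>)\<^sup>2 - (wasserstein 2 \<mu> \<eta>)\<^sup>2 + d / s
    - (1 - s) * (wasserstein 2 \<mu> \<nu>)\<^sup>2"
proof -
  let ?W = "\<lambda>\<mu> \<nu>. (wasserstein 2 \<mu> \<nu>)\<^sup>2"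
  obtain \<rho> h where \<rho>: "\<rho> \<in> P2" "H \<rho> = ereal h" and le:
    "h + ?W \<rho> \<eta> / (2 * \<tau>) + s * (1 - s) * ?W \<mu> \<nu> / (2 * \<tau>)
      \<le> (1 - s) * (a + ?W \<mu> \<eta> / (2 * \<tau>)) + s * (b + ?W \<nu> \<eta> / (2 * \<tau>))"
    by (rule prox_objective_strongly_convex[OF P \<open>\<tau> > 0\<close> _ H, of s]) (use s in auto)
  have "a + ?W \<mu> \<eta> / (2 * \<tau>) \<le> h + ?W \<rho> \<eta> / (2 * \<tau>) + d / (2 * \<tau>)"
    using min[OF \<rho>(1)] by (simp add: prox_objective_ereal[OF H(1)] prox_objective_ereal[OF \<rho>(2)])
  moreover define A B D E where "A = ?W \<mu> \<eta> / (2 * \<tau>)" "B = ?W \<nu> \<eta> / (2 * \<tau>)"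
    "D = ?W \<mu> \<nu> / (2 * \<tau>)" "E = d / (2 * \<tau>)"
  ultimately have "a + A + s * (1 - s) * D \<le> (1 - s) * (a + A) + s * (b + B) + E"
    using le by simp
  then have "s * (a - b) \<le> s * (B - A - (1 - s) * D) + E"
    by (simp add: algebra_simps)
  from mult_left_mono[OF this, of "2 * \<tau>"]
  have "s * (2 * \<tau> * (a - b)) \<le> s * (2 * \<tau> * B - 2 * \<tau> * A - (1 - s) * (2 * \<tau> * D)) + 2 * \<tau> * E"
    using \<open>\<tau> > 0\<close> by (simp add: algebra_simps)
  moreover have "2 * \<tau> * A = ?W \<mu> \<eta>" "2 * \<tau> * B = ?W \<nu> \<eta>" "2 * \<tau> * D = ?W \<mu> \<nu>" "2 * \<tau> * E = d"
    using \<open>\<tau> > 0\<close> by (simp_all add: A_B_D_E_def)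
  ultimately have "s * (2 * \<tau> * (a - b)) \<le> s * (?W \<nu> \<eta> - ?W \<mu> \<eta> - (1 - s) * ?W \<mu> \<nu>) + d"
    by simp
  then have "s * (2 * \<tau> * (a - b)) / s \<le> (s * (?W \<nu> \<eta> - ?W \<mu> \<eta> - (1 - s) * ?W \<mu> \<nu>) + d) / s"
    using s by (intro divide_right_mono) auto
  then show ?thesis
    using s by (simp add: add_divide_distrib)
qed

end

section \<open>The forward step\<close>

lemma has_real_derivative_along_line:
  assumes "GDERIV F (x + t *\<^sub>R v) :> g"
  shows "((\<lambda>t. F (x + t *\<^sub>R v)) has_real_derivative inner v g) (at t)"
proof -
  have "((\<lambda>t. x + t *\<^sub>R v) has_derivative (\<lambda>h. h *\<^sub>R v)) (at t)"
    by (auto intro!: derivative_eq_intros)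
  from has_derivative_compose[OF this assms[unfolded gderiv_def]]
  show ?thesis
    by (simp add: has_field_derivative_def mult_commute_abs)
qed

locale smooth_convex_function =
  fixes F :: "'a::euclidean_space \<Rightarrow> real" and gradF :: "'a \<Rightarrow> 'a" and L :: real
  assumes convex_F: "convex_on UNIV F" and gradF: "\<And>x. GDERIV F x :> gradF x"
    and L_pos: "L > 0" and lipschitz_gradF: "L-lipschitz_on UNIV gradF"
begin

lemma gradient_ineq: "F x + inner (gradF x) (y - x) \<le> F y"
proof -
  let ?\<phi> = "\<lambda>t. F (x + t *\<^sub>R (y - x))"
  have "convex_on UNIV ?\<phi>"
  proof (rule convex_onI)
    fix t a b :: real assume t: "0 < t" "t < 1"
    have "x + ((1 - t) *\<^sub>R a + t *\<^sub>R b) *\<^sub>R (y - x)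
        = (1 - t) *\<^sub>R (x + a *\<^sub>R (y - x)) + t *\<^sub>R (x + b *\<^sub>R (y - x))"
      by (simp add: algebra_simps)
    then show "?\<phi> ((1 - t) *\<^sub>R a + t *\<^sub>R b) \<le> (1 - t) * ?\<phi> a + t * ?\<phi> b"
      using convex_onD[OF convex_F, of t "x + a *\<^sub>R (y - x)" "x + b *\<^sub>R (y - x)"] t by simp
  qed auto
  moreover have "(?\<phi> has_real_derivative inner (y - x) (gradF x)) (at 0)"
    using gradF by (intro has_real_derivative_along_line) simp
  ultimately have "inner (y - x) (gradF x) * (1 - 0) \<le> ?\<phi> 1 - ?\<phi> 0"
    by (intro convex_on_imp_above_tangent[where A = UNIV]) auto
  then show ?thesis
    by (simp add: inner_commute)
qed

lemma descent_ineq: "F y \<le> F x + inner (gradF x) (y - x) + L / 2 * (norm (y - x))\<^sup>2"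
proof -
  let ?v = "y - x"
  \<comment> \<open>Removing the tangent and the quadratic leaves a function whose derivative on
    [0, 1] is nonpositive by Cauchy-Schwarz and the Lipschitz bound.\<close>
  let ?\<psi> = "\<lambda>t. F (x + t *\<^sub>R ?v) - t * inner ?v (gradF x) - L / 2 * t\<^sup>2 * (norm ?v)\<^sup>2"
  have "?\<psi> 1 \<le> ?\<psi> 0"
  proof (rule DERIV_nonpos_imp_nonincreasing[where f = ?\<psi>])
    fix t :: real assume t: "0 \<le> t" "t \<le> 1"
    let ?d = "inner ?v (gradF (x + t *\<^sub>R ?v)) - inner ?v (gradF x) - L * t * (norm ?v)\<^sup>2"
    have "(?\<psi> has_real_derivative ?d) (at t)"
      by (auto intro!: derivative_eq_intros has_real_derivative_along_line gradF)
    moreover have "inner ?v (gradF (x + t *\<^sub>R ?v)) - inner ?v (gradF x) \<le> L * t * (norm ?v)\<^sup>2"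
    proof -
      have "inner ?v (gradF (x + t *\<^sub>R ?v) - gradF x) \<le> norm ?v * norm (gradF (x + t *\<^sub>R ?v) - gradF x)"
        by (rule norm_cauchy_schwarz)
      also have "\<dots> \<le> norm ?v * (L * norm (t *\<^sub>R ?v))"
        using lipschitz_on_normD[OF lipschitz_gradF, of "x + t *\<^sub>R ?v" x]
        by (intro mult_left_mono) auto
      finally show ?thesis
        using t by (simp add: inner_diff_right power2_eq_square mult.assoc mult.left_commute)
    qed
    ultimately show "\<exists>d. (?\<psi> has_real_derivative d) (at t) \<and> d \<le> 0"
      by (intro exI[of _ ?d]) simp
  qed simp
  then show ?thesis
    by (simp add: inner_commute)
qed

lemma continuous_F: "continuous_on UNIV F"
  using gradF unfolding gderiv_def
  by (intro has_derivative_continuous_on) auto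

lemma continuous_gradF: "continuous_on UNIV gradF"
  by (rule lipschitz_on_continuous_on[OF lipschitz_gradF])

lemma measurable_F_gradF [measurable]:
  "F \<in> borel_measurable borel" "gradF \<in> borel_measurable borel"
  using continuous_F continuous_gradF by (auto intro: borel_measurable_continuous_onI)

lemma integrable_gradF_sq:
  assumes "\<mu> \<in> P2"
  shows "integrable \<mu> (\<lambda>x. (norm (gradF x))\<^sup>2)"
proof (rule Bochner_Integration.integrable_bound)
  interpret prob_space \<mu> by (rule P2D[OF assms])
  have [measurable_cong]: "sets \<mu> = sets borel" by (rule P2D[OF assms])
  show "integrable \<mu> (\<lambda>x. 2 * (norm (gradF 0))\<^sup>2 + 2 * L\<^sup>2 * (norm x)\<^sup>2)"
    using P2D(4)[OF assms] by simp
  show "(\<lambda>x. (norm (gradF x))\<^sup>2) \<in> borel_measurable \<mu>"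
    by measurable
  show "AE x in \<mu>. norm ((norm (gradF x))\<^sup>2) \<le> norm (2 * (norm (gradF 0))\<^sup>2 + 2 * L\<^sup>2 * (norm x)\<^sup>2)"
  proof (rule AE_I2)
    fix x
    have "norm (gradF x) \<le> norm (gradF 0) + norm (gradF x - gradF 0)"
      by (rule norm_triangle_sub)
    also have "\<dots> \<le> norm (gradF 0) + L * norm x"
      using lipschitz_on_normD[OF lipschitz_gradF, of x 0] by simp
    finally have "(norm (gradF x))\<^sup>2 \<le> (norm (gradF 0) + L * norm x)\<^sup>2"
      by (rule power_mono) simp
    also have "\<dots> \<le> 2 * (norm (gradF 0))\<^sup>2 + 2 * L\<^sup>2 * (norm x)\<^sup>2"
      using zero_le_power2[of "norm (gradF 0) - L * norm x"]
      by (simp add: power2_eq_square algebra_simps)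
    finally show "norm ((norm (gradF x))\<^sup>2) \<le> norm (2 * (norm (gradF 0))\<^sup>2 + 2 * L\<^sup>2 * (norm x)\<^sup>2)"
      by simp
  qed
qed

lemma integrable_F:
  assumes "\<mu> \<in> P2"
  shows "integrable \<mu> F"
proof (rule Bochner_Integration.integrable_bound)
  interpret prob_space \<mu> by (rule P2D[OF assms])
  have [measurable_cong]: "sets \<mu> = sets borel" by (rule P2D[OF assms])
  let ?b = "\<lambda>x. \<bar>F 0\<bar> + (norm (gradF 0))\<^sup>2 + (L + 1) * (norm x)\<^sup>2"
  show "integrable \<mu> ?b"
    using P2D(4)[OF assms] by simp
  show "F \<in> borel_measurable \<mu>"
    by measurable
  show "AE x in \<mu>. norm (F x) \<le> norm (?b x)"
  proof (rule AE_I2)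
    fix x
    have "\<bar>inner (gradF 0) x\<bar> \<le> norm (gradF 0) * norm x"
      by (rule Cauchy_Schwarz_ineq2)
    also have "\<dots> \<le> (norm (gradF 0))\<^sup>2 + (norm x)\<^sup>2"
      using zero_le_power2[of "norm (gradF 0) - norm x"] zero_le_power2[of "norm (gradF 0)"] zero_le_power2[of "norm x"]
      unfolding power2_diff by linarith
    finally have "\<bar>inner (gradF 0) x\<bar> \<le> (norm (gradF 0))\<^sup>2 + (norm x)\<^sup>2" .
    moreover have "0 \<le> L * (norm x)\<^sup>2"
      using L_pos by simp
    ultimately have "\<bar>F x\<bar> \<le> ?b x"
      using gradient_ineq[of 0 x] descent_ineq[of x 0] unfolding distrib_right by simp
    then show "norm (F x) \<le> norm (?b x)"
      by (simp only: real_norm_def)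
  qed
qed

definition forward :: "real \<Rightarrow> 'a \<Rightarrow> 'a" where
  "forward \<tau> x = x - \<tau> *\<^sub>R gradF x"

lemma measurable_forward [measurable]: "forward \<tau> \<in> borel_measurable borel"
  unfolding forward_def by measurable

lemma forward_expands:
  assumes "0 < \<tau>"
  shows "(1 - \<tau> * L) * norm (x - y) \<le> norm (forward \<tau> x - forward \<tau> y)"
proof -
  have "norm (x - y) - norm (\<tau> *\<^sub>R (gradF x - gradF y)) \<le> norm (x - y - \<tau> *\<^sub>R (gradF x - gradF y))"
    by (rule norm_triangle_ineq2)
  moreover have "norm (\<tau> *\<^sub>R (gradF x - gradF y)) \<le> \<tau> * (L * norm (x - y))"
    using lipschitz_on_normD[OF lipschitz_gradF, of x y] assms by (simp add: mult_left_mono)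
  moreover have "norm (x - y - \<tau> *\<^sub>R (gradF x - gradF y)) = norm (forward \<tau> x - forward \<tau> y)"
    by (simp add: forward_def algebra_simps)
  ultimately have "norm (x - y) - \<tau> * (L * norm (x - y)) \<le> norm (forward \<tau> x - forward \<tau> y)"
    by linarith
  then show ?thesis
    by (simp add: left_diff_distrib mult.assoc)
qed

text \<open>Solving \<open>forward \<tau> x = y\<close> means finding a fixed point of the
  contraction sending \<open>x\<close> to \<open>y + \<tau> *\<^sub>R gradF x\<close>. The expansion
  estimate makes the inverse Lipschitz, hence Borel, so it can be applied to the first coordinate of
  a coupling.\<close>

lemma forward_inverseE:
  assumes "0 < \<tau>" "\<tau> * L < 1"
  obtains S where "S \<in> borel_measurable borel" "\<And>x. S (forward \<tau> x) = x" "\<And>y. forward \<tau> (S y) = y"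
proof -
  have inj: "inj (forward \<tau>)"
  proof (rule injI)
    fix x y assume "forward \<tau> x = forward \<tau> y"
    then have "(1 - \<tau> * L) * norm (x - y) \<le> 0"
      using forward_expands[OF assms(1), of x y] by simp
    then show "x = y"
      using assms by (simp add: mult_le_0_iff)
  qed
  have "\<exists>x. forward \<tau> x = y" for y
  proof -
    have "\<forall>x z. dist (y + \<tau> *\<^sub>R gradF x) (y + \<tau> *\<^sub>R gradF z) \<le> (\<tau> * L) * dist x z"
      using lipschitz_onD[OF lipschitz_gradF] assms(1)
      by (simp add: dist_norm mult.assoc mult_left_mono flip: scaleR_diff_right)
    from banach_fix_type[OF _ assms(2) this] obtain x where "y + \<tau> *\<^sub>R gradF x = x"
      using assms L_pos by auto
    then show ?thesis
      by (auto simp: forward_def algebra_simps intro!: exI[of _ x])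
  qed
  then have surj: "surj (forward \<tau>)"
    by (metis surjI)
  define S where "S = inv (forward \<tau>)"
  have S: "S (forward \<tau> x) = x" "forward \<tau> (S y) = y" for x y
    using inj surj by (simp_all add: S_def surj_f_inv_f)
  have "(1 / (1 - \<tau> * L))-lipschitz_on UNIV S"
  proof (rule lipschitz_onI)
    show "dist (S x) (S y) \<le> 1 / (1 - \<tau> * L) * dist x y" for x y
      using forward_expands[OF assms(1), of "S x" "S y"] assms(2)
      by (simp add: S dist_norm pos_le_divide_eq mult.commute)
  qed (use assms in auto)
  then have "S \<in> borel_measurable borel"
    by (intro borel_measurable_continuous_onI lipschitz_on_continuous_on)
  then show ?thesis
    using that S by blast
qed

lemma forward_P2:
  assumes "\<mu> \<in> P2"
  shows "distr \<mu> borel (forward \<tau>) \<in> P2"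
proof (rule P2_distr)
  have [measurable_cong]: "sets \<mu> = sets borel" by (rule P2D[OF assms])
  show "forward \<tau> \<in> borel_measurable \<mu>"
    by measurable
  have "integrable \<mu> (\<lambda>x. (norm (x - \<tau> *\<^sub>R gradF x))\<^sup>2)"
  proof (rule integrable_norm_diff_sq)
    show "integrable \<mu> (\<lambda>x. (norm (\<tau> *\<^sub>R gradF x))\<^sup>2)"
      using integrable_gradF_sq[OF assms] by (simp add: power_mult_distrib)
  qed (use P2D[OF assms] in auto)
  then show "integrable \<mu> (\<lambda>x. (norm (forward \<tau> x))\<^sup>2)"
    by (simp add: forward_def)
qed (rule P2D[OF assms])

text \<open>In an optimal coupling of the forward measure with \<rho>, the inverse \<open>S\<close>
  recovers the point of \<mu> from its image, so both are available on the same space. Expanding the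
  square and applying the descent inequality leaves exactly the two values of \<open>F\<close> and
  the gradient term.\<close>

lemma forward_lower:
  assumes P: "\<mu> \<in> P2" "\<rho> \<in> P2" and \<tau>: "0 < \<tau>" "\<tau> * L < 1"
  shows "2 * \<tau> * ((\<integral>x. F x \<partial>\<rho>) - (\<integral>x. F x \<partial>\<mu>)) + \<tau>\<^sup>2 * (\<integral>x. (norm (gradF x))\<^sup>2 \<partial>\<mu>)
    \<le> (wasserstein 2 \<rho> (distr \<mu> borel (forward \<tau>)))\<^sup>2"
proof -
  obtain S where [measurable]: "S \<in> borel_measurable borel" and S: "\<And>x. S (forward \<tau> x) = x" "\<And>y. forward \<tau> (S y) = y"
    using forward_inverseE[OF \<tau>] by metis
  let ?\<eta> = "distr \<mu> borel (forward \<tau>)"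
  have \<eta>: "?\<eta> \<in> P2"
    by (rule forward_P2[OF P(1)])
  obtain \<gamma> where \<gamma>: "\<gamma> \<in> couplings ?\<eta> \<rho>" "(wasserstein 2 ?\<eta> \<rho>)\<^sup>2 = (\<integral>z. (norm (fst z - snd z))\<^sup>2 \<partial>\<gamma>)"
    using optimal_couplingE[OF \<eta> P(2)] by blast
  note g = couplingsD[OF \<gamma>(1)] and int = couplings_P2[OF \<gamma>(1) \<eta> P(2)]
  note [measurable_cong] = g(2) P2D(2)[OF P(1)]
  have dS: "distr \<gamma> borel (\<lambda>z. S (fst z)) = \<mu>"
  proof -
    have "distr \<gamma> borel (\<lambda>z. S (fst z)) = distr ?\<eta> borel S"
      by (simp add: distr_distr o_def flip: g(3))
    also have "\<dots> = distr \<mu> borel (\<lambda>x. x)"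
      by (simp add: distr_distr o_def S)
    also have "\<dots> = \<mu>"
      using P2D[OF P(1)] by (intro distr_id2) auto
    finally show ?thesis .
  qed
  have intF: "integrable \<gamma> (\<lambda>z. F (S (fst z)))" "integrable \<gamma> (\<lambda>z. F (snd z))"
    "integrable \<gamma> (\<lambda>z. (norm (gradF (S (fst z))))\<^sup>2)"
    using integrable_F[OF P(1)] integrable_F[OF P(2)] integrable_gradF_sq[OF P(1)]
    by (simp_all add: integrable_distr_eq flip: dS g(4))
  have eqF: "(\<integral>z. F (S (fst z)) \<partial>\<gamma>) = (\<integral>x. F x \<partial>\<mu>)" "(\<integral>z. F (snd z) \<partial>\<gamma>) = (\<integral>x. F x \<partial>\<rho>)"
    "(\<integral>z. (norm (gradF (S (fst z))))\<^sup>2 \<partial>\<gamma>) = (\<integral>x. (norm (gradF x))\<^sup>2 \<partial>\<mu>)"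
    by (simp_all add: integral_distr flip: dS g(4))
  have "2 * \<tau> * ((\<integral>x. F x \<partial>\<rho>) - (\<integral>x. F x \<partial>\<mu>)) + \<tau>\<^sup>2 * (\<integral>x. (norm (gradF x))\<^sup>2 \<partial>\<mu>)
      = (\<integral>z. 2 * \<tau> * (F (snd z) - F (S (fst z))) + \<tau>\<^sup>2 * (norm (gradF (S (fst z))))\<^sup>2 \<partial>\<gamma>)"
    unfolding eqF[symmetric] using intF by simp
  also have "\<dots> \<le> (\<integral>z. (norm (fst z - snd z))\<^sup>2 \<partial>\<gamma>)"
  proof (rule integral_mono)
    fix z :: "'a \<times> 'a"
    define x y where "x = S (fst z)" and "y = snd z"
    have z: "fst z = x - \<tau> *\<^sub>R gradF x"
      using S(2)[of "fst z"] by (simp add: x_def forward_def)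
    have eq: "(norm (fst z - y))\<^sup>2 = (norm (y - x))\<^sup>2 + 2 * \<tau> * inner (gradF x) (y - x) + \<tau>\<^sup>2 * (norm (gradF x))\<^sup>2"
      unfolding z by (simp add: power2_norm_eq_inner inner_simps inner_commute algebra_simps power2_eq_square[of \<tau>])
    \<comment> \<open>The quadratic remainder of the descent inequality is absorbed by the squared
      distance; this is the restriction on the step size.\<close>
    have "\<tau> * L * (norm (y - x))\<^sup>2 \<le> 1 * (norm (y - x))\<^sup>2"
      using \<tau> by (intro mult_right_mono) auto
    moreover have "2 * \<tau> * (F y - F x) \<le> 2 * \<tau> * (inner (gradF x) (y - x) + L / 2 * (norm (y - x))\<^sup>2)"
      using descent_ineq[of y x] \<tau> by (intro mult_left_mono) auto
    then have "2 * \<tau> * (F y - F x) \<le> 2 * \<tau> * inner (gradF x) (y - x) + \<tau> * L * (norm (y - x))\<^sup>2"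
      by (simp add: algebra_simps)
    ultimately show "2 * \<tau> * (F (snd z) - F (S (fst z))) + \<tau>\<^sup>2 * (norm (gradF (S (fst z))))\<^sup>2 \<le> (norm (fst z - snd z))\<^sup>2"
      using eq unfolding x_def y_def by linarith
  qed (use intF int in auto)
  finally show ?thesis
    using \<gamma>(2) wasserstein_commute_P2[OF \<eta> P(2)] by simp
qed

text \<open>The mirror image of the lower estimate: an optimal coupling of \<mu> and \<nu> is pushed
  forward, and convexity bounds the inner product from the other side. The same integrals of
  \<open>F\<close> and of the squared gradient under \<mu> occur in both estimates.\<close>

lemma forward_upper:
  assumes P: "\<mu> \<in> P2" "\<nu> \<in> P2" and \<tau>: "0 < \<tau>"
  shows "(wasserstein 2 \<nu> (distr \<mu> borel (forward \<tau>)))\<^sup>2 \<le> (wasserstein 2 \<mu> \<nu>)\<^sup>2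
    + 2 * \<tau> * ((\<integral>x. F x \<partial>\<nu>) - (\<integral>x. F x \<partial>\<mu>)) + \<tau>\<^sup>2 * (\<integral>x. (norm (gradF x))\<^sup>2 \<partial>\<mu>)"
proof -
  obtain \<gamma> where \<gamma>: "\<gamma> \<in> couplings \<mu> \<nu>" "(wasserstein 2 \<mu> \<nu>)\<^sup>2 = (\<integral>z. (norm (fst z - snd z))\<^sup>2 \<partial>\<gamma>)"
    using optimal_couplingE[OF P] by blast
  let ?\<eta> = "distr \<mu> borel (forward \<tau>)"
  have \<eta>: "?\<eta> \<in> P2"
    by (rule forward_P2[OF P(1)])
  note g = couplingsD[OF \<gamma>(1)] and int = couplings_P2[OF \<gamma>(1) P]
  note [measurable_cong] = g(2) P2D(2)[OF P(1)]
  have d\<eta>: "distr \<gamma> borel (\<lambda>z. forward \<tau> (fst z)) = ?\<eta>"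
    by (simp add: distr_distr o_def flip: g(3))
  have intF: "integrable \<gamma> (\<lambda>z. F (fst z))" "integrable \<gamma> (\<lambda>z. F (snd z))"
    "integrable \<gamma> (\<lambda>z. (norm (gradF (fst z)))\<^sup>2)" "integrable \<gamma> (\<lambda>z. (norm (forward \<tau> (fst z)))\<^sup>2)"
    using integrable_F[OF P(1)] integrable_F[OF P(2)] integrable_gradF_sq[OF P(1)] P2D(4)[OF \<eta>]
    by (simp_all add: integrable_distr_eq flip: g(3,4) d\<eta>)
  have eqF: "(\<integral>z. F (fst z) \<partial>\<gamma>) = (\<integral>x. F x \<partial>\<mu>)" "(\<integral>z. F (snd z) \<partial>\<gamma>) = (\<integral>x. F x \<partial>\<nu>)"
    "(\<integral>z. (norm (gradF (fst z)))\<^sup>2 \<partial>\<gamma>) = (\<integral>x. (norm (gradF x))\<^sup>2 \<partial>\<mu>)"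
    by (simp_all add: integral_distr flip: g(3,4))
  have int\<eta>: "integrable \<gamma> (\<lambda>z. (norm (forward \<tau> (fst z) - snd z))\<^sup>2)"
    by (rule integrable_norm_diff_sq) (use intF int in auto)
  have "(wasserstein 2 ?\<eta> \<nu>)\<^sup>2 \<le> (\<integral>z. (norm (forward \<tau> (fst z) - snd z))\<^sup>2 \<partial>\<gamma>)"
    using wasserstein_sq_le_distr[OF g(1) _ g(6) int\<eta>] by (simp add: d\<eta> g(4))
  also have "\<dots> \<le> (\<integral>z. (norm (fst z - snd z))\<^sup>2 + 2 * \<tau> * (F (snd z) - F (fst z)) + \<tau>\<^sup>2 * (norm (gradF (fst z)))\<^sup>2 \<partial>\<gamma>)"
  proof (rule integral_mono)
    fix z :: "'a \<times> 'a"
    define x y where "x = fst z" and "y = snd z"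
    have eq: "(norm (forward \<tau> x - y))\<^sup>2 = (norm (x - y))\<^sup>2 + 2 * \<tau> * inner (gradF x) (y - x) + \<tau>\<^sup>2 * (norm (gradF x))\<^sup>2"
      unfolding forward_def by (simp add: power2_norm_eq_inner inner_simps inner_commute algebra_simps power2_eq_square[of \<tau>])
    have "2 * \<tau> * inner (gradF x) (y - x) \<le> 2 * \<tau> * (F y - F x)"
      using gradient_ineq[of x y] \<tau> by (intro mult_left_mono) auto
    then show "(norm (forward \<tau> (fst z) - snd z))\<^sup>2 \<le> (norm (fst z - snd z))\<^sup>2 + 2 * \<tau> * (F (snd z) - F (fst z)) + \<tau>\<^sup>2 * (norm (gradF (fst z)))\<^sup>2"
      using eq unfolding x_def y_def by linarith
  qed (use int\<eta> intF int in auto)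
  also have "\<dots> = (wasserstein 2 \<mu> \<nu>)\<^sup>2 + 2 * \<tau> * ((\<integral>x. F x \<partial>\<nu>) - (\<integral>x. F x \<partial>\<mu>)) + \<tau>\<^sup>2 * (\<integral>x. (norm (gradF x))\<^sup>2 \<partial>\<mu>)"
    unfolding eqF[symmetric] \<gamma>(2) using intF int by simp
  finally show ?thesis
    using wasserstein_commute_P2[OF \<eta> P(2)] by simp
qed

end

section \<open>Convergence below the second moment\<close>

lemma tendsto_real_subseqI:
  fixes h :: "nat \<Rightarrow> real"
  assumes "\<And>r :: nat \<Rightarrow> nat. strict_mono r \<Longrightarrow> \<exists>r'. strict_mono r' \<and> (\<lambda>n. h (r (r' n))) \<longlonglongrightarrow> l"
  shows "h \<longlonglongrightarrow> l"
proof (rule tendstoI, rule ccontr)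
  fix e :: real assume "e > 0" and "\<not> (\<forall>\<^sub>F n in sequentially. dist (h n) l < e)"
  then obtain r :: "nat \<Rightarrow> nat" where r: "strict_mono r" "\<And>n. \<not> dist (h (r n)) l < e"
    using not_eventually_sequentiallyD by blast
  obtain r' where "(\<lambda>n. h (r (r' n))) \<longlonglongrightarrow> l"
    using assms[OF r(1)] by blast
  from tendstoD[OF this \<open>e > 0\<close>] r(2) show False
    by (simp add: eventually_sequentially)
qed

text \<open>A form of Vitali's theorem: growth below every multiple of \<open>V\<close>, up to a
  constant, gives uniform integrability. After splitting off \<open>d * V\<close>, the truncation at
  \<open>K\<close> is handled by dominated convergence. It serves both the test functions in
  \<open>C2w\<close> and the powers with exponent below 2.\<close>

lemma tendsto_expectation_zero:
  fixes \<phi> :: "nat \<Rightarrow> 'b \<Rightarrow> real"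
  assumes "prob_space M" and [measurable]: "\<And>n. \<phi> n \<in> borel_measurable M"
    and lim: "AE \<omega> in M. (\<lambda>n. \<phi> n \<omega>) \<longlonglongrightarrow> 0"
    and V: "\<And>n. integrable M (V n)" "\<And>n. (\<integral>\<omega>. V n \<omega> \<partial>M) \<le> C" "\<And>n \<omega>. 0 \<le> V n \<omega>"
    and bound: "\<And>d. d > 0 \<Longrightarrow> \<exists>K. \<forall>n \<omega>. \<bar>\<phi> n \<omega>\<bar> \<le> d * V n \<omega> + K"
  shows "\<And>n. integrable M (\<phi> n)" "(\<lambda>n. \<integral>\<omega>. \<bar>\<phi> n \<omega>\<bar> \<partial>M) \<longlonglongrightarrow> 0"
proof -
  interpret prob_space M by fact
  show int: "integrable M (\<phi> n)" for n
  proof -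
    obtain K where K: "\<And>n \<omega>. \<bar>\<phi> n \<omega>\<bar> \<le> 1 * V n \<omega> + K"
      using bound[of 1] by auto
    show ?thesis
    proof (rule Bochner_Integration.integrable_bound)
      show "integrable M (\<lambda>\<omega>. 1 * V n \<omega> + K)"
        using V(1) by simp
      show "AE \<omega> in M. norm (\<phi> n \<omega>) \<le> norm (1 * V n \<omega> + K)"
        using K[of n] by (intro AE_I2) (simp, smt (verit))
    qed simp
  qed
  show "(\<lambda>n. \<integral>\<omega>. \<bar>\<phi> n \<omega>\<bar> \<partial>M) \<longlonglongrightarrow> 0"
  proof (rule tendstoI)
    fix e :: real assume "e > 0"
    define c where "c = \<bar>C\<bar> + 1"
    define d where "d = e / (2 * c)"
    have "c > 0" "C \<le> c"
      by (auto simp: c_def)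
    then have "d > 0" using \<open>e > 0\<close> by (simp add: d_def)
    have "d * C \<le> d * c"
      using \<open>d > 0\<close> \<open>C \<le> c\<close> by (intro mult_left_mono) auto
    then have dC: "d * C \<le> e / 2"
      using \<open>c > 0\<close> by (simp add: d_def)
    obtain K0 where K0: "\<And>n \<omega>. \<bar>\<phi> n \<omega>\<bar> \<le> d * V n \<omega> + K0"
      using bound[OF \<open>d > 0\<close>] by blast
    \<comment> \<open>The truncation level must be nonnegative for the truncated functions to tend
      to 0.\<close>
    define K where "K = max 0 K0"
    have "(\<lambda>n. \<integral>\<omega>. min \<bar>\<phi> n \<omega>\<bar> K \<partial>M) \<longlonglongrightarrow> (\<integral>\<omega>. 0 \<partial>M)"
    proof (rule integral_dominated_convergence[where w = "\<lambda>_. K"])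
      show "AE \<omega> in M. (\<lambda>n. min \<bar>\<phi> n \<omega>\<bar> K) \<longlonglongrightarrow> 0"
        using lim
      proof eventually_elim
        case (elim \<omega>)
        have "(\<lambda>n. min \<bar>\<phi> n \<omega>\<bar> K) \<longlonglongrightarrow> min \<bar>0\<bar> K"
          by (intro tendsto_intros elim)
        then show ?case by (simp add: K_def)
      qed
    qed (auto simp: K_def)
    then have "\<forall>\<^sub>F n in sequentially. (\<integral>\<omega>. min \<bar>\<phi> n \<omega>\<bar> K \<partial>M) < e / 2"
      using \<open>e > 0\<close> by (intro order_tendstoD) auto
    then show "\<forall>\<^sub>F n in sequentially. dist (\<integral>\<omega>. \<bar>\<phi> n \<omega>\<bar> \<partial>M) 0 < e"
    proof eventually_elim
      case (elim n)
      have minint: "integrable M (\<lambda>\<omega>. min \<bar>\<phi> n \<omega>\<bar> K)"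
        by (rule integrable_const_bound[of _ K]) (auto simp: K_def)
      have "(\<integral>\<omega>. \<bar>\<phi> n \<omega>\<bar> \<partial>M) \<le> (\<integral>\<omega>. d * V n \<omega> + min \<bar>\<phi> n \<omega>\<bar> K \<partial>M)"
      proof (rule integral_mono)
        fix \<omega>
        have "0 \<le> d * V n \<omega>"
          using V(3) \<open>d > 0\<close> by simp
        then show "\<bar>\<phi> n \<omega>\<bar> \<le> d * V n \<omega> + min \<bar>\<phi> n \<omega>\<bar> K"
          using K0[of n \<omega>] by (simp add: K_def min_def max_def)
      qed (use int V minint in auto)
      also have "\<dots> = d * (\<integral>\<omega>. V n \<omega> \<partial>M) + (\<integral>\<omega>. min \<bar>\<phi> n \<omega>\<bar> K \<partial>M)"
        using V(1) minint by simp
      also have "d * (\<integral>\<omega>. V n \<omega> \<partial>M) \<le> d * C"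
        using V(2) \<open>d > 0\<close> by (intro mult_left_mono) auto
      finally have "(\<integral>\<omega>. \<bar>\<phi> n \<omega>\<bar> \<partial>M) < e"
        using dC elim by linarith
      moreover have "0 \<le> (\<integral>\<omega>. \<bar>\<phi> n \<omega>\<bar> \<partial>M)"
        by (simp add: integral_nonneg_AE)
      ultimately show ?case
        by (simp add: dist_real_def)
    qed
  qed
qed

lemma powr_le_square:
  fixes p d :: real
  assumes "0 < p" "p < 2" "0 < d"
  obtains K where "\<And>x. 0 \<le> x \<Longrightarrow> x powr p \<le> d * x\<^sup>2 + K"
proof
  \<comment> \<open>Beyond this radius the factor \<open>x powr (p - 2)\<close> drops below
    \<open>d\<close>, since its exponent is negative.\<close>
  define R where "R = d powr (1 / (p - 2))"
  have R: "R > 0" "R powr (p - 2) = d"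
    using assms by (simp_all add: R_def powr_powr)
  fix x :: real assume x: "0 \<le> x"
  show "x powr p \<le> d * x\<^sup>2 + R powr p"
  proof (cases "x \<le> R")
    case True
    then have "x powr p \<le> R powr p"
      using x assms by (intro powr_mono2) auto
    then show ?thesis
      using \<open>0 < d\<close> by (simp add: add_increasing)
  next
    case False
    then have "x powr (p - 2) \<le> d"
      using R assms powr_mono2'[of "p - 2" R x] by simp
    then have "x powr (p - 2) * x\<^sup>2 \<le> d * x\<^sup>2"
      by (rule mult_right_mono) simp
    moreover have "x powr (p - 2) * x\<^sup>2 = x powr p"
      using False R by (simp add: powr_diff)
    ultimately show ?thesis
      by (simp add: add_increasing2)
  qed
qed

lemma C2w_le_square:
  fixes f :: "'a::euclidean_space \<Rightarrow> real"
  assumes f: "f \<in> C2w" and "0 < d"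
  obtains K where "\<And>x. \<bar>f x\<bar> \<le> d * (norm x)\<^sup>2 + K"
proof -
  have cont: "continuous_on UNIV f" and lim: "((\<lambda>x. f x / (1 + (norm x)\<^sup>2)) \<longlongrightarrow> 0) at_infinity"
    using f by (auto simp: C2w_def)
  from tendstoD[OF lim \<open>0 < d\<close>] obtain b where
    b: "\<And>x. b \<le> norm x \<Longrightarrow> \<bar>f x / (1 + (norm x)\<^sup>2)\<bar> < d"
    by (auto simp: eventually_at_infinity dist_real_def)
  have "compact (f ` cball 0 b)"
    by (rule compact_continuous_image[OF continuous_on_subset[OF cont]]) auto
  then obtain K where K: "\<And>x. norm x \<le> b \<Longrightarrow> \<bar>f x\<bar> \<le> K"
    using compact_imp_bounded by (force simp: bounded_iff)
  \<comment> \<open>The absolute value guards against a negative \<open>K\<close>, possible when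
    \<open>b\<close> is negative and the ball is empty.\<close>
  have "\<bar>f x\<bar> \<le> d * (norm x)\<^sup>2 + (d + \<bar>K\<bar>)" for x
  proof (cases "norm x \<le> b")
    case True
    have "0 \<le> d * (norm x)\<^sup>2"
      using \<open>0 < d\<close> by simp
    then show ?thesis
      using K[OF True] \<open>0 < d\<close> by linarith
  next
    case False
    have pos: "0 < 1 + (norm x)\<^sup>2"
      using zero_le_power2[of "norm x"] by linarith
    have "\<bar>f x\<bar> / (1 + (norm x)\<^sup>2) < d"
      using b[of x] False pos by simp
    then have "\<bar>f x\<bar> < d * (1 + (norm x)\<^sup>2)"
      using pos by (simp add: pos_divide_less_eq)
    then show ?thesis
      by (simp add: distrib_left)
  qed
  then show ?thesis
    by (rule that)
qed

text \<open>The hypothesis asks for uniqueness of narrow cluster points, which is the form that the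
  Opial argument delivers. Every subsequence then has a further one represented by variables
  converging almost surely to a variable of law \<mu>, and the moment bound controls all growth
  strictly below quadratic.\<close>

lemma tendsto_P2:
  fixes m :: "nat \<Rightarrow> 'a::euclidean_space measure"
  assumes m: "\<And>n. m n \<in> P2" and C: "\<And>n. (\<integral>x. (norm x)\<^sup>2 \<partial>m n) \<le> C" and \<mu>: "\<mu> \<in> P2"
    and uniq: "\<And>(r :: nat \<Rightarrow> nat) \<rho>. strict_mono r \<Longrightarrow> \<rho> \<in> P2 \<Longrightarrow> narrow_conv (\<lambda>n. m (r n)) \<rho> \<Longrightarrow> \<rho> = \<mu>"
  shows "limitin tau_w2 m \<mu> sequentially"
    "\<And>p. 1 \<le> p \<Longrightarrow> p < 2 \<Longrightarrow> (\<lambda>n. wasserstein p (m n) \<mu>) \<longlonglongrightarrow> 0"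
proof -
  define D where "D = (\<integral>x. (norm x)\<^sup>2 \<partial>\<mu>)"
  have rep: "\<exists>(r' :: nat \<Rightarrow> nat) (M :: real measure) X Y. strict_mono r' \<and> prob_space M \<and>
      (\<forall>n. X n \<in> borel_measurable M) \<and> Y \<in> borel_measurable M \<and>
      (\<forall>n. distr M borel (X n) = m (r (r' n))) \<and> distr M borel Y = \<mu> \<and>
      (AE \<omega> in M. (\<lambda>n. X n \<omega>) \<longlonglongrightarrow> Y \<omega>)"
    if r: "strict_mono r" for r :: "nat \<Rightarrow> nat"
  proof -
    obtain r' M X Y where *: "strict_mono (r' :: nat \<Rightarrow> nat)" "prob_space (M :: real measure)"
      "\<And>n. X n \<in> borel_measurable M" "Y \<in> borel_measurable M"
      "\<And>n. distr M borel (X n) = m (r (r' n))" "AE \<omega> in M. (\<lambda>n. X n \<omega>) \<longlonglongrightarrow> Y \<omega>"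
      "distr M borel Y \<in> P2" "narrow_conv (\<lambda>n. m (r (r' n))) (distr M borel Y)"
      by (rule skorohod_subsequence[of "\<lambda>n. m (r n)" C, OF m C]) blast
    have "distr M borel Y = \<mu>"
      using uniq[of "\<lambda>n. r (r' n)"] * strict_mono_o[OF r *(1)] by (simp add: o_def)
    then show ?thesis
      using * by blast
  qed
  show "limitin tau_w2 m \<mu> sequentially"
    unfolding limitin_tau_w2[OF m \<mu>]
  proof (intro ballI tendsto_real_subseqI)
    fix f :: "'a \<Rightarrow> real" and r :: "nat \<Rightarrow> nat" assume f: "f \<in> C2w" and "strict_mono r"
    from rep[OF this(2)] obtain r' M X Y where r': "strict_mono (r' :: nat \<Rightarrow> nat)"
      and M: "prob_space (M :: real measure)"
      and [measurable]: "\<And>n. X n \<in> borel_measurable M" "Y \<in> borel_measurable M"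
      and dX: "\<And>n. distr M borel (X n) = m (r (r' n))" and dY: "distr M borel Y = \<mu>"
      and lim: "AE \<omega> in M. (\<lambda>n. X n \<omega>) \<longlonglongrightarrow> Y \<omega>"
      by blast
    interpret prob_space M by (rule M)
    have cont: "continuous_on UNIV f"
      using f by (simp add: C2w_def)
    then have [measurable]: "f \<in> borel_measurable borel"
      by (rule borel_measurable_continuous_onI)
    have X2: "integrable M (\<lambda>\<omega>. (norm (X n \<omega>))\<^sup>2)" "(\<integral>\<omega>. (norm (X n \<omega>))\<^sup>2 \<partial>M) \<le> C" for n
      using P2_distrD[of M "X n"] m C by (simp_all add: dX)
    have Y2: "integrable M (\<lambda>\<omega>. (norm (Y \<omega>))\<^sup>2)" "(\<integral>\<omega>. (norm (Y \<omega>))\<^sup>2 \<partial>M) = D"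
      using P2_distrD[of M Y] \<mu> by (simp_all add: dY D_def)
    obtain K1 where K1: "\<And>x. \<bar>f x\<bar> \<le> 1 * (norm x)\<^sup>2 + K1"
      using C2w_le_square[OF f zero_less_one] by blast
    have fY: "integrable M (\<lambda>\<omega>. f (Y \<omega>))"
    proof (rule Bochner_Integration.integrable_bound)
      show "integrable M (\<lambda>\<omega>. 1 * (norm (Y \<omega>))\<^sup>2 + K1)"
        using Y2 by simp
      show "AE \<omega> in M. norm (f (Y \<omega>)) \<le> norm (1 * (norm (Y \<omega>))\<^sup>2 + K1)"
        using order_trans[OF K1 abs_ge_self] by (intro AE_I2) simp
    qed measurable
    let ?\<phi> = "\<lambda>n \<omega>. f (X n \<omega>) - f (Y \<omega>)"
    let ?V = "\<lambda>n \<omega>. (norm (X n \<omega>))\<^sup>2 + (norm (Y \<omega>))\<^sup>2"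
    have AE: "AE \<omega> in M. (\<lambda>n. ?\<phi> n \<omega>) \<longlonglongrightarrow> 0"
        using lim
      proof eventually_elim
        case (elim \<omega>)
        from continuous_on_tendsto_compose[OF cont this] show ?case
          by (simp add: LIM_zero)
      qed
    have V: "integrable M (?V n)" "(\<integral>\<omega>. ?V n \<omega> \<partial>M) \<le> C + D" for n
        using X2 Y2 by simp_all
    have bd: "\<exists>K. \<forall>n \<omega>. \<bar>?\<phi> n \<omega>\<bar> \<le> d * ?V n \<omega> + K" if "d > 0" for d
      proof -
        obtain K where K: "\<And>x. \<bar>f x\<bar> \<le> d * (norm x)\<^sup>2 + K"
          using C2w_le_square[OF f \<open>d > 0\<close>] by blast
        have "\<bar>?\<phi> n \<omega>\<bar> \<le> d * ?V n \<omega> + (K + K)" for n \<omega>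
          using K[of "X n \<omega>"] K[of "Y \<omega>"] by (simp add: distrib_left)
        then show ?thesis by blast
      qed
    have meas: "?\<phi> n \<in> borel_measurable M" for n
      by measurable
    have V0: "0 \<le> ?V n \<omega>" for n \<omega>
      by simp
    note * = tendsto_expectation_zero[where V = ?V, OF M meas AE V V0 bd]
    have fX: "integrable M (\<lambda>\<omega>. f (X n \<omega>))" for n
      using Bochner_Integration.integrable_add[OF *(1)[of n] fY] by simp
    have "(\<lambda>n. \<integral>\<omega>. ?\<phi> n \<omega> \<partial>M) \<longlonglongrightarrow> 0"
    proof (rule tendsto_rabs_zero_cancel, rule tendsto_sandwich[OF _ _ tendsto_const *(2)])
      show "\<forall>\<^sub>F n in sequentially. \<bar>\<integral>\<omega>. ?\<phi> n \<omega> \<partial>M\<bar> \<le> (\<integral>\<omega>. \<bar>?\<phi> n \<omega>\<bar> \<partial>M)"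
        by (intro always_eventually allI integral_abs_bound)
    qed auto
    then have "(\<lambda>n. (\<integral>\<omega>. f (X n \<omega>) \<partial>M) - (\<integral>\<omega>. f (Y \<omega>) \<partial>M)) \<longlonglongrightarrow> 0"
      using fX fY by simp
    then have "(\<lambda>n. \<integral>\<omega>. f (X n \<omega>) \<partial>M) \<longlonglongrightarrow> (\<integral>\<omega>. f (Y \<omega>) \<partial>M)"
      by (rule LIM_zero_cancel)
    then have "(\<lambda>n. \<integral>x. f x \<partial>m (r (r' n))) \<longlonglongrightarrow> (\<integral>x. f x \<partial>\<mu>)"
      by (simp add: integral_distr flip: dX dY)
    with r' show "\<exists>r'. strict_mono r' \<and> (\<lambda>n. \<integral>x. f x \<partial>m (r (r' n))) \<longlonglongrightarrow> (\<integral>x. f x \<partial>\<mu>)"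
      by blast
  qed
  fix p :: real assume p: "1 \<le> p" "p < 2"
  show "(\<lambda>n. wasserstein p (m n) \<mu>) \<longlonglongrightarrow> 0"
  proof (rule tendsto_real_subseqI)
    fix r :: "nat \<Rightarrow> nat" assume "strict_mono r"
    from rep[OF this] obtain r' M X Y where r': "strict_mono (r' :: nat \<Rightarrow> nat)"
      and M: "prob_space (M :: real measure)"
      and [measurable]: "\<And>n. X n \<in> borel_measurable M" "Y \<in> borel_measurable M"
      and dX: "\<And>n. distr M borel (X n) = m (r (r' n))" and dY: "distr M borel Y = \<mu>"
      and lim: "AE \<omega> in M. (\<lambda>n. X n \<omega>) \<longlonglongrightarrow> Y \<omega>"
      by blast
    interpret prob_space M by (rule M)
    have X2: "integrable M (\<lambda>\<omega>. (norm (X n \<omega>))\<^sup>2)" "(\<integral>\<omega>. (norm (X n \<omega>))\<^sup>2 \<partial>M) \<le> C" for n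
      using P2_distrD[of M "X n"] m C by (simp_all add: dX)
    have Y2: "integrable M (\<lambda>\<omega>. (norm (Y \<omega>))\<^sup>2)" "(\<integral>\<omega>. (norm (Y \<omega>))\<^sup>2 \<partial>M) = D"
      using P2_distrD[of M Y] \<mu> by (simp_all add: dY D_def)
    let ?\<phi> = "\<lambda>n \<omega>. dist (X n \<omega>) (Y \<omega>) powr p"
    let ?V = "\<lambda>n \<omega>. 2 * (norm (X n \<omega>))\<^sup>2 + 2 * (norm (Y \<omega>))\<^sup>2"
    have AE: "AE \<omega> in M. (\<lambda>n. ?\<phi> n \<omega>) \<longlonglongrightarrow> 0"
        using lim
      proof eventually_elim
        case (elim \<omega>)
        then show ?case
          using p by (intro tendsto_zero_powrI[OF _ tendsto_const]) (auto simp: tendsto_dist_iff[symmetric])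
      qed
    have V: "integrable M (?V n)" "(\<integral>\<omega>. ?V n \<omega> \<partial>M) \<le> 2 * C + 2 * D" for n
        using X2 Y2 by simp_all
    have bd: "\<exists>K. \<forall>n \<omega>. \<bar>?\<phi> n \<omega>\<bar> \<le> d * ?V n \<omega> + K" if "d > 0" for d
      proof -
        obtain K where K: "\<And>x. 0 \<le> x \<Longrightarrow> x powr p \<le> d * x\<^sup>2 + K"
          using powr_le_square[of p d] p \<open>d > 0\<close> by auto
        have "\<bar>?\<phi> n \<omega>\<bar> \<le> d * ?V n \<omega> + K" for n \<omega>
        proof -
          have "(norm (X n \<omega> - Y \<omega>))\<^sup>2 + (norm (X n \<omega> + Y \<omega>))\<^sup>2 = ?V n \<omega>"
            by (simp add: power2_norm_eq_inner algebra_simps)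
          then have "(dist (X n \<omega>) (Y \<omega>))\<^sup>2 \<le> ?V n \<omega>"
            using zero_le_power2[of "norm (X n \<omega> + Y \<omega>)"] unfolding dist_norm by linarith
          then have "d * (dist (X n \<omega>) (Y \<omega>))\<^sup>2 \<le> d * ?V n \<omega>"
            using that by (intro mult_left_mono) auto
          then show ?thesis
            using K[of "dist (X n \<omega>) (Y \<omega>)"] by simp
        qed
        then show ?thesis by blast
      qed
    have meas: "?\<phi> n \<in> borel_measurable M" for n
      by measurable
    have V0: "0 \<le> ?V n \<omega>" for n \<omega>
      by simp
    note * = tendsto_expectation_zero[where V = ?V, OF M meas AE V V0 bd]
    have "(\<lambda>n. (\<integral>\<omega>. ?\<phi> n \<omega> \<partial>M) powr (1 / p)) \<longlonglongrightarrow> 0"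
      using *(2) p by (intro tendsto_zero_powrI[OF _ tendsto_const]) (auto intro!: integral_nonneg_AE)
    then have "(\<lambda>n. wasserstein p (m (r (r' n))) \<mu>) \<longlonglongrightarrow> 0"
    proof (rule tendsto_sandwich[OF _ _ tendsto_const, rotated -1])
      show "\<forall>\<^sub>F n in sequentially. 0 \<le> wasserstein p (m (r (r' n))) \<mu>"
        by (simp add: wasserstein_def)
      show "\<forall>\<^sub>F n in sequentially. wasserstein p (m (r (r' n))) \<mu> \<le> (\<integral>\<omega>. ?\<phi> n \<omega> \<partial>M) powr (1 / p)"
        using wasserstein_le_distr[OF M _ _ *(1)] p by (simp add: dX dY)
    qed
    with r' show "\<exists>r'. strict_mono r' \<and> (\<lambda>n. wasserstein p (m (r (r' n))) \<mu>) \<longlonglongrightarrow> 0"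
      by blast
  qed
qed

section \<open>The inexact forward-backward iteration\<close>

locale forward_backward = geodesically_convex_functional H + smooth_convex_function F gradF L
  for H :: "'a::euclidean_space measure \<Rightarrow> ereal" and F :: "'a \<Rightarrow> real" and gradF L +
  fixes G :: "'a measure \<Rightarrow> ereal"
  assumes G_def: "\<And>\<nu>. G \<nu> = ereal (\<integral>x. F x \<partial>\<nu>) + H \<nu>"
    and argmin_nonempty: "argmin_P2 G \<noteq> {}"
begin

abbreviation W2 :: "'a measure \<Rightarrow> 'a measure \<Rightarrow> real" where
  "W2 \<equiv> wasserstein 2"

lemma W2_nonneg: "0 \<le> W2 \<mu> \<nu>"
  by (simp add: wasserstein_def)

definition Gmin :: real where
  "Gmin = real_of_ereal (INF \<nu>\<in>P2. G \<nu>)"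

lemma G_ereal: "H \<nu> = ereal h \<Longrightarrow> G \<nu> = ereal ((\<integral>x. F x \<partial>\<nu>) + h)"
  by (simp add: G_def)

lemma G_finiteE:
  assumes "\<nu> \<in> P2" "G \<nu> \<noteq> \<infinity>"
  obtains h where "H \<nu> = ereal h" "G \<nu> = ereal ((\<integral>x. F x \<partial>\<nu>) + h)"
  using assms G_ereal by (auto simp: G_def elim: H_finiteE)

text \<open>A minimizer excludes the value minus infinity and properness excludes plus infinity, so
  \<open>real_of_ereal\<close> in \<open>Gmin\<close> loses nothing.\<close>

lemma INF_G: "(INF \<nu>\<in>P2. G \<nu>) = ereal Gmin"
proof -
  obtain \<mu> where \<mu>: "\<mu> \<in> P2" "\<And>\<nu>. \<nu> \<in> P2 \<Longrightarrow> G \<mu> \<le> G \<nu>"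
    using argmin_nonempty by (auto simp: argmin_P2_def is_arg_min_linorder)
  obtain \<nu>0 where \<nu>0: "\<nu>0 \<in> P2" "H \<nu>0 \<noteq> \<infinity>"
    using proper by (auto simp: proper_on_P2_def)
  have "G \<mu> \<noteq> \<infinity>"
    using \<mu>(2)[OF \<nu>0(1)] \<nu>0 by (auto simp: G_def)
  then obtain h where "G \<mu> = ereal h"
    using \<mu>(1) by (metis G_finiteE)
  moreover have "(INF \<nu>\<in>P2. G \<nu>) = G \<mu>"
    using \<mu> by (intro antisym INF_lower INF_greatest)
  ultimately show ?thesis
    by (simp add: Gmin_def)
qed

lemma Gmin_le: "\<nu> \<in> P2 \<Longrightarrow> ereal Gmin \<le> G \<nu>"
  unfolding INF_G[symmetric] by (rule INF_lower)

lemma argmin_P2_iff: "\<mu> \<in> argmin_P2 G \<longleftrightarrow> \<mu> \<in> P2 \<and> G \<mu> = ereal Gmin"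
proof
  assume "\<mu> \<in> argmin_P2 G"
  then have "\<mu> \<in> P2" "\<And>\<nu>. \<nu> \<in> P2 \<Longrightarrow> G \<mu> \<le> G \<nu>"
    by (auto simp: argmin_P2_def is_arg_min_linorder)
  then show "\<mu> \<in> P2 \<and> G \<mu> = ereal Gmin"
    unfolding INF_G[symmetric] by (auto intro!: antisym INF_lower INF_greatest)
next
  assume "\<mu> \<in> P2 \<and> G \<mu> = ereal Gmin"
  then show "\<mu> \<in> argmin_P2 G"
    using Gmin_le by (auto simp: argmin_P2_def is_arg_min_linorder)
qed

text \<open>\<open>J\<close> is a choice operator, so it has the minimizing property only once some
  minimizer exists. Existence needs a lower bound: by \<open>forward_lower\<close> the penalty
  dominates the increase of the potential energy from \<mu>, and the objective is at least
  \<open>Gmin\<close> minus the energy of \<mu>.\<close>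

lemma J_is_arg_min:
  assumes \<mu>: "\<mu> \<in> P2" and \<tau>: "0 < \<tau>" "\<tau> * L < 1"
  defines "\<eta> \<equiv> distr \<mu> borel (forward \<tau>)"
  shows "is_arg_min (prox_objective \<tau> H \<eta>) (\<lambda>\<nu>. \<nu> \<in> P2) (J \<tau> H \<eta>)"
proof -
  have \<eta>: "\<eta> \<in> P2"
    unfolding \<eta>_def by (rule forward_P2[OF \<mu>])
  have "ereal (Gmin - (\<integral>x. F x \<partial>\<mu>)) \<le> prox_objective \<tau> H \<eta> \<nu>" if \<nu>: "\<nu> \<in> P2" for \<nu>
  proof (cases "H \<nu> = \<infinity>")
    case True
    then show ?thesis by (simp add: prox_objective_def)
  next
    case False
    then obtain h where h: "H \<nu> = ereal h"
      by (rule H_finiteE[OF \<nu>])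
    have "Gmin \<le> (\<integral>x. F x \<partial>\<nu>) + h"
      using Gmin_le[OF \<nu>] G_ereal[OF h] by simp
    moreover have "0 \<le> \<tau>\<^sup>2 * (\<integral>x. (norm (gradF x))\<^sup>2 \<partial>\<mu>)"
      by (simp add: integral_nonneg_AE)
    then have "2 * \<tau> * ((\<integral>x. F x \<partial>\<nu>) - (\<integral>x. F x \<partial>\<mu>)) \<le> (W2 \<nu> \<eta>)\<^sup>2"
      using forward_lower[OF \<mu> \<nu> \<tau>] unfolding \<eta>_def by linarith
    then have "(\<integral>x. F x \<partial>\<nu>) - (\<integral>x. F x \<partial>\<mu>) \<le> (W2 \<nu> \<eta>)\<^sup>2 / (2 * \<tau>)"
      using \<tau> by (simp add: pos_le_divide_eq mult.commute)
    ultimately show ?thesis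
      by (simp add: prox_objective_ereal[OF h])
  qed
  from prox_minimizer_exists[OF \<eta> \<tau>(1) this] show ?thesis
    unfolding J_def arg_min_def by (rule someI_ex)
qed

text \<open>Isolating one step lets the same estimates serve the inexact iteration and, with
  \<epsilon> = 0, the exact step from a candidate limit.\<close>

definition approximate_step :: "real \<Rightarrow> real \<Rightarrow> 'a measure \<Rightarrow> 'a measure \<Rightarrow> bool" where
  "approximate_step \<tau> \<epsilon> \<mu> m \<longleftrightarrow> (let \<eta> = distr \<mu> borel (forward \<tau>) in
     prox_objective \<tau> H \<eta> m \<le> prox_objective \<tau> H \<eta> (J \<tau> H \<eta>) + ereal (\<epsilon>\<^sup>2 / (2 * \<tau>)))"

section \<open>Estimates for a single inexact step\<close>

context
  fixes \<tau> \<epsilon> :: real and \<mu> m :: "'a measure"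
  assumes \<tau>: "0 < \<tau>" "\<tau> * L < 1" and \<mu>: "\<mu> \<in> P2" and m: "m \<in> P2"
    and \<epsilon>: "0 \<le> \<epsilon>" and step: "approximate_step \<tau> \<epsilon> \<mu> m"
begin

lemma approximate_step_le:
  assumes "\<rho> \<in> P2"
  defines "\<eta> \<equiv> distr \<mu> borel (forward \<tau>)"
  shows "prox_objective \<tau> H \<eta> m \<le> prox_objective \<tau> H \<eta> \<rho> + ereal (\<epsilon>\<^sup>2 / (2 * \<tau>))"
proof -
  have "prox_objective \<tau> H \<eta> (J \<tau> H \<eta>) \<le> prox_objective \<tau> H \<eta> \<rho>"
    using J_is_arg_min[OF \<mu> \<tau>] assms by (simp add: is_arg_min_linorder)
  then show ?thesis
    using step unfolding approximate_step_def Let_def \<eta>_def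
    by (meson add_right_mono order_trans)
qed

lemma approximate_step_G_finite:
  obtains h where "H m = ereal h" "G m = ereal ((\<integral>x. F x \<partial>m) + h)"
proof -
  obtain \<nu>0 where \<nu>0: "\<nu>0 \<in> P2" "H \<nu>0 \<noteq> \<infinity>"
    using proper by (auto simp: proper_on_P2_def)
  have "H m \<noteq> \<infinity>"
    using approximate_step_le[OF \<nu>0(1)] \<nu>0(2) by (auto simp: prox_objective_def)
  then obtain h where "H m = ereal h"
    by (rule H_finiteE[OF m])
  then show ?thesis
    using that G_ereal by blast
qed

text \<open>The proximal inequality for \<open>H\<close> is added to the two forward estimates. The
  distances to the forward measure, the energy of \<mu> and the squared gradient all cancel.\<close>

lemma approximate_step_evi:
  assumes \<nu>: "\<nu> \<in> P2" and s: "0 < s" "s \<le> 1" and G: "G m = ereal a" "G \<nu> = ereal b"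
  shows "2 * \<tau> * (a - b) \<le> (W2 \<mu> \<nu>)\<^sup>2 - (1 - s) * (W2 m \<nu>)\<^sup>2 + \<epsilon>\<^sup>2 / s"
proof -
  let ?\<eta> = "distr \<mu> borel (forward \<tau>)"
  obtain h where h: "H m = ereal h" "a = (\<integral>x. F x \<partial>m) + h"
    using G(1) by (auto intro: G_finiteE[OF m])
  obtain k where k: "H \<nu> = ereal k" "b = (\<integral>x. F x \<partial>\<nu>) + k"
    using G(2) by (auto intro: G_finiteE[OF \<nu>])
  have "2 * \<tau> * (h - k) \<le> (W2 \<nu> ?\<eta>)\<^sup>2 - (W2 m ?\<eta>)\<^sup>2 + \<epsilon>\<^sup>2 / s - (1 - s) * (W2 m \<nu>)\<^sup>2"
    by (rule approximate_prox_evi[OF forward_P2[OF \<mu>] m \<nu> \<tau>(1) s h(1) k(1) approximate_step_le])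
  with forward_lower[OF \<mu> m \<tau>] forward_upper[OF \<mu> \<nu> \<tau>(1)] show ?thesis
    unfolding h k by (simp add: algebra_simps)
qed

text \<open>Optimizing the inequality above over \<open>s\<close> leads to \<open>s = \<epsilon> / W2 m \<nu>\<close>, truncated at \<open>1\<close>.\<close>

lemma approximate_step_quasi_fejer:
  assumes \<nu>: "\<nu> \<in> P2" and G: "G m = ereal a" "G \<nu> = ereal b"
  shows "2 * \<tau> * (a - b) \<le> (W2 \<mu> \<nu>)\<^sup>2 - (W2 m \<nu>)\<^sup>2 + 2 * \<epsilon> * (W2 m \<nu> + \<epsilon>)"
proof -
  define w where "w = W2 m \<nu>"
  have w0: "0 \<le> w"
    by (simp add: w_def W2_nonneg)
  note evi = approximate_step_evi[OF \<nu> _ _ G, folded w_def]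
  consider "w < \<epsilon>" | "\<epsilon> \<le> w" "0 < \<epsilon>" | "\<epsilon> = 0"
    using \<epsilon> by linarith
  then show ?thesis
    unfolding w_def[symmetric]
  proof cases
    \<comment> \<open>The truncated choice \<open>s = 1\<close> discards the contraction term; it is
      restored because \<open>w\<^sup>2\<close> is then at most
      \<open>\<epsilon>\<^sup>2\<close>.\<close>
    case 1
    have "w\<^sup>2 \<le> \<epsilon>\<^sup>2"
      using 1 w0 by (intro power_mono) auto
    moreover have "0 \<le> \<epsilon> * w"
      using w0 \<epsilon> by simp
    ultimately show "2 * \<tau> * (a - b) \<le> (W2 \<mu> \<nu>)\<^sup>2 - w\<^sup>2 + 2 * \<epsilon> * (w + \<epsilon>)"
      using evi[of 1] by (simp add: power2_eq_square algebra_simps)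
  next
    case 2
    have eqs: "(1 - \<epsilon> / w) * w\<^sup>2 = w\<^sup>2 - \<epsilon> * w" "\<epsilon>\<^sup>2 / (\<epsilon> / w) = \<epsilon> * w"
      using 2 by (simp_all add: power2_eq_square field_simps)
    have "0 < \<epsilon> / w" "\<epsilon> / w \<le> 1"
      using 2 by auto
    from evi[OF this] have "2 * \<tau> * (a - b) \<le> (W2 \<mu> \<nu>)\<^sup>2 - w\<^sup>2 + 2 * \<epsilon> * w"
      unfolding eqs by simp
    then show "2 * \<tau> * (a - b) \<le> (W2 \<mu> \<nu>)\<^sup>2 - w\<^sup>2 + 2 * \<epsilon> * (w + \<epsilon>)"
      using zero_le_power2[of \<epsilon>] unfolding distrib_left power2_eq_square by linarith
  next
    \<comment> \<open>The balanced parameter would be 0, which is not admissible; without error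
      \<open>s\<close> may instead be sent to 0.\<close>
    case 3
    have "2 * \<tau> * (a - b) \<le> (W2 \<mu> \<nu>)\<^sup>2 - w\<^sup>2"
    proof (rule field_le_epsilon)
      fix e :: real assume "e > 0"
      define s where "s = min 1 (e / (w\<^sup>2 + 1))"
      have pos: "0 < w\<^sup>2 + 1"
        using zero_le_power2[of w] by linarith
      then have s: "0 < s" "s \<le> 1"
        using \<open>e > 0\<close> by (auto simp: s_def)
      have "s * w\<^sup>2 \<le> e / (w\<^sup>2 + 1) * (w\<^sup>2 + 1)"
        using \<open>e > 0\<close> pos by (intro mult_mono) (auto simp: s_def)
      then have "s * w\<^sup>2 \<le> e"
        using pos by simp
      then show "2 * \<tau> * (a - b) \<le> (W2 \<mu> \<nu>)\<^sup>2 - w\<^sup>2 + e"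
        using evi[OF s] 3 by (simp add: algebra_simps)
    qed
    then show "2 * \<tau> * (a - b) \<le> (W2 \<mu> \<nu>)\<^sup>2 - w\<^sup>2 + 2 * \<epsilon> * (w + \<epsilon>)"
      using 3 by simp
  qed
qed

text \<open>With \<nu> = \<mu> and \<open>s = 1\<close> every distance disappears from the
  variational inequality.\<close>

lemma approximate_step_descent:
  assumes "G m = ereal a" "G \<mu> = ereal b"
  shows "2 * \<tau> * (a - b) \<le> \<epsilon>\<^sup>2"
  using approximate_step_evi[OF \<mu> zero_less_one order_refl assms] wasserstein_self_P2[OF \<mu>] by simp

text \<open>For a minimizer the left side of the quasi-Fejer inequality is nonnegative. Completing
  the square gives \<open>(W2 m \<nu> - \<epsilon>)\<^sup>2 \<le> (W2 \<mu> \<nu>)\<^sup>2 + 3 *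
  \<epsilon>\<^sup>2\<close>, and the right side is at most
  \<open>(W2 \<mu> \<nu> + 2 * \<epsilon>)\<^sup>2\<close>.\<close>

lemma approximate_step_dist_argmin:
  assumes "\<nu> \<in> argmin_P2 G"
  shows "W2 m \<nu> \<le> W2 \<mu> \<nu> + 3 * \<epsilon>"
proof (rule ccontr)
  assume "\<not> ?thesis"
  then have "W2 \<mu> \<nu> + 2 * \<epsilon> < W2 m \<nu> - \<epsilon>"
    by simp
  then have "(W2 \<mu> \<nu> + 2 * \<epsilon>)\<^sup>2 < (W2 m \<nu> - \<epsilon>)\<^sup>2"
    using W2_nonneg[of \<mu> \<nu>] \<epsilon> by (intro power_strict_mono) auto
  then have lt: "(W2 \<mu> \<nu>)\<^sup>2 + 4 * (W2 \<mu> \<nu> * \<epsilon>) + 4 * \<epsilon>\<^sup>2 < (W2 m \<nu>)\<^sup>2 - 2 * (W2 m \<nu> * \<epsilon>) + \<epsilon>\<^sup>2"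
    by (simp add: power2_eq_square algebra_simps)
  have "0 \<le> W2 \<mu> \<nu> * \<epsilon>"
    using W2_nonneg[of \<mu> \<nu>] \<epsilon> by auto
  obtain h where h: "G m = ereal h"
    by (rule approximate_step_G_finite)
  have \<nu>: "\<nu> \<in> P2" "G \<nu> = ereal Gmin"
    using assms by (auto simp: argmin_P2_iff)
  have "0 \<le> 2 * \<tau> * (h - Gmin)"
    using Gmin_le[OF m] h \<tau> by simp
  then have "0 \<le> (W2 \<mu> \<nu>)\<^sup>2 - (W2 m \<nu>)\<^sup>2 + 2 * \<epsilon> * (W2 m \<nu> + \<epsilon>)"
    using approximate_step_quasi_fejer[OF \<nu>(1) h \<nu>(2)] by linarith
  then have "0 \<le> (W2 \<mu> \<nu>)\<^sup>2 - (W2 m \<nu>)\<^sup>2 + 2 * (W2 m \<nu> * \<epsilon>) + 2 * \<epsilon>\<^sup>2"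
    by (simp add: power2_eq_square algebra_simps)
  then show False
    using lt \<open>0 \<le> W2 \<mu> \<nu> * \<epsilon>\<close> zero_le_power2[of \<epsilon>] by linarith
qed

end

text \<open>The exact step \<open>\<rho>\<close> from \<open>\<mu>\<close>, tested against \<open>m n\<close>, contradicts the Opial property unless \<open>\<rho> = \<mu>\<close>.\<close>

lemma narrow_limit_of_minimizing_sequence:
  assumes m: "\<And>n. m n \<in> P2" and C: "\<And>n. (\<integral>x. (norm x)\<^sup>2 \<partial>m n) \<le> C"
    and \<mu>: "\<mu> \<in> P2" and conv: "narrow_conv m \<mu>"
    and G: "\<And>n. G (m n) = ereal (a n)" and lim: "a \<longlonglongrightarrow> Gmin"
  shows "\<mu> \<in> argmin_P2 G"
proof -
  \<comment> \<open>Any step size in the admissible range would do; this is the middle of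
    it.\<close>
  define \<tau> where "\<tau> = 1 / (2 * L)"
  have \<tau>: "0 < \<tau>" "\<tau> * L < 1"
    using L_pos by (simp_all add: \<tau>_def)
  define \<rho> where "\<rho> = J \<tau> H (distr \<mu> borel (forward \<tau>))"
  have \<rho>: "\<rho> \<in> P2"
    using J_is_arg_min[OF \<mu> \<tau>] by (simp add: is_arg_min_def \<rho>_def)
  have step: "approximate_step \<tau> 0 \<mu> \<rho>"
    by (simp add: approximate_step_def \<rho>_def Let_def)
  obtain g where g: "G \<rho> = ereal g"
    by (rule approximate_step_G_finite[OF \<tau> \<mu> \<rho> order_refl step])
  have le: "2 * \<tau> * (g - a n) \<le> (W2 \<mu> (m n))\<^sup>2 - (W2 \<rho> (m n))\<^sup>2" for n
    using approximate_step_quasi_fejer[OF \<tau> \<mu> \<rho> order_refl step m g G] by simp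
  \<comment> \<open>The step from \<mu> brings \<rho> closer to \<open>m n\<close> up to the
    difference of values, whereas Opial's inequality makes \<mu> the asymptotically closer point. In
    the limit the two facts bound the value gap by \<open>- c\<close>.\<close>
  have c_le: "2 * \<tau> * (g - Gmin) \<le> - c" if c: "c < (W2 \<mu> \<rho>)\<^sup>2" for c
  proof (rule LIMSEQ_le_const2)
    show "(\<lambda>n. 2 * \<tau> * (g - a n)) \<longlonglongrightarrow> 2 * \<tau> * (g - Gmin)"
      by (intro tendsto_intros lim)
    have "\<forall>\<^sub>F n in sequentially. 2 * \<tau> * (g - a n) \<le> - c"
      using opial_P2[OF m C \<mu> \<rho> conv c]
    proof eventually_elim
      case (elim n)
      then show ?case
        using le[of n] wasserstein_commute_P2[OF \<mu> m] wasserstein_commute_P2[OF \<rho> m] by simp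
    qed
    then show "\<exists>N. \<forall>n\<ge>N. 2 * \<tau> * (g - a n) \<le> - c"
      by (simp add: eventually_sequentially)
  qed
  have "Gmin \<le> g"
    using Gmin_le[OF \<rho>] g by simp
  then have nonneg: "0 \<le> 2 * \<tau> * (g - Gmin)"
    using \<tau> by simp
  have "(W2 \<mu> \<rho>)\<^sup>2 \<le> 0"
    using c_le[of "(W2 \<mu> \<rho>)\<^sup>2 / 2"] nonneg by (cases "(W2 \<mu> \<rho>)\<^sup>2 \<le> 0") auto
  then have eq: "\<mu> = \<rho>"
    by (rule wasserstein_eq_0_P2[OF \<mu> \<rho>])
  have "2 * \<tau> * (g - Gmin) \<le> 0"
  proof (rule field_le_epsilon)
    fix e :: real assume "e > 0"
    then show "2 * \<tau> * (g - Gmin) \<le> 0 + e"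
      using c_le[of "- e"] zero_le_power2[of "W2 \<mu> \<rho>"] by linarith
  qed
  then have "g = Gmin"
    using \<open>Gmin \<le> g\<close> \<tau> by (simp add: mult_le_0_iff)
  then show ?thesis
    using \<rho> g by (simp add: argmin_P2_iff eq)
qed

end

section \<open>Rates and convergence of the iterates\<close>

text \<open>Subtracting the partial sums of the errors leaves a decreasing sequence bounded
  below.\<close>

lemma convergent_quasi_decreasing:
  fixes D e :: "nat \<Rightarrow> real"
  assumes D: "\<And>n. 0 \<le> D n" and step: "\<And>n. D (Suc n) \<le> D n + e n" and e: "\<And>n. 0 \<le> e n" "summable e"
  shows "convergent D"
proof -
  define S where "S n = (\<Sum>i<n. e i)" for n
  have S: "S \<longlonglongrightarrow> suminf e"
    unfolding S_def by (rule summable_LIMSEQ[OF e(2)])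
  have "decseq (\<lambda>n. D n - S n)"
    using step by (intro decseq_SucI) (simp add: S_def algebra_simps)
  moreover have "- suminf e \<le> D n - S n" for n
    using D[of n] sum_le_suminf[OF e(2), of "{..<n}"] e(1) by (simp add: S_def)
  ultimately obtain d where "(\<lambda>n. D n - S n) \<longlonglongrightarrow> d"
    using decseq_convergent[of "\<lambda>n. D n - S n" "- suminf e"] by blast
  from tendsto_add[OF this S] show ?thesis
    by (auto simp: convergent_def)
qed

locale forward_backward_iteration = forward_backward +
  fixes \<epsilon> \<tau> \<sigma> :: "nat \<Rightarrow> real" and \<mu> :: "nat \<Rightarrow> 'a measure"
  assumes \<epsilon>: "\<And>n. 0 \<le> \<epsilon> n" "summable \<epsilon>"
    and \<tau>: "\<And>n. 0 < \<tau> n" "\<And>n. \<tau> n * L < 1"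
    and \<sigma>_def: "\<And>n. \<sigma> n = (\<Sum>i<n. \<tau> i)" and \<sigma>_top: "filterlim \<sigma> at_top sequentially"
    and \<mu>: "\<And>n. \<mu> n \<in> P2"
    and step: "\<And>n. approximate_step (\<tau> n) (\<epsilon> n) (\<mu> n) (\<mu> (Suc n))"
begin

text \<open>\<open>G (\<mu> 0)\<close> may be infinite, and \<open>real_of_ereal\<close> then
  returns 0, so \<open>gap 0\<close> carries no meaning in general. From index 1 on the value is
  finite, because an approximate proximal step has finite \<open>H\<close>.\<close>

definition gap :: "nat \<Rightarrow> real" where
  "gap n = real_of_ereal (G (\<mu> n)) - Gmin"

lemma G_iterate_Suc: "G (\<mu> (Suc n)) = ereal (Gmin + gap (Suc n))"
  by (rule approximate_step_G_finite[OF \<tau> \<mu> \<mu> \<epsilon>(1) step, of n]) (simp add: gap_def)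

lemma G_iterate: "n > 0 \<Longrightarrow> G (\<mu> n) = ereal (Gmin + gap n)"
  using G_iterate_Suc[of "n - 1"] by simp

lemma gap_nonneg: "0 \<le> gap (Suc n)"
  using Gmin_le[OF \<mu>[of "Suc n"]] G_iterate_Suc by simp

lemma \<sigma>_Suc: "\<sigma> (Suc n) = \<sigma> n + \<tau> n"
  by (simp add: \<sigma>_def)

lemma \<sigma>_nonneg: "0 \<le> \<sigma> n"
  unfolding \<sigma>_def using \<tau>(1) by (intro sum_nonneg) (simp add: less_imp_le)

lemma \<sigma>_pos: "0 < n \<Longrightarrow> 0 < \<sigma> n"
  using \<sigma>_Suc[of "n - 1"] \<sigma>_nonneg[of "n - 1"] \<tau>(1)[of "n - 1"] by simp

lemma \<epsilon>_bounded: obtains E where "\<And>n. \<epsilon> n \<le> E"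
proof -
  have "Bseq \<epsilon>"
    using summable_LIMSEQ_zero[OF \<epsilon>(2)] by (rule convergent_imp_Bseq[OF convergentI])
  then obtain E where "\<And>n. norm (\<epsilon> n) \<le> E"
    unfolding Bseq_def by blast
  then have "\<epsilon> n \<le> E" for n
    using abs_ge_self[of "\<epsilon> n"] by (metis order_trans real_norm_def)
  then show ?thesis
    by (rule that)
qed

lemma convergent_dist_argmin:
  assumes "\<nu> \<in> argmin_P2 G"
  shows "convergent (\<lambda>n. W2 (\<mu> n) \<nu>)"
proof (rule convergent_quasi_decreasing[where e = "\<lambda>n. 3 * \<epsilon> n"])
  show "W2 (\<mu> (Suc n)) \<nu> \<le> W2 (\<mu> n) \<nu> + 3 * \<epsilon> n" for n
    by (rule approximate_step_dist_argmin[OF \<tau> \<mu> \<mu> \<epsilon>(1) step assms])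
qed (use \<epsilon> W2_nonneg in auto)

text \<open>The quasi-Fejer inequality against a minimizer telescopes. Its error is linear in
  \<epsilon> with bounded coefficient \<open>K + E\<close>, since the distances to that minimizer
  converge.\<close>

lemma weighted_gap_sum_bounded:
  obtains C where "\<And>n. (\<Sum>i<n. \<tau> i * gap (Suc i)) \<le> C"
proof -
  obtain \<nu> where \<nu>: "\<nu> \<in> argmin_P2 G"
    using argmin_nonempty by blast
  then have \<nu>': "\<nu> \<in> P2" "G \<nu> = ereal Gmin"
    by (auto simp: argmin_P2_iff)
  obtain E where E: "\<And>n. \<epsilon> n \<le> E"
    using \<epsilon>_bounded by blast
  have "Bseq (\<lambda>n. W2 (\<mu> n) \<nu>)"
    by (rule convergent_imp_Bseq[OF convergent_dist_argmin[OF \<nu>]])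
  then obtain K where K: "\<And>n. norm (W2 (\<mu> n) \<nu>) \<le> K"
    unfolding Bseq_def by blast
  then have K: "W2 (\<mu> n) \<nu> \<le> K" for n
    by (simp add: abs_le_iff)
  have KE: "0 \<le> K + E"
    using K[of 0] E[of 0] W2_nonneg[of "\<mu> 0" \<nu>] \<epsilon>(1)[of 0] by linarith
  have one: "\<tau> n * gap (Suc n) \<le> (W2 (\<mu> n) \<nu>)\<^sup>2 / 2 - (W2 (\<mu> (Suc n)) \<nu>)\<^sup>2 / 2 + (K + E) * \<epsilon> n" for n
  proof -
    have "2 * \<tau> n * gap (Suc n) \<le> (W2 (\<mu> n) \<nu>)\<^sup>2 - (W2 (\<mu> (Suc n)) \<nu>)\<^sup>2
        + 2 * \<epsilon> n * (W2 (\<mu> (Suc n)) \<nu> + \<epsilon> n)"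
      using approximate_step_quasi_fejer[OF \<tau> \<mu> \<mu> \<epsilon>(1) step \<nu>'(1) G_iterate_Suc \<nu>'(2), of n] by simp
    also have "2 * \<epsilon> n * (W2 (\<mu> (Suc n)) \<nu> + \<epsilon> n) \<le> 2 * \<epsilon> n * (K + E)"
      using K E \<epsilon>(1) by (intro mult_left_mono add_mono) auto
    finally show ?thesis
      by (simp add: algebra_simps)
  qed
  have *: "(\<Sum>i<n. \<tau> i * gap (Suc i)) \<le> (W2 (\<mu> 0) \<nu>)\<^sup>2 / 2 - (W2 (\<mu> n) \<nu>)\<^sup>2 / 2 + (K + E) * (\<Sum>i<n. \<epsilon> i)" for n
  proof (induction n)
    case (Suc n)
    then show ?case
      using one[of n] by (simp add: distrib_left)
  qed simp
  have **: "(K + E) * (\<Sum>i<n. \<epsilon> i) \<le> (K + E) * suminf \<epsilon>" for n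
    using KE \<epsilon> by (intro mult_left_mono sum_le_suminf) auto
  have "(\<Sum>i<n. \<tau> i * gap (Suc i)) \<le> (W2 (\<mu> 0) \<nu>)\<^sup>2 / 2 + (K + E) * suminf \<epsilon>" for n
    using *[of n] **[of n] zero_le_power2[of "W2 (\<mu> n) \<nu>"] by linarith
  then show ?thesis
    by (rule that)
qed

text \<open>The best gap is at most every term of the weighted sum. Finiteness is asserted
  separately because \<open>real_of_ereal\<close> sends infinity to 0, so the rate alone would not
  exclude infinite values.\<close>

lemma best_iterate_rate:
  assumes j: "\<And>n. n \<ge> 1 \<Longrightarrow> is_arg_min (\<lambda>i. G (\<mu> i)) (\<lambda>i. i < n) (j n)"
  shows "\<forall>\<^sub>F n in sequentially. \<bar>G (\<mu> (j n))\<bar> \<noteq> \<infinity>"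
    "(\<lambda>n. real_of_ereal (G (\<mu> (j n)) - (INF \<nu>\<in>P2. G \<nu>))) \<in> O(\<lambda>n. 1 / \<sigma> n)"
proof -
  obtain C where C: "\<And>n. (\<Sum>i<n. \<tau> i * gap (Suc i)) \<le> C"
    using weighted_gap_sum_bounded by blast
  \<comment> \<open>Only from \<open>n = 2\<close> on does the range of candidates contain an
    iterate of positive index, whose value is finite.\<close>
  have best: "\<exists>b. G (\<mu> (j n)) = ereal (Gmin + b) \<and> 0 \<le> b \<and> (\<forall>i. Suc i < n \<longrightarrow> b \<le> gap (Suc i))"
    if n: "n \<ge> 2" for n
  proof -
    have le: "G (\<mu> (j n)) \<le> ereal (Gmin + gap (Suc i))" if "Suc i < n" for i
      using j[of n] n that by (simp add: is_arg_min_linorder flip: G_iterate_Suc)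
    have "ereal Gmin \<le> G (\<mu> (j n))"
      by (rule Gmin_le[OF \<mu>])
    then obtain g where g: "G (\<mu> (j n)) = ereal g"
      using le[of 0] n by (cases "G (\<mu> (j n))") auto
    then show ?thesis
      using le \<open>ereal Gmin \<le> _\<close> by (intro exI[of _ "g - Gmin"]) (auto simp: diff_le_eq add.commute)
  qed
  show "\<forall>\<^sub>F n in sequentially. \<bar>G (\<mu> (j n))\<bar> \<noteq> \<infinity>"
    using eventually_ge_at_top[of 2] by eventually_elim (use best in force)
  show "(\<lambda>n. real_of_ereal (G (\<mu> (j n)) - (INF \<nu>\<in>P2. G \<nu>))) \<in> O(\<lambda>n. 1 / \<sigma> n)"
  proof (rule bigoI)
    \<comment> \<open>The gaps up to index \<open>n - 1\<close> are weighted by the step before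
      each, so the sum yields the rate with \<open>\<sigma> (n - 1)\<close>. Once
      \<open>\<sigma> n\<close> reaches \<open>2 / L\<close>, the last step is at most half of
      \<open>\<sigma> n\<close>, and passing to \<open>\<sigma> n\<close> costs a factor 2.\<close>
    have "\<forall>\<^sub>F n in sequentially. 2 / L \<le> \<sigma> n"
      using \<sigma>_top by (auto simp: filterlim_at_top)
    then show "\<forall>\<^sub>F n in sequentially. norm (real_of_ereal (G (\<mu> (j n)) - (INF \<nu>\<in>P2. G \<nu>)))
        \<le> (2 * C) * norm (1 / \<sigma> n)"
      using eventually_ge_at_top[of 2]
    proof eventually_elim
      case (elim n)
      from best[OF elim(2)] obtain b where b: "G (\<mu> (j n)) = ereal (Gmin + b)" "0 \<le> b"
        and le: "\<And>i. Suc i < n \<Longrightarrow> b \<le> gap (Suc i)"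
        by blast
      define k where "k = n - 1"
      have n: "n = Suc k"
        using elim(2) by (simp add: k_def)
      have "\<tau> k < 1 / L"
        using \<tau>(2)[of k] L_pos by (simp add: pos_less_divide_eq)
      then have "\<sigma> n \<le> 2 * \<sigma> k"
        using elim(1) by (simp add: n \<sigma>_Suc)
      then have "b * \<sigma> n \<le> b * (2 * \<sigma> k)"
        using b(2) by (intro mult_left_mono) auto
      also have "\<dots> = 2 * (\<Sum>i<k. \<tau> i * b)"
        by (simp add: \<sigma>_def sum_distrib_left mult_ac)
      also have "(\<Sum>i<k. \<tau> i * b) \<le> (\<Sum>i<k. \<tau> i * gap (Suc i))"
        using le \<tau>(1) by (intro sum_mono mult_left_mono) (auto simp: n less_imp_le)
      also have "\<dots> \<le> C"
        by (rule C)
      finally have "b * \<sigma> n \<le> 2 * C"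
        by simp
      moreover have "0 < \<sigma> n"
        using elim(2) by (intro \<sigma>_pos) auto
      ultimately have "b \<le> 2 * C / \<sigma> n"
        by (simp add: pos_le_divide_eq)
      then show ?case
        using b \<open>0 < \<sigma> n\<close> by (simp add: INF_G)
    qed
  qed
qed

text \<open>The quantity \<open>\<sigma> n * gap n\<close> is nearly monotone. Raising the index of
  \<sigma> adds \<open>\<tau> n * gap (Suc n)\<close>, whose sum is already bounded; raising the
  index of the gap costs \<open>\<sigma> n * (\<epsilon> n)\<^sup>2 / (2 * \<tau> n)\<close>,
  summable by assumption since \<epsilon> is bounded.\<close>

lemma gap_bound:
  assumes "summable (\<lambda>n. \<sigma> n / \<tau> n * \<epsilon> n)"
  obtains B where "\<And>n. \<sigma> (Suc n) * gap (Suc n) \<le> B"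
proof -
  obtain C where C: "\<And>n. (\<Sum>i<n. \<tau> i * gap (Suc i)) \<le> C"
    using weighted_gap_sum_bounded by blast
  obtain E where E: "\<And>n. \<epsilon> n \<le> E"
    using \<epsilon>_bounded by blast
  have nonneg: "0 \<le> \<sigma> n / \<tau> n * \<epsilon> n" for n
    using \<sigma>_nonneg \<tau>(1) \<epsilon>(1) by (simp add: less_imp_le)
  have E0: "0 \<le> E"
    using E[of 0] \<epsilon>(1)[of 0] by linarith
  have descent: "\<sigma> n * gap (Suc n) \<le> \<sigma> n * gap n + E / 2 * (\<sigma> n / \<tau> n * \<epsilon> n)" for n
  proof (cases "n = 0")
    case True
    then show ?thesis by (simp add: \<sigma>_def)
  next
    case False
    have "2 * \<tau> n * (gap (Suc n) - gap n) \<le> (\<epsilon> n)\<^sup>2"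
      using approximate_step_descent[OF \<tau> \<mu> \<mu> \<epsilon>(1) step G_iterate_Suc G_iterate, of n] False by simp
    also have "(\<epsilon> n)\<^sup>2 \<le> E * \<epsilon> n"
      unfolding power2_eq_square using E \<epsilon>(1) by (intro mult_right_mono) auto
    finally have "gap (Suc n) - gap n \<le> E * \<epsilon> n / (2 * \<tau> n)"
      using \<tau>(1)[of n] by (simp add: pos_le_divide_eq mult_ac)
    then have "\<sigma> n * (gap (Suc n) - gap n) \<le> \<sigma> n * (E * \<epsilon> n / (2 * \<tau> n))"
      using \<sigma>_nonneg by (intro mult_left_mono)
    then show ?thesis
      by (simp add: algebra_simps)
  qed
  have "\<sigma> n * gap n \<le> E / 2 * (\<Sum>i<n. \<sigma> i / \<tau> i * \<epsilon> i) + (\<Sum>i<n. \<tau> i * gap (Suc i))" for n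
  proof (induction n)
    case 0
    then show ?case by (simp add: \<sigma>_def)
  next
    case (Suc n)
    have "\<sigma> (Suc n) * gap (Suc n) = \<sigma> n * gap (Suc n) + \<tau> n * gap (Suc n)"
      by (simp add: \<sigma>_Suc distrib_right)
    then show ?case
      using Suc descent[of n] unfolding sum.lessThan_Suc distrib_left by linarith
  qed
  moreover have "E / 2 * (\<Sum>i<n. \<sigma> i / \<tau> i * \<epsilon> i) \<le> E / 2 * (\<Sum>i. \<sigma> i / \<tau> i * \<epsilon> i)" for n
    using E0 nonneg by (intro mult_left_mono sum_le_suminf assms) auto
  ultimately have "\<sigma> n * gap n \<le> E / 2 * (\<Sum>i. \<sigma> i / \<tau> i * \<epsilon> i) + C" for n
    using C[of n] by (meson add_mono order_trans)
  then show ?thesis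
    by (rule that)
qed

lemma last_iterate_rate:
  assumes "summable (\<lambda>n. \<sigma> n / \<tau> n * \<epsilon> n)"
  shows "\<forall>\<^sub>F n in sequentially. \<bar>G (\<mu> n)\<bar> \<noteq> \<infinity>"
    "(\<lambda>n. real_of_ereal (G (\<mu> n) - (INF \<nu>\<in>P2. G \<nu>))) \<in> O(\<lambda>n. 1 / \<sigma> n)"
    "(\<lambda>n. gap (Suc n)) \<longlonglongrightarrow> 0"
proof -
  obtain B where B: "\<And>n. \<sigma> (Suc n) * gap (Suc n) \<le> B"
    using gap_bound[OF assms] by blast
  have gap_le: "gap (Suc n) \<le> B / \<sigma> (Suc n)" for n
    using B[of n] \<sigma>_pos[of "Suc n"] by (simp add: pos_le_divide_eq mult.commute)
  show "\<forall>\<^sub>F n in sequentially. \<bar>G (\<mu> n)\<bar> \<noteq> \<infinity>"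
    using eventually_gt_at_top[of 0] by eventually_elim (simp add: G_iterate)
  show "(\<lambda>n. real_of_ereal (G (\<mu> n) - (INF \<nu>\<in>P2. G \<nu>))) \<in> O(\<lambda>n. 1 / \<sigma> n)"
  proof (rule bigoI)
    show "\<forall>\<^sub>F n in sequentially. norm (real_of_ereal (G (\<mu> n) - (INF \<nu>\<in>P2. G \<nu>))) \<le> B * norm (1 / \<sigma> n)"
      using eventually_gt_at_top[of 0]
    proof eventually_elim
      case (elim n)
      then show ?case
        using gap_le[of "n - 1"] gap_nonneg[of "n - 1"] \<sigma>_pos[OF elim] by (simp add: G_iterate INF_G)
    qed
  qed
  have "filterlim (\<lambda>n. \<sigma> (Suc n)) at_top sequentially"
    using \<sigma>_top by (simp add: filterlim_sequentially_Suc)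
  then have "(\<lambda>n. B / \<sigma> (Suc n)) \<longlonglongrightarrow> 0"
    by (rule tendsto_divide_0[OF tendsto_const filterlim_at_top_imp_at_infinity])
  then show "(\<lambda>n. gap (Suc n)) \<longlonglongrightarrow> 0"
    by (rule tendsto_sandwich[OF _ _ tendsto_const, rotated -1]) (use gap_le gap_nonneg in auto)
qed

lemma second_moments_bounded:
  obtains C where "\<And>n. (\<integral>x. (norm x)\<^sup>2 \<partial>\<mu> n) \<le> C"
proof -
  obtain \<nu> where \<nu>: "\<nu> \<in> argmin_P2 G" "\<nu> \<in> P2"
    using argmin_nonempty argmin_P2_iff by blast
  have "Bseq (\<lambda>n. W2 (\<mu> n) \<nu>)"
    by (rule convergent_imp_Bseq[OF convergent_dist_argmin[OF \<nu>(1)]])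
  then obtain K where K: "\<And>n. norm (W2 (\<mu> n) \<nu>) \<le> K"
    unfolding Bseq_def by blast
  have "(W2 (\<mu> n) \<nu>)\<^sup>2 \<le> K\<^sup>2" for n
    using power_mono[OF K norm_ge_zero, of n 2] by simp
  then have "(\<integral>x. (norm x)\<^sup>2 \<partial>\<mu> n) \<le> 2 * K\<^sup>2 + 2 * (\<integral>x. (norm x)\<^sup>2 \<partial>\<nu>)" for n
    using second_moment_le_wasserstein[OF \<mu> \<nu>(2), of n] by (smt (verit))
  then show ?thesis
    by (rule that)
qed

text \<open>Distances to both minimizers converge along the whole sequence, so their squares have a
  limiting difference. Opial's inequality along the two subsequences bounds this number below by the
  squared distance of the limits and above by its negative.\<close>

lemma narrow_limits_argmin_unique:
  assumes r: "strict_mono (r1 :: nat \<Rightarrow> nat)" "strict_mono (r2 :: nat \<Rightarrow> nat)"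
    and \<nu>: "\<nu>1 \<in> argmin_P2 G" "\<nu>2 \<in> argmin_P2 G"
    and conv: "narrow_conv (\<lambda>n. \<mu> (r1 n)) \<nu>1" "narrow_conv (\<lambda>n. \<mu> (r2 n)) \<nu>2"
  shows "\<nu>1 = \<nu>2"
proof -
  have P: "\<nu>1 \<in> P2" "\<nu>2 \<in> P2"
    using \<nu> by (auto simp: argmin_P2_iff)
  obtain C where C: "\<And>n. (\<integral>x. (norm x)\<^sup>2 \<partial>\<mu> n) \<le> C"
    using second_moments_bounded by blast
  obtain l1 l2 where "(\<lambda>n. W2 (\<mu> n) \<nu>1) \<longlonglongrightarrow> l1" "(\<lambda>n. W2 (\<mu> n) \<nu>2) \<longlonglongrightarrow> l2"
    using convergent_dist_argmin \<nu> by (meson convergent_def)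
  then have lim: "(\<lambda>n. (W2 (\<mu> n) \<nu>2)\<^sup>2 - (W2 (\<mu> n) \<nu>1)\<^sup>2) \<longlonglongrightarrow> l2\<^sup>2 - l1\<^sup>2"
    by (intro tendsto_intros)
  have ge1: "c \<le> l2\<^sup>2 - l1\<^sup>2" if "c < (W2 \<nu>1 \<nu>2)\<^sup>2" for c
    using opial_P2[OF \<mu> C P conv(1) that] LIMSEQ_subseq_LIMSEQ[OF lim r(1)]
    by (intro tendsto_lowerbound[of _ "l2\<^sup>2 - l1\<^sup>2" sequentially c]) (auto simp: o_def elim: eventually_mono)
  have ge2: "c \<le> l1\<^sup>2 - l2\<^sup>2" if "c < (W2 \<nu>2 \<nu>1)\<^sup>2" for c
    using opial_P2[OF \<mu> C P(2,1) conv(2) that] tendsto_minus[OF LIMSEQ_subseq_LIMSEQ[OF lim r(2)]]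
    by (intro tendsto_lowerbound[of _ "l1\<^sup>2 - l2\<^sup>2" sequentially c]) (auto simp: o_def elim: eventually_mono)
  have "(W2 \<nu>1 \<nu>2)\<^sup>2 \<le> 0"
  proof (rule ccontr)
    assume "\<not> ?thesis"
    moreover from this have "(W2 \<nu>1 \<nu>2)\<^sup>2 / 2 < (W2 \<nu>1 \<nu>2)\<^sup>2"
      by simp
    ultimately show False
      using ge1[of "(W2 \<nu>1 \<nu>2)\<^sup>2 / 2"] ge2[of "(W2 \<nu>1 \<nu>2)\<^sup>2 / 2"]
      unfolding wasserstein_commute_P2[OF P(2,1)] by linarith
  qed
  then show ?thesis
    by (rule wasserstein_eq_0_P2[OF P])
qed

lemma iterates_converge:
  assumes "summable (\<lambda>n. \<sigma> n / \<tau> n * \<epsilon> n)"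
  shows "\<exists>\<mu>s\<in>argmin_P2 G. limitin tau_w2 \<mu> \<mu>s sequentially \<and>
    (\<forall>p\<in>{1..<2}. (\<lambda>n. wasserstein p (\<mu> n) \<mu>s) \<longlonglongrightarrow> 0)"
proof -
  obtain C where C: "\<And>n. (\<integral>x. (norm x)\<^sup>2 \<partial>\<mu> n) \<le> C"
    using second_moments_bounded by blast
  have cluster: "\<rho> \<in> argmin_P2 G"
    if r: "strict_mono r" and \<rho>: "\<rho> \<in> P2" and conv: "narrow_conv (\<lambda>n. \<mu> (r n)) \<rho>"
    for r :: "nat \<Rightarrow> nat" and \<rho>
  proof (rule narrow_limit_of_minimizing_sequence)
    \<comment> \<open>The subsequence may start at index 0, where \<open>G\<close> may be infinite;
      dropping its first term makes all values real.\<close>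
    have suc: "strict_mono Suc"
      by (simp add: strict_mono_def)
    have r': "strict_mono (\<lambda>n. r (Suc n))"
      using strict_mono_o[OF r suc] by (simp add: o_def)
    show "narrow_conv (\<lambda>n. \<mu> (r (Suc n))) \<rho>"
      using narrow_conv_subseq[OF conv suc] .
    have pos: "0 < r (Suc n)" for n
      using seq_suble[OF r, of "Suc n"] by simp
    then show "G (\<mu> (r (Suc n))) = ereal (Gmin + gap (r (Suc n)))" for n
      by (rule G_iterate)
    have "gap \<longlonglongrightarrow> 0"
      using last_iterate_rate(3)[OF assms] by (simp add: filterlim_sequentially_Suc)
    from LIMSEQ_subseq_LIMSEQ[OF this r'] have "(\<lambda>n. gap (r (Suc n))) \<longlonglongrightarrow> 0"
      by (simp add: o_def)
    from tendsto_add[OF tendsto_const this, of Gmin]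
    show "(\<lambda>n. Gmin + gap (r (Suc n))) \<longlonglongrightarrow> Gmin"
      by simp
  qed (use \<mu> C \<rho> in auto)
  obtain r \<mu>s where r: "strict_mono (r :: nat \<Rightarrow> nat)" "\<mu>s \<in> P2" "narrow_conv (\<lambda>n. \<mu> (r n)) \<mu>s"
    by (rule skorohod_subsequence[of \<mu>, OF \<mu> C]) blast
  have \<mu>s: "\<mu>s \<in> argmin_P2 G"
    by (rule cluster[OF r])
  have "\<rho> = \<mu>s" if "strict_mono r'" "\<rho> \<in> P2" "narrow_conv (\<lambda>n. \<mu> (r' n)) \<rho>"
    for r' :: "nat \<Rightarrow> nat" and \<rho>
    using narrow_limits_argmin_unique[OF that(1) r(1) cluster[OF that] \<mu>s that(3) r(3)] .
  from tendsto_P2[OF \<mu> C r(2) this] show ?thesis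
    using \<mu>s by (intro bexI[of _ \<mu>s]) auto
qed

end

theorem theorem4p10:
  fixes F :: "'a::euclidean_space \<Rightarrow> real" and gradF :: "'a \<Rightarrow> 'a"
    and H G :: "'a measure \<Rightarrow> ereal"
    and L l :: real and \<epsilon> \<tau> \<sigma> :: "nat \<Rightarrow> real"
    and \<mu> \<eta> :: "nat \<Rightarrow> 'a measure"
  assumes "convex_on UNIV F"
    and "\<And>x. GDERIV F x :> gradF x"
    and "L > 0" and "L-lipschitz_on UNIV gradF"
    and "l \<ge> 0" and "strongly_convex l F"
    and "proper_on_P2 H" and "lsc_W2 H" and "convex_along_generalized_geodesics H"
    and "effective_domain H \<subseteq> P2r"
    and G_def: "\<And>\<nu>. G \<nu> = ereal (\<integral>x. F x \<partial>\<nu>) + H \<nu>"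
    and "argmin_P2 G \<noteq> {}"
    and "\<And>n. \<epsilon> n \<ge> 0" and "summable \<epsilon>"
    and "\<And>n. 0 < \<tau> n \<and> \<tau> n < 1 / L"
    and "filterlim (\<lambda>n. \<Sum>i<n. \<tau> i) at_top sequentially"
    and "(SUP i. \<tau> i) < 1 / L"
    and \<sigma>_def: "\<And>n. \<sigma> n = (\<Sum>i<n. \<tau> i)"
    and "\<And>n. \<mu> n \<in> P2" and "\<And>n. \<eta> n \<in> P2"
    and "\<And>n. \<eta> n = distr (\<mu> n) borel (\<lambda>x. x - \<tau> n *\<^sub>R gradF x)"
    and "\<And>n. H (\<mu> (Suc n)) + ereal (1 / (2 * \<tau> n) * (wasserstein 2 (\<mu> (Suc n)) (\<eta> n))\<^sup>2)
        \<le> H (J (\<tau> n) H (\<eta> n))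
          + ereal (1 / (2 * \<tau> n) * (wasserstein 2 (J (\<tau> n) H (\<eta> n)) (\<eta> n))\<^sup>2)
          + ereal ((\<epsilon> n)\<^sup>2 / (2 * \<tau> n))"
  shows "(\<forall>j :: nat \<Rightarrow> nat. (\<forall>n\<ge>1. is_arg_min (\<lambda>i. G (\<mu> i)) (\<lambda>i. i < n) (j n)) \<longrightarrow>
        (\<forall>\<^sub>F n in sequentially. \<bar>G (\<mu> (j n))\<bar> \<noteq> \<infinity>) \<and>
        (\<lambda>n. real_of_ereal (G (\<mu> (j n)) - (INF \<nu>\<in>P2. G \<nu>))) \<in> O(\<lambda>n. 1 / \<sigma> n)) \<and>
    (summable (\<lambda>n. \<sigma> n / \<tau> n * \<epsilon> n) \<longrightarrow>
        (\<forall>\<^sub>F n in sequentially. \<bar>G (\<mu> n)\<bar> \<noteq> \<infinity>) \<and>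
        (\<lambda>n. real_of_ereal (G (\<mu> n) - (INF \<nu>\<in>P2. G \<nu>))) \<in> O(\<lambda>n. 1 / \<sigma> n) \<and>
        (\<exists>\<mu>s\<in>argmin_P2 G. limitin tau_w2 \<mu> \<mu>s sequentially \<and>
          (\<forall>p\<in>{1..<2}. (\<lambda>n. wasserstein p (\<mu> n) \<mu>s) \<longlonglongrightarrow> 0)))"
proof -
  interpret forward_backward H F gradF L G
    by unfold_locales (use assms in auto)
  have \<eta>: "distr (\<mu> n) borel (forward (\<tau> n)) = \<eta> n" for n
    using assms(21) by (simp add: forward_def[abs_def])
  interpret forward_backward_iteration H F gradF L G \<epsilon> \<tau> \<sigma> \<mu>
  proof unfold_locales
    show "\<tau> n * L < 1" for n
      using assms(15)[of n] \<open>L > 0\<close> by (simp add: pos_less_divide_eq)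
    show "filterlim \<sigma> at_top sequentially"
      using assms(16) by (simp add: \<sigma>_def[abs_def])
    show "approximate_step (\<tau> n) (\<epsilon> n) (\<mu> n) (\<mu> (Suc n))" for n
      using assms(22)[of n] by (simp only: approximate_step_def Let_def \<eta> prox_objective_def)
  qed (use assms in auto)
  show ?thesis
  proof (intro conjI allI impI)
    fix j :: "nat \<Rightarrow> nat"
    assume "\<forall>n\<ge>1. is_arg_min (\<lambda>i. G (\<mu> i)) (\<lambda>i. i < n) (j n)"
    then show "\<forall>\<^sub>F n in sequentially. \<bar>G (\<mu> (j n))\<bar> \<noteq> \<infinity>"
      "(\<lambda>n. real_of_ereal (G (\<mu> (j n)) - (INF \<nu>\<in>P2. G \<nu>))) \<in> O(\<lambda>n. 1 / \<sigma> n)"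
      using best_iterate_rate[of j] by simp_all
  next
    assume sum: "summable (\<lambda>n. \<sigma> n / \<tau> n * \<epsilon> n)"
    show "\<forall>\<^sub>F n in sequentially. \<bar>G (\<mu> n)\<bar> \<noteq> \<infinity>"
      "(\<lambda>n. real_of_ereal (G (\<mu> n) - (INF \<nu>\<in>P2. G \<nu>))) \<in> O(\<lambda>n. 1 / \<sigma> n)"
      by (rule last_iterate_rate[OF sum])+
    show "\<exists>\<mu>s\<in>argmin_P2 G. limitin tau_w2 \<mu> \<mu>s sequentially \<and>
        (\<forall>p\<in>{1..<2}. (\<lambda>n. wasserstein p (\<mu> n) \<mu>s) \<longlonglongrightarrow> 0)"
      by (rule iterates_converge[OF sum])
  qed
qed

end
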